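(* Let $n,m,N$ be positive integers and let $A\in c_0(\mathbb{Z}^n)^N$ be an index set. Then the closure of the outer cone satisfies $\overline{C^{\mathrm{out}}_{\infty,\infty}}(A)=C(A)$, where $C(A)\subset\mathbb{C}^N$ is the Sobolev moment cone.
   Context: Setting. $T^n=\mathbb{R}^n/\mathbb{Z}^n$ is the unit torus; for $a\in\mathbb{Z}^n$, $e_a(x):=e^{-2\pi \mathbf{i}\langle a,x\rangle}$, and the Fourier coefficients of $f\in L^2(T^n)$, $f:T^n\to\mathbb{C}$, are $c_a=\langle f,e_a\rangle_{L^2}:=\int_{T^n}f(x)e_a(x)dx$. Put $w_a:=(1+\langle a,a\rangle)^m$ and $\|f\|^2_{H^m(T^n)}:=\sum_{a\in\mathbb{Z}^n}w_a|c_a|^2$. $H^m(T^n)$ is the Sobolev space of functions $f:T^n\to\mathbb{C}$ in $L^2$ with $\|f\|_{H^m(T^n)}<\infty$, and $B:=\{f\in H^m(T^n):\|f\|_{H^m(T^n)}\le1\}$, with the topology inherited from $L^2(T^n)$. "Measure" means non-negative Radon measure (locally finite and tight). $c_0(\mathbb{Z}^n)$ is the set of finite collections $\mathbf a$ of elements of $\mathbb{Z}^n$, repetitions allowed, including $\emptyset$. The algebraic degree $d_{\mathbf a}$ is the number of terms of $\mathbf a$; the harmonic degree is $\delta_{\mathbf a}:=\max_{a\in\mathbf a}\max_i|a_i|$ (and $0$ for $\emptyset$); for $a\in\mathbb{Z}^n$, $\delta_a:=\max_i|a_i|$. Moment cone. $C(A):=\{(y_{\mathbf a})_{\mathbf a\in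 A}: y_{\mathbf a}=\int_B\prod_{a\in\mathbf a}\langle f,e_a\rangle_{L^2}\,d\mu(f)\text{ for some measure }\mu\text{ supported on }B\}$. Outer cone. $\mathbb{C}[c]$ is the ring of complex polynomials in the indeterminates $c=(c_a)_{a\in\mathbb{Z}^n}$ with monomials $c^{\mathbf a}:=\prod_{a\in\mathbf a}c_a$; the squared modulus $|c_a|^2$ is written as the monomial $c_ac_{-a}$, and $q^*$ denotes the Hermitian conjugate of $q\in\mathbb{C}[c]$ (conjugate the coefficients and set $c_a^*=c_{-a}$). The degrees $d(p),\delta(p)$ of a polynomial are the maxima of $d_{\mathbf a},\delta_{\mathbf a}$ over its monomials. $\mathbb{C}[c]_{r,\rho}:=\{p:d(p)\le r,\ \delta(p)\le\rho\}$, $\Sigma_{r,\rho}:=\{\sum_kq_k^*q_k:q_k\in\mathbb{C}[c]_{r,\rho}\}$ (finite sums; $\Sigma_{-1,\rho}:=\{0\}$), $Q_{r,\rho}:=\{s_0+s_1(1-\sum_{a\in\mathbb{Z}^n,\delta_a\le\rho}w_a|c_a|^2):s_0\in\Sigma_{r,\rho},\ s_1\in\Sigma_{r-1,\rho}\}$, and $Q_{\infty,\infty}:=\bigcup_{r,\rho\in\mathbb{N}}Q_{r,\rho}$, where $\mathbb{N}$ includes $0$. For a square-summable family $y=(y_{\mathbf a})_{\mathbf a\in c_0(\mathbb{Z}^n)}$ let $\ell_y(\sum_{\mathbf a}p_{\mathbf a}c^{\mathbf a}):=\sum_{\mathbf a}p_{\mathbf a}y_{\mathbf a}$, and let $\Pi_A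 y:=(y_{\mathbf a})_{\mathbf a\in A}$. Then $C^{\mathrm{out}}_{\infty,\infty}(A):=\Pi_A\{y : \ell_y(p)\ge0\text{ for all }p\in Q_{\infty,\infty}\}$, and the bar denotes closure in $\mathbb{C}^N$.
   Formalization: The ball B is restricted to functions with conj(c_a)=c_{-a} (real-valued), since the claim fails otherwise; equality with C(A) is stated when the empty collection is an entry of A, and for every A as equality with the closure of C(A), since C(A) need not be closed. *)

theory Defs
  imports "HOL-Analysis.Analysis" "HOL-Library.Poly_Mapping"
begin

section \<open>The Hilbert space of square-integrable functions on the torus\<close>

text \<open>
  Functions on the torus \<open>\<real>\<^sup>n / \<int>\<^sup>n\<close> are \<open>\<int>\<^sup>n\<close>-periodic functions on \<open>\<real>\<^sup>n\<close>, and integration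
  over the torus is integration over the unit cube.
\<close>

definition torus_measure :: "(real ^ 'n) measure" where
  "torus_measure = restrict_space lborel (cbox 0 1)"

definition periodic :: "(real ^ 'n \<Rightarrow> complex) \<Rightarrow> bool" where
  "periodic f \<longleftrightarrow> (\<forall>x (k :: int ^ 'n). f (x + (\<chi> i. of_int (k $ i))) = f x)"

definition square_integrable :: "(real ^ 'n \<Rightarrow> complex) \<Rightarrow> bool" where
  "square_integrable f \<longleftrightarrow> f \<in> borel_measurable borel \<and> periodic f \<and>
     integrable torus_measure (\<lambda>x. (cmod (f x))\<^sup>2)"

definition L2_eq :: "(real ^ 'n \<Rightarrow> complex) \<Rightarrow> (real ^ 'n \<Rightarrow> complex) \<Rightarrow> bool" where
  "L2_eq f g \<longleftrightarrow> square_integrable f \<and> square_integrable g \<and> (AE x in torus_measure. f x = g x)"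

lemma L2_eqD:
  assumes "L2_eq f g"
  shows "square_integrable f" "square_integrable g" "AE x in torus_measure. f x = g x"
  using assms by (simp_all add: L2_eq_def)

lemma square_integrable_zero: "square_integrable (\<lambda>x. 0)"
  by (simp add: square_integrable_def periodic_def)

lemma measurable_torus_measure:
  "f \<in> borel_measurable borel \<Longrightarrow> f \<in> borel_measurable torus_measure"
  unfolding torus_measure_def by (rule measurable_restrict_space1) simp

lemma square_integrable_diff:
  assumes f: "square_integrable f" and g: "square_integrable g"
  shows "square_integrable (\<lambda>x. f x - g x)"
proof -
  have [measurable]: "f \<in> borel_measurable borel" "g \<in> borel_measurable borel"
    using f g by (auto simp: square_integrable_def)
  have "integrable torus_measure (\<lambda>x. 2 * (cmod (f x))\<^sup>2 + 2 * (cmod (g x))\<^sup>2)"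
    using f g by (simp add: square_integrable_def)
  then have "integrable torus_measure (\<lambda>x. (cmod (f x - g x))\<^sup>2)"
  proof (rule Bochner_Integration.integrable_bound)
    show "(\<lambda>x. (cmod (f x - g x))\<^sup>2) \<in> borel_measurable torus_measure"
      by (rule measurable_torus_measure) measurable
    have "(cmod (u - v))\<^sup>2 \<le> 2 * (cmod u)\<^sup>2 + 2 * (cmod v)\<^sup>2" for u v :: complex
    proof -
      have "(cmod (u - v))\<^sup>2 \<le> (cmod u + cmod v)\<^sup>2"
        by (intro power_mono norm_triangle_ineq4) auto
      also have "\<dots> \<le> 2 * (cmod u)\<^sup>2 + 2 * (cmod v)\<^sup>2"
        using sum_squares_bound[of "cmod u" "cmod v"] by (simp add: power2_sum)
      finally show ?thesis .
    qed
    then show "AE x in torus_measure. norm ((cmod (f x - g x))\<^sup>2)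
        \<le> norm (2 * (cmod (f x))\<^sup>2 + 2 * (cmod (g x))\<^sup>2)"
      by simp
  qed
  moreover have "(\<lambda>x. f x - g x) \<in> borel_measurable borel" by measurable
  ultimately show ?thesis
    using f g by (simp add: square_integrable_def periodic_def)
qed

text \<open>Minkowski's inequality for square-integrable functions.\<close>

lemma L2_minkowski:
  assumes u: "square_integrable u" and v: "square_integrable v"
    and w: "square_integrable w" and le: "\<And>x. cmod (w x) \<le> cmod (u x) + cmod (v x)"
  shows "sqrt (LINT x|torus_measure. (cmod (w x))\<^sup>2)
    \<le> sqrt (LINT x|torus_measure. (cmod (u x))\<^sup>2) + sqrt (LINT x|torus_measure. (cmod (v x))\<^sup>2)"
proof -
  let ?I = "\<lambda>h. LINT x|torus_measure. h x"
  define U V where "U = ?I (\<lambda>x. (cmod (u x))\<^sup>2)" and "V = ?I (\<lambda>x. (cmod (v x))\<^sup>2)"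
  have [measurable]: "u \<in> borel_measurable borel" "v \<in> borel_measurable borel"
    "w \<in> borel_measurable borel"
    using u v w by (auto simp: square_integrable_def)
  have iu: "integrable torus_measure (\<lambda>x. (cmod (u x))\<^sup>2)"
    and iv: "integrable torus_measure (\<lambda>x. (cmod (v x))\<^sup>2)"
    and iw: "integrable torus_measure (\<lambda>x. (cmod (w x))\<^sup>2)"
    using u v w by (auto simp: square_integrable_def)
  have iuv: "integrable torus_measure (\<lambda>x. cmod (u x) * cmod (v x))"
  proof (rule Bochner_Integration.integrable_bound[OF Bochner_Integration.integrable_add[OF iu iv]])
    show "(\<lambda>x. cmod (u x) * cmod (v x)) \<in> borel_measurable torus_measure"
      by (rule measurable_torus_measure) measurable
    have "cmod a * cmod b \<le> (cmod a)\<^sup>2 + (cmod b)\<^sup>2" for a b :: complex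
    proof -
      have "0 \<le> cmod a * cmod b" by simp
      then show ?thesis using sum_squares_bound[of "cmod a" "cmod b"] by linarith
    qed
    then show "AE x in torus_measure.
        norm (cmod (u x) * cmod (v x)) \<le> norm ((cmod (u x))\<^sup>2 + (cmod (v x))\<^sup>2)"
      by simp
  qed
  have U0: "0 \<le> U" and V0: "0 \<le> V" by (auto simp: U_def V_def)
  have cs: "?I (\<lambda>x. cmod (u x) * cmod (v x)) \<le> sqrt U * sqrt V"
  proof -
    define P where "P = ?I (\<lambda>x. cmod (u x) * cmod (v x))"
    have P0: "0 \<le> P" by (auto simp: P_def)
    have nn: "(\<integral>\<^sup>+x. ennreal (cmod (u x)) * ennreal (cmod (v x)) \<partial>torus_measure) = ennreal P"
      "(\<integral>\<^sup>+x. (ennreal (cmod (u x)))\<^sup>2 \<partial>torus_measure) = ennreal U"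
      "(\<integral>\<^sup>+x. (ennreal (cmod (v x)))\<^sup>2 \<partial>torus_measure) = ennreal V"
      using nn_integral_eq_integral[OF iuv] nn_integral_eq_integral[OF iu]
        nn_integral_eq_integral[OF iv]
      by (simp_all add: P_def U_def V_def ennreal_mult ennreal_power)
    have "(ennreal P)\<^sup>2 \<le> ennreal U * ennreal V"
      unfolding nn[symmetric] by (rule Cauchy_Schwarz_nn_integral) (rule measurable_torus_measure, measurable)+
    then have "ennreal (P\<^sup>2) \<le> ennreal (U * V)"
      by (simp only: ennreal_power[OF P0] ennreal_mult[OF U0 V0])
    then have "P\<^sup>2 \<le> U * V"
      using U0 V0 by (subst (asm) ennreal_le_iff) auto
    then show ?thesis
      unfolding P_def[symmetric] real_sqrt_mult[symmetric] by (rule real_le_rsqrt)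
  qed
  have "?I (\<lambda>x. (cmod (w x))\<^sup>2)
      \<le> ?I (\<lambda>x. (cmod (u x))\<^sup>2 + 2 * (cmod (u x) * cmod (v x)) + (cmod (v x))\<^sup>2)"
  proof (rule integral_mono)
    show "integrable torus_measure
        (\<lambda>x. (cmod (u x))\<^sup>2 + 2 * (cmod (u x) * cmod (v x)) + (cmod (v x))\<^sup>2)"
      using iu iv iuv by simp
    fix x
    have "(cmod (w x))\<^sup>2 \<le> (cmod (u x) + cmod (v x))\<^sup>2"
      using le by (intro power_mono) auto
    then show "(cmod (w x))\<^sup>2 \<le> (cmod (u x))\<^sup>2 + 2 * (cmod (u x) * cmod (v x)) + (cmod (v x))\<^sup>2"
      by (simp add: power2_sum)
  qed (rule iw)
  also have "\<dots> = U + 2 * ?I (\<lambda>x. cmod (u x) * cmod (v x)) + V"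
    using iu iv iuv by (simp add: U_def V_def)
  also have "\<dots> \<le> (sqrt U + sqrt V)\<^sup>2"
    using cs U0 V0 by (simp add: power2_sum)
  finally have "sqrt (?I (\<lambda>x. (cmod (w x))\<^sup>2)) \<le> sqrt ((sqrt U + sqrt V)\<^sup>2)"
    by (rule real_sqrt_le_mono)
  then show ?thesis
    using U0 V0 by (simp add: U_def V_def)
qed

quotient_type (overloaded) 'n L2 = "real ^ 'n \<Rightarrow> complex" / partial: L2_eq
proof (rule part_equivpI)
  show "\<exists>f. L2_eq f f"
    using square_integrable_zero by (auto simp: L2_eq_def)
  show "symp L2_eq"
    by (rule sympI) (auto simp: L2_eq_def elim: eventually_mono)
  show "transp (L2_eq :: (real ^ 'n \<Rightarrow> complex) \<Rightarrow> _)"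
  proof (rule transpI)
    fix f g h :: "real ^ 'n \<Rightarrow> complex"
    assume a: "L2_eq f g" "L2_eq g h"
    have "AE x in torus_measure. f x = h x"
      using L2_eqD(3)[OF a(1)] L2_eqD(3)[OF a(2)] by eventually_elim simp
    then show "L2_eq f h" using a by (simp add: L2_eq_def)
  qed
qed

instantiation L2 :: (finite) metric_space
begin

lift_definition dist_L2 :: "'a L2 \<Rightarrow> 'a L2 \<Rightarrow> real" is
  "\<lambda>f g. sqrt (LINT x|torus_measure. (cmod (f x - g x))\<^sup>2)"
proof -
  fix f f' g g' :: "real ^ 'a \<Rightarrow> complex"
  assume a: "L2_eq f f'" "L2_eq g g'"
  have [measurable]: "f \<in> borel_measurable borel" "g \<in> borel_measurable borel"
    "f' \<in> borel_measurable borel" "g' \<in> borel_measurable borel"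
    using a by (auto simp: L2_eq_def square_integrable_def)
  have "(LINT x|torus_measure. (cmod (f x - g x))\<^sup>2) = (LINT x|torus_measure. (cmod (f' x - g' x))\<^sup>2)"
  proof (rule integral_cong_AE)
    show "AE x in torus_measure. (cmod (f x - g x))\<^sup>2 = (cmod (f' x - g' x))\<^sup>2"
      using L2_eqD(3)[OF a(1)] L2_eqD(3)[OF a(2)] by eventually_elim simp
  qed (rule measurable_torus_measure, measurable)+
  then show "sqrt (LINT x|torus_measure. (cmod (f x - g x))\<^sup>2)
      = sqrt (LINT x|torus_measure. (cmod (f' x - g' x))\<^sup>2)"
    by simp
qed

definition uniformity_L2 :: "('a L2 \<times> 'a L2) filter" where
  "uniformity_L2 = (INF e\<in>{0<..}. principal {(F, G). dist F G < e})"

definition open_L2 :: "'a L2 set \<Rightarrow> bool" where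
  "open_L2 U \<longleftrightarrow> (\<forall>F\<in>U. \<forall>\<^sub>F (F', G) in uniformity. F' = F \<longrightarrow> G \<in> U)"

instance
proof
  show "(uniformity :: ('a L2 \<times> 'a L2) filter) = (INF e\<in>{0<..}. principal {(F, G). dist F G < e})"
    by (rule uniformity_L2_def)
  show "open U \<longleftrightarrow> (\<forall>F\<in>U. \<forall>\<^sub>F (F', G) in uniformity. F' = F \<longrightarrow> G \<in> U)" for U :: "'a L2 set"
    by (rule open_L2_def)
  show "dist F G = 0 \<longleftrightarrow> F = G" for F G :: "'a L2"
  proof (transfer, goal_cases)
    case (1 f g)
    then have f: "square_integrable f" and g: "square_integrable g" by (auto dest: L2_eqD)
    have "integrable torus_measure (\<lambda>x. (cmod (f x - g x))\<^sup>2)"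
      using square_integrable_diff[OF f g] by (simp add: square_integrable_def)
    then have "(LINT x|torus_measure. (cmod (f x - g x))\<^sup>2) = 0
        \<longleftrightarrow> (AE x in torus_measure. (cmod (f x - g x))\<^sup>2 = 0)"
      by (rule integral_nonneg_eq_0_iff_AE) simp
    then show ?case using f g by (simp add: L2_eq_def)
  qed
  show "dist F G \<le> dist F H + dist G H" for F G H :: "'a L2"
  proof (transfer, goal_cases)
    case (1 f g h)
    then have "square_integrable f" "square_integrable g" "square_integrable h"
      by (auto dest: L2_eqD)
    then show ?case
    proof (intro L2_minkowski square_integrable_diff)
      fix x
      show "cmod (f x - g x) \<le> cmod (f x - h x) + cmod (g x - h x)"
        using norm_triangle_ineq4[of "f x - h x" "g x - h x"] by simp
    qed
  qed
qed

end


section \<open>Fourier coefficients and the Sobolev ball\<close>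

definition fourier_basis :: "int ^ 'n \<Rightarrow> real ^ 'n \<Rightarrow> complex" where
  "fourier_basis a x = exp (- (2 * of_real pi * \<i> * of_real (\<Sum>i\<in>UNIV. of_int (a $ i) * x $ i)))"

lift_definition fourier_coeff :: "('n :: finite) L2 \<Rightarrow> int ^ 'n \<Rightarrow> complex" is
  "\<lambda>f a. LINT x|torus_measure. f x * fourier_basis a x"
proof -
  fix f g :: "real ^ 'n \<Rightarrow> complex"
  assume fg: "L2_eq f g"
  have [measurable]: "f \<in> borel_measurable borel" "g \<in> borel_measurable borel"
    using fg by (auto simp: L2_eq_def square_integrable_def)
  have [measurable]: "fourier_basis a \<in> borel_measurable borel" for a :: "int ^ 'n"
    unfolding fourier_basis_def by (intro borel_measurable_continuous_onI continuous_intros)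
  show "(\<lambda>a. LINT x|torus_measure. f x * fourier_basis a x)
      = (\<lambda>a. LINT x|torus_measure. g x * fourier_basis a x)"
  proof (intro ext integral_cong_AE)
    fix a :: "int ^ 'n"
    show "AE x in torus_measure. f x * fourier_basis a x = g x * fourier_basis a x"
      using L2_eqD(3)[OF fg] by eventually_elim simp
  qed (rule measurable_torus_measure, measurable)+
qed

definition weight :: "nat \<Rightarrow> int ^ 'n \<Rightarrow> real" where
  "weight m a = (1 + of_int (\<Sum>i\<in>UNIV. (a $ i)\<^sup>2)) ^ m"

definition sobolev_space :: "nat \<Rightarrow> ('n :: finite) L2 set" where
  "sobolev_space m = {F. (\<lambda>a. weight m a * (cmod (fourier_coeff F a))\<^sup>2) summable_on UNIV}"

definition sobolev_norm :: "nat \<Rightarrow> ('n :: finite) L2 \<Rightarrow> real" where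
  "sobolev_norm m F = sqrt (\<Sum>\<^sub>\<infinity>a. weight m a * (cmod (fourier_coeff F a))\<^sup>2)"

text \<open>
  The convention under which the monomial \<open>c\<^sub>a c\<^sub>-\<^sub>a\<close> stands for the squared modulus of \<open>c\<^sub>a\<close>:
  the conjugate of \<open>c\<^sub>a\<close> is \<open>c\<^sub>-\<^sub>a\<close>, which holds for all \<open>a\<close> exactly when the function is real-valued
  almost everywhere. The Sobolev ball consists of functions obeying it; without it, moments of
  a measure on the ball need not be nonnegative on Hermitian squares.
\<close>

definition hermitian_coeffs :: "('n :: finite) L2 \<Rightarrow> bool" where
  "hermitian_coeffs F \<longleftrightarrow> (\<forall>a. cnj (fourier_coeff F a) = fourier_coeff F (- a))"

definition sobolev_ball :: "nat \<Rightarrow> ('n :: finite) L2 set" where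
  "sobolev_ball m = {F \<in> sobolev_space m. sobolev_norm m F \<le> 1 \<and> hermitian_coeffs F}"


section \<open>The moment cone\<close>

definition radon_measure :: "'a :: topological_space measure \<Rightarrow> bool" where
  "radon_measure \<mu> \<longleftrightarrow> sets \<mu> = sets borel \<and>
     (\<forall>x. \<exists>U. open U \<and> x \<in> U \<and> emeasure \<mu> U < \<infinity>) \<and>
     (\<forall>E\<in>sets borel. emeasure \<mu> E = (SUP K\<in>{K. compact K \<and> K \<subseteq> E}. emeasure \<mu> K))"

text \<open>Finite collections of frequencies, repetitions allowed, are multisets.\<close>

definition moment_cone :: "nat \<Rightarrow> ((int ^ 'n) multiset) ^ 'N \<Rightarrow> (complex ^ 'N) set" where
  "moment_cone m A =
     {\<chi> j. LINT F:sobolev_ball m|\<mu>. (\<Prod>a\<in>#A $ j. fourier_coeff F a)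
      |\<mu> :: ('n :: finite) L2 measure. radon_measure \<mu> \<and> (AE F in \<mu>. F \<in> sobolev_ball m)}"


section \<open>The outer cone\<close>

text \<open>
  The polynomial ring in the indeterminates \<open>c\<^sub>a\<close> is the monoid algebra over the free commutative
  monoid of multisets of frequencies: the monomial of the multiset \<open>\<alpha>\<close> is
  \<^term>\<open>Poly_Mapping.single \<alpha> 1\<close>.
\<close>

type_synonym 'n cpoly = "(int ^ 'n) multiset \<Rightarrow>\<^sub>0 complex"

definition freq_degree :: "int ^ 'n \<Rightarrow> nat" where
  "freq_degree a = nat (Max (range (\<lambda>i. \<bar>a $ i\<bar>)))"

definition harmonic_degree :: "(int ^ 'n) multiset \<Rightarrow> nat" where
  "harmonic_degree \<alpha> = (if \<alpha> = {#} then 0 else Max (freq_degree ` set_mset \<alpha>))"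

text \<open>
  The algebraic degree bound is an integer so that the bound \<open>-1\<close>, which is met by the zero
  polynomial only, is available.
\<close>

definition cpolys :: "int \<Rightarrow> nat \<Rightarrow> ('n :: finite) cpoly set" where
  "cpolys r \<rho> = {p. \<forall>\<alpha>\<in>Poly_Mapping.keys p. int (size \<alpha>) \<le> r \<and> harmonic_degree \<alpha> \<le> \<rho>}"

definition hermitian_conj :: "('n :: finite) cpoly \<Rightarrow> 'n cpoly" where
  "hermitian_conj q = (\<Sum>\<alpha>\<in>Poly_Mapping.keys q.
     Poly_Mapping.single (image_mset uminus \<alpha>) (cnj (Poly_Mapping.lookup q \<alpha>)))"

definition sos :: "int \<Rightarrow> nat \<Rightarrow> ('n :: finite) cpoly set" where
  "sos r \<rho> = {\<Sum>k<K. hermitian_conj (q k) * q k |(K :: nat) q. \<forall>k<K. q k \<in> cpolys r \<rho>}"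

definition ball_poly :: "nat \<Rightarrow> nat \<Rightarrow> ('n :: finite) cpoly" where
  "ball_poly m \<rho> = 1 - (\<Sum>a | freq_degree a \<le> \<rho>. Poly_Mapping.single {#a, - a#} (of_real (weight m a)))"

definition quad_module :: "nat \<Rightarrow> nat \<Rightarrow> nat \<Rightarrow> ('n :: finite) cpoly set" where
  "quad_module m r \<rho> = {s\<^sub>0 + s\<^sub>1 * ball_poly m \<rho> |s\<^sub>0 s\<^sub>1. s\<^sub>0 \<in> sos (int r) \<rho> \<and> s\<^sub>1 \<in> sos (int r - 1) \<rho>}"

definition quad_module_inf :: "nat \<Rightarrow> ('n :: finite) cpoly set" where
  "quad_module_inf m = (\<Union>r \<rho>. quad_module m r \<rho>)"

definition riesz :: "((int ^ 'n) multiset \<Rightarrow> complex) \<Rightarrow> 'n cpoly \<Rightarrow> complex" where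
  "riesz y p = (\<Sum>\<alpha>\<in>Poly_Mapping.keys p. Poly_Mapping.lookup p \<alpha> * y \<alpha>)"

definition outer_cone :: "nat \<Rightarrow> ((int ^ 'n) multiset) ^ 'N \<Rightarrow> (complex ^ 'N) set" where
  "outer_cone m A =
     {\<chi> j. y (A $ j) |y :: (int ^ ('n :: finite)) multiset \<Rightarrow> complex.
       (\<lambda>\<alpha>. (cmod (y \<alpha>))\<^sup>2) summable_on UNIV \<and>
       (\<forall>p\<in>quad_module_inf m. riesz y p \<in> \<real>\<^sub>\<ge>\<^sub>0)}"

end

theory Submission
  imports Defs
begin

text \<open>
  Let \<open>H\<close> be the convex cone generated by the vectors \<open>(c\<^sup>\<alpha>)\<^sub>\<alpha>\<^sub>\<in>\<^sub>A\<close> evaluated at the points of the Sobolev ball.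
  Finite sums of Dirac measures give \<open>H \<subseteq> C(A)\<close>. The ball is compact in \<open>L\<^sup>2\<close> (Rellich), hence every measure
  on it is finite, and \<open>H\<close> is closed if \<open>A\<close> contains the empty collection. A vector lies in the
  closure of \<open>H\<close> as soon as it satisfies all linear inequalities that hold on the ball. Moments of
  measures do so by integration. Vectors of the outer cone do so by a Positivstellensatz: if a
  polynomial \<open>p\<close> is nonnegative on the ball, then so is \<open>\<ell>(p)\<close>.

  For the latter, rescale the real and imaginary parts of the finitely many relevant \<open>c\<^sub>a\<close> to elements \<open>u\<close>
  with \<open>u\<close> and \<open>1 - u\<close> in the quadratic module \<open>Q\<close>. As \<open>Q\<close> is closed under multiplication, the members \<open>b\<close> of the
  Bernstein partition of unity in the \<open>u\<close> lie in \<open>Q\<close>, and \<open>\<ell>\<close> splits into the positive functionals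
  \<open>q \<mapsto> \<ell>(b q)\<close>. By the variance identity \<open>\<Sum>\<^sub>k b\<^sub>k (u - k/N)\<^sup>2 = u (1 - u) / N\<close> these are, up to a total error that
  vanishes as \<open>N\<close> grows, multiples of evaluations at grid points, and positivity on the constraint
  forces the grid points that carry mass towards the ball.

  Conversely, the moments of a measure on the ball, contracted by a factor \<open>t < 1\<close>, are square-summable,
  lie in the outer cone, and converge to the original moments as \<open>t\<close> tends to \<open>1\<close>.
\<close>

section \<open>The polynomial ring\<close>

text \<open>The conclusion has two clauses because of mass. If no entry of \<open>A\<close> is
  empty, the moments do not control the total mass, and the moment cone need not be closed: for the
  entries c_0 and c_0 c_0, mass k at the constant function 1/k has moments (1, 1/k). The limit (1,
  0) is no moment vector, since c_0 is real on the ball and a vanishing integral of its square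
  forces c_0 = 0 almost everywhere. An empty entry records the mass and restores closedness; without
  one, only closures are compared. The outer cone is treated without producing a measure. Only
  finitely many frequencies occur in \<open>A\<close>, so one harmonic degree \<rho> is fixed, while
  the algebraic degree stays free to make room for Bernstein polynomials of any degree. Points that
  satisfy the constraint at level \<rho> and vanish beyond it are coefficients of trigonometric
  polynomials in the Sobolev ball, so positivity on the ball is available exactly where it is used.
  A positive functional controls an element only through its square; this is why approximation
  errors are measured by Hermitian squares inside the quadratic module rather than
  pointwise.\<close>

lemma riesz_superset:
  assumes "finite S" "Poly_Mapping.keys p \<subseteq> S"
  shows "riesz y p = (\<Sum>\<alpha>\<in>S. Poly_Mapping.lookup p \<alpha> * y \<alpha>)"
  unfolding riesz_def using assms
  by (intro sum.mono_neutral_left) (auto simp: in_keys_iff)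

lemma riesz_add: "riesz y (p + q) = riesz y p + riesz y q"
proof -
  let ?S = "Poly_Mapping.keys p \<union> Poly_Mapping.keys q"
  have "riesz y (p + q) = (\<Sum>\<alpha>\<in>?S. Poly_Mapping.lookup (p + q) \<alpha> * y \<alpha>)"
    by (rule riesz_superset) (auto dest: set_mp[OF keys_add])
  also have "\<dots> = riesz y p + riesz y q"
    by (simp add: riesz_superset[of ?S] lookup_add distrib_right sum.distrib)
  finally show ?thesis .
qed

lemma riesz_0 [simp]: "riesz y 0 = 0"
  by (simp add: riesz_def)

lemma riesz_single [simp]: "riesz y (Poly_Mapping.single \<alpha> c) = c * y \<alpha>"
  by (cases "c = 0") (simp_all add: riesz_def)

lemma riesz_sum: "riesz y (\<Sum>i\<in>I. p i) = (\<Sum>i\<in>I. riesz y (p i))"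
  by (induction I rule: infinite_finite_induct) (simp_all add: riesz_add)

lemma cpoly_induct [case_names single add]:
  fixes p :: "'n cpoly"
  assumes single: "\<And>\<alpha> c. P (Poly_Mapping.single \<alpha> c)" and add: "\<And>p q. P p \<Longrightarrow> P q \<Longrightarrow> P (p + q)"
  shows "P p"
proof (induction p rule: update_induct)
  case const
  show ?case using single[of "{#}" 0] by simp
next
  case (update f a b)
  have "Poly_Mapping.update a b f = Poly_Mapping.single a b + f"
    using update(1) by (intro poly_mapping_eqI) (auto simp: lookup_update lookup_add lookup_single when_def in_keys_iff)
  then show ?case using add[OF single update(3)] by simp
qed

definition cst :: "complex \<Rightarrow> ('n::finite) cpoly" where
  "cst c = Poly_Mapping.single {#} c"

lemma cst_0 [simp]: "cst 0 = 0" and cst_1 [simp]: "cst 1 = 1"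
  by (simp_all add: cst_def flip: zero_multiset_def single_one)

lemma cst_add: "cst (a + b) = cst a + cst b"
  and cst_diff: "cst (a - b) = cst a - cst b"
  and cst_uminus: "cst (- a) = - cst a"
  by (simp_all add: cst_def single_add single_diff single_uminus)

lemma cst_mult: "cst (a * b) = cst a * cst b"
  by (simp add: cst_def mult_single)

lemma cst_of_nat: "cst (of_nat k) = of_nat k"
  by (induction k) (simp_all add: cst_add)

lemma cst_numeral: "cst (numeral k) = numeral k"
  using cst_of_nat[of "numeral k"] by simp

lemma cst_mult_single: "cst c * Poly_Mapping.single \<alpha> d = Poly_Mapping.single \<alpha> (c * d)"
  by (simp add: cst_def mult_single)

lemma riesz_cst_mult: "riesz y (cst c * p) = c * riesz y p"
  by (induction p rule: cpoly_induct) (simp_all add: cst_mult_single distrib_left riesz_add)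

lemma riesz_cst [simp]: "riesz y (cst c) = c * y {#}"
  by (simp add: cst_def)

lemma riesz_uminus: "riesz y (- p) = - riesz y p"
  using riesz_cst_mult[of y "-1" p] by (simp add: cst_uminus)

lemma riesz_diff: "riesz y (p - q) = riesz y p - riesz y q"
  using riesz_add[of y p "- q"] by (simp add: riesz_uminus)

text \<open>Evaluation is encoded as the Riesz functional of the multiplicative family of monomial
  values, so linearity is inherited and only multiplicativity needs an argument.\<close>

definition eval_cpoly :: "(int ^ 'n \<Rightarrow> complex) \<Rightarrow> ('n::finite) cpoly \<Rightarrow> complex" where
  "eval_cpoly z = riesz (\<lambda>\<alpha>. \<Prod>a\<in>#\<alpha>. z a)"

lemma eval_cpoly_add: "eval_cpoly z (p + q) = eval_cpoly z p + eval_cpoly z q"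
  and eval_cpoly_diff: "eval_cpoly z (p - q) = eval_cpoly z p - eval_cpoly z q"
  and eval_cpoly_cst [simp]: "eval_cpoly z (cst c) = c"
  and eval_cpoly_0 [simp]: "eval_cpoly z 0 = 0"
  and eval_cpoly_single: "eval_cpoly z (Poly_Mapping.single \<alpha> c) = c * (\<Prod>a\<in>#\<alpha>. z a)"
  and eval_cpoly_sum: "eval_cpoly z (\<Sum>i\<in>I. f i) = (\<Sum>i\<in>I. eval_cpoly z (f i))"
  by (simp_all add: eval_cpoly_def riesz_add riesz_diff riesz_sum)

lemma eval_cpoly_1 [simp]: "eval_cpoly z 1 = 1"
  using eval_cpoly_cst[of z 1] by simp

lemma eval_cpoly_mult: "eval_cpoly z (p * q) = eval_cpoly z p * eval_cpoly z q"
proof (induction p rule: cpoly_induct)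
  case (single \<alpha> c)
  show ?case
    by (induction q rule: cpoly_induct) (simp_all add: eval_cpoly_single mult_single eval_cpoly_add distrib_left)
qed (simp add: eval_cpoly_add distrib_right)

lemma hermitian_conj_superset:
  assumes "finite S" "Poly_Mapping.keys p \<subseteq> S"
  shows "hermitian_conj p = (\<Sum>\<alpha>\<in>S. Poly_Mapping.single (image_mset uminus \<alpha>) (cnj (Poly_Mapping.lookup p \<alpha>)))"
  unfolding hermitian_conj_def using assms
  by (intro sum.mono_neutral_left) (auto simp: in_keys_iff)

lemma hermitian_conj_add: "hermitian_conj (p + q) = hermitian_conj p + hermitian_conj q"
proof -
  let ?S = "Poly_Mapping.keys p \<union> Poly_Mapping.keys q"
  have "hermitian_conj (p + q) = (\<Sum>\<alpha>\<in>?S. Poly_Mapping.single (image_mset uminus \<alpha>) (cnj (Poly_Mapping.lookup (p + q) \<alpha>)))"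
    by (rule hermitian_conj_superset) (auto dest: set_mp[OF keys_add])
  also have "\<dots> = hermitian_conj p + hermitian_conj q"
    by (simp add: hermitian_conj_superset[of ?S] lookup_add single_add sum.distrib)
  finally show ?thesis .
qed

lemma hermitian_conj_0 [simp]: "hermitian_conj 0 = 0"
  by (simp add: hermitian_conj_def)

lemma hermitian_conj_single [simp]:
  "hermitian_conj (Poly_Mapping.single \<alpha> c) = Poly_Mapping.single (image_mset uminus \<alpha>) (cnj c)"
  by (cases "c = 0") (simp_all add: hermitian_conj_def)

lemma hermitian_conj_sum: "hermitian_conj (\<Sum>i\<in>I. f i) = (\<Sum>i\<in>I. hermitian_conj (f i))"
  by (induction I rule: infinite_finite_induct) (simp_all add: hermitian_conj_add)

lemma hermitian_conj_mult: "hermitian_conj (p * q) = hermitian_conj p * hermitian_conj q"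
proof (induction p rule: cpoly_induct)
  case (single \<alpha> c)
  show ?case
    by (induction q rule: cpoly_induct) (simp_all add: mult_single hermitian_conj_add distrib_left)
qed (simp add: hermitian_conj_add distrib_right)

lemma hermitian_conj_hermitian_conj [simp]: "hermitian_conj (hermitian_conj p) = p"
  by (induction p rule: cpoly_induct)
     (simp_all add: hermitian_conj_add multiset.map_comp comp_def)

lemma hermitian_conj_cst [simp]: "hermitian_conj (cst c) = cst (cnj c)"
  by (simp add: cst_def)

lemma hermitian_conj_1 [simp]: "hermitian_conj 1 = 1"
  using hermitian_conj_cst[of 1] by simp

lemma hermitian_conj_uminus: "hermitian_conj (- p) = - hermitian_conj p"
  using hermitian_conj_add[of p "- p"] by (simp add: eq_neg_iff_add_eq_0 add.commute)

lemma hermitian_conj_diff: "hermitian_conj (p - q) = hermitian_conj p - hermitian_conj q"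
  using hermitian_conj_add[of p "- q"] by (simp add: hermitian_conj_uminus)

lemmas hermitian_conj_simps =
  hermitian_conj_add hermitian_conj_mult hermitian_conj_uminus hermitian_conj_diff hermitian_conj_sum

text \<open>The points at which the formal conjugation becomes complex conjugation, so that
  Hermitian squares evaluate to squared moduli.\<close>

definition hermitian_point :: "(int ^ 'n \<Rightarrow> complex) \<Rightarrow> bool" where
  "hermitian_point z \<longleftrightarrow> (\<forall>a. cnj (z a) = z (- a))"

lemma eval_cpoly_hermitian_conj:
  assumes "hermitian_point z"
  shows "eval_cpoly z (hermitian_conj p) = cnj (eval_cpoly z p)"
proof (induction p rule: cpoly_induct)
  case (single \<alpha> c)
  have "(\<Prod>a\<in>#\<alpha>. z (- a)) = cnj (\<Prod>a\<in>#\<alpha>. z a)"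
    using assms by (induction \<alpha>) (simp_all add: hermitian_point_def)
  then show ?case by (simp add: eval_cpoly_single multiset.map_comp comp_def)
qed (simp add: eval_cpoly_add hermitian_conj_add)

section \<open>The quadratic module at a fixed harmonic degree\<close>

text \<open>Without a bound on the algebraic degree this is a subalgebra closed under conjugation,
  which \<open>cpolys\<close> is not. The harmonic bound stays because the constraint
  \<open>ball_poly m \<rho>\<close> depends on it.\<close>

definition band :: "nat \<Rightarrow> ('n::finite) cpoly set" where
  "band \<rho> = {p. \<forall>\<alpha>\<in>Poly_Mapping.keys p. \<forall>a\<in>#\<alpha>. freq_degree a \<le> \<rho>}"

lemma freq_degree_le_iff: "freq_degree (a :: int ^ 'n) \<le> \<rho> \<longleftrightarrow> (\<forall>i. \<bar>a $ i\<bar> \<le> int \<rho>)"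
proof -
  have "freq_degree a \<le> \<rho> \<longleftrightarrow> Max (range (\<lambda>i. \<bar>a $ i\<bar>)) \<le> int \<rho>"
    by (simp add: freq_degree_def nat_le_iff)
  then show ?thesis by (subst (asm) Max_le_iff) auto
qed

lemma freq_degree_uminus [simp]: "freq_degree (- a :: int ^ 'n) = freq_degree a"
  by (simp add: freq_degree_def)

lemma finite_freq_degree_le: "finite {a :: int ^ 'n. freq_degree a \<le> \<rho>}"
proof -
  have "finite (vec_nth ` {a :: int ^ 'n. freq_degree a \<le> \<rho>})"
  proof (rule finite_subset)
    show "vec_nth ` {a :: int ^ 'n. freq_degree a \<le> \<rho>} \<subseteq> PiE UNIV (\<lambda>_. {- int \<rho>..int \<rho>})"
      by (auto simp: freq_degree_le_iff abs_le_iff minus_le_iff[of "int \<rho>"])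
  qed (simp add: finite_PiE)
  then show ?thesis by (rule finite_imageD) (simp add: inj_on_def vec_nth_inject)
qed

lemma band_0 [simp]: "0 \<in> band \<rho>"
  by (simp add: band_def)

lemma band_cst [simp]: "cst c \<in> band \<rho>"
  by (cases "c = 0") (simp_all add: band_def cst_def)

lemma band_1 [simp]: "1 \<in> band \<rho>"
  using band_cst[of 1] by simp

lemma band_single: "(\<And>a. a \<in># \<alpha> \<Longrightarrow> freq_degree a \<le> \<rho>) \<Longrightarrow> Poly_Mapping.single \<alpha> c \<in> band \<rho>"
  by (cases "c = 0") (simp_all add: band_def)

lemma band_add: "p \<in> band \<rho> \<Longrightarrow> q \<in> band \<rho> \<Longrightarrow> p + q \<in> band \<rho>"
  unfolding band_def by (auto dest!: set_mp[OF keys_add])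

lemma band_mult: "p \<in> band \<rho> \<Longrightarrow> q \<in> band \<rho> \<Longrightarrow> p * q \<in> band \<rho>"
  unfolding band_def by (auto dest!: set_mp[OF keys_mult])

lemma band_uminus: "p \<in> band \<rho> \<Longrightarrow> - p \<in> band \<rho>"
  by (auto simp: band_def in_keys_iff)

lemma band_diff: "p \<in> band \<rho> \<Longrightarrow> q \<in> band \<rho> \<Longrightarrow> p - q \<in> band \<rho>"
  using band_add[of p \<rho> "- q"] band_uminus[of q] by simp

lemma band_sum: "(\<And>i. i \<in> I \<Longrightarrow> f i \<in> band \<rho>) \<Longrightarrow> (\<Sum>i\<in>I. f i) \<in> band \<rho>"
  by (induction I rule: infinite_finite_induct) (simp_all add: band_add)

lemma band_hermitian_conj: "p \<in> band \<rho> \<Longrightarrow> hermitian_conj p \<in> band \<rho>"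
  unfolding hermitian_conj_def
  by (intro band_sum band_single) (auto simp: band_def)

lemma band_induct [consumes 1, case_names single add]:
  assumes p: "p \<in> band \<rho>"
    and single: "\<And>\<alpha> c. (\<forall>a\<in>#\<alpha>. freq_degree a \<le> \<rho>) \<Longrightarrow> P (Poly_Mapping.single \<alpha> c)"
    and add: "\<And>p q. P p \<Longrightarrow> P q \<Longrightarrow> P (p + q)"
  shows "P p"
  using p
proof (induction p rule: update_induct)
  case const
  show ?case using single[of "{#}" 0] by simp
next
  case (update f a b)
  have eq: "Poly_Mapping.update a b f = Poly_Mapping.single a b + f"
    using update(1) by (intro poly_mapping_eqI) (auto simp: lookup_update lookup_add lookup_single when_def in_keys_iff)
  have "f \<in> band \<rho>" "\<forall>c\<in>#a. freq_degree c \<le> \<rho>"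
    using update(1,2,4) by (auto simp: band_def keys_update split: if_splits)
  then show ?case using add[OF single update(3)] eq by simp
qed

text \<open>Asserted for all large r, so that the bounds of several polynomials, including the
  degree r - 1 in \<open>quad_module\<close>, can be met simultaneously.\<close>

lemma band_imp_cpolys:
  assumes "p \<in> band \<rho>"
  shows "\<exists>r0::nat. \<forall>r\<ge>int r0. p \<in> cpolys r \<rho>"
proof (intro exI allI impI)
  fix r assume r: "int (\<Sum>\<alpha>\<in>Poly_Mapping.keys p. size \<alpha>) \<le> r"
  have "size \<alpha> \<le> (\<Sum>\<alpha>\<in>Poly_Mapping.keys p. size \<alpha>)" if "\<alpha> \<in> Poly_Mapping.keys p" for \<alpha>
    using that by (intro member_le_sum) auto
  then have "int (size \<alpha>) \<le> r" if "\<alpha> \<in> Poly_Mapping.keys p" for \<alpha>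
    using that r by (meson of_nat_mono order_trans)
  moreover have "harmonic_degree \<alpha> \<le> \<rho>" if "\<alpha> \<in> Poly_Mapping.keys p" for \<alpha>
    using assms that by (auto simp: harmonic_degree_def band_def)
  ultimately show "p \<in> cpolys r \<rho>"
    by (simp add: cpolys_def)
qed

inductive_set psd :: "nat \<Rightarrow> ('n::finite) cpoly set" for \<rho> where
  psd_0: "0 \<in> psd \<rho>"
| psd_step: "p \<in> psd \<rho> \<Longrightarrow> q \<in> band \<rho> \<Longrightarrow> p + hermitian_conj q * q \<in> psd \<rho>"

lemma psd_imp_sos:
  assumes "p \<in> psd \<rho>"
  shows "\<exists>r0::nat. \<forall>r\<ge>int r0. p \<in> sos r \<rho>"
  using assms
proof induction
  case psd_0
  show ?case unfolding sos_def by (intro exI[of _ 0] allI impI CollectI) auto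
next
  case (psd_step p q)
  then obtain r1 r2 where r1: "\<forall>r\<ge>int r1. p \<in> sos r \<rho>" and r2: "\<forall>r\<ge>int r2. q \<in> cpolys r \<rho>"
    using band_imp_cpolys by blast
  show ?case
  proof (intro exI allI impI)
    fix r assume r: "int (max r1 r2) \<le> r"
    then have "p \<in> sos r \<rho>" using r1 by simp
    then obtain K f where f: "p = (\<Sum>k<K. hermitian_conj (f k) * f k)" "\<forall>k<(K::nat). f k \<in> cpolys r \<rho>"
      by (auto simp: sos_def)
    have "p + hermitian_conj q * q = (\<Sum>k<Suc K. hermitian_conj ((f(K := q)) k) * (f(K := q)) k)"
      by (simp add: f)
    moreover have "\<forall>k<Suc K. (f(K := q)) k \<in> cpolys r \<rho>"
      using f(2) r2 r by auto
    ultimately show "p + hermitian_conj q * q \<in> sos r \<rho>"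
      unfolding sos_def by blast
  qed
qed

lemma psd_square: "q \<in> band \<rho> \<Longrightarrow> hermitian_conj q * q \<in> psd \<rho>"
  using psd_step[OF psd_0] by simp

lemma psd_add:
  assumes "p \<in> psd \<rho>" "q \<in> psd \<rho>"
  shows "p + q \<in> psd \<rho>"
  using assms(2) by induction (simp_all add: assms(1) psd.psd_step flip: add.assoc)

lemma psd_mult_square:
  assumes "p \<in> psd \<rho>" "h \<in> band \<rho>"
  shows "p * (hermitian_conj h * h) \<in> psd \<rho>"
  using assms(1)
proof induction
  case (psd_step p q)
  have "(p + hermitian_conj q * q) * (hermitian_conj h * h)
      = p * (hermitian_conj h * h) + hermitian_conj (q * h) * (q * h)"
    by (simp add: hermitian_conj_mult algebra_simps)
  then show ?case
    by (simp only:) (intro psd.psd_step psd_step band_mult assms(2))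
qed (simp add: psd_0)

lemma psd_mult:
  assumes "p \<in> psd \<rho>" "q \<in> psd \<rho>"
  shows "p * q \<in> psd \<rho>"
  using assms(2)
proof induction
  case (psd_step q h)
  show ?case
    unfolding distrib_left by (intro psd_add psd_step psd_mult_square assms(1))
qed (simp add: psd_0)

lemma psd_cst:
  assumes "0 \<le> r"
  shows "cst (of_real r) \<in> psd \<rho>"
proof -
  have "complex_of_real (sqrt r) * of_real (sqrt r) = of_real r"
    using assms by (simp only: of_real_mult[symmetric] real_sqrt_mult_self abs_of_nonneg)
  then show ?thesis
    using psd_square[OF band_cst, of "of_real (sqrt r)" \<rho>]
    by (simp only: hermitian_conj_cst complex_cnj_complex_of_real cst_mult[symmetric])
qed

text \<open>With \<rho> fixed there is a single constraint, and with the algebraic degree free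
  nothing obstructs products. The link to the outer cone is the inclusion in
  \<open>quad_module_inf m\<close>.\<close>

definition qmod :: "nat \<Rightarrow> nat \<Rightarrow> ('n::finite) cpoly set" where
  "qmod m \<rho> = {s + t * ball_poly m \<rho> |s t. s \<in> psd \<rho> \<and> t \<in> psd \<rho>}"

lemma qmodI: "s \<in> psd \<rho> \<Longrightarrow> t \<in> psd \<rho> \<Longrightarrow> s + t * ball_poly m \<rho> \<in> qmod m \<rho>"
  by (auto simp: qmod_def)

lemma qmod_subset: "qmod m \<rho> \<subseteq> quad_module_inf m"
proof
  fix p assume "p \<in> qmod m \<rho>"
  then obtain s t where p: "p = s + t * ball_poly m \<rho>" "s \<in> psd \<rho>" "t \<in> psd \<rho>"
    by (auto simp: qmod_def)
  obtain r1 where r1: "\<forall>r\<ge>int r1. s \<in> sos r \<rho>" using psd_imp_sos[OF p(2)] by blast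
  obtain r2 where r2: "\<forall>r\<ge>int r2. t \<in> sos r \<rho>" using psd_imp_sos[OF p(3)] by blast
  \<comment> \<open>The extra 1 pays for the degree r - 1 that is allowed to the multiplier of the
    constraint.\<close>
  have "p \<in> quad_module m (r1 + r2 + 1) \<rho>"
    unfolding quad_module_def using p(1) r1 r2 by fastforce
  then show "p \<in> quad_module_inf m" by (auto simp: quad_module_inf_def)
qed

lemma psd_subset_qmod: "p \<in> psd \<rho> \<Longrightarrow> p \<in> qmod m \<rho>"
  using qmodI[OF _ psd_0] by fastforce

lemma qmod_add: "p \<in> qmod m \<rho> \<Longrightarrow> q \<in> qmod m \<rho> \<Longrightarrow> p + q \<in> qmod m \<rho>"
proof -
  assume "p \<in> qmod m \<rho>" "q \<in> qmod m \<rho>"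
  then obtain s t s' t' where "p = s + t * ball_poly m \<rho>" "q = s' + t' * ball_poly m \<rho>"
    and st: "s \<in> psd \<rho>" "t \<in> psd \<rho>" "s' \<in> psd \<rho>" "t' \<in> psd \<rho>"
    by (auto simp: qmod_def)
  then have "p + q = (s + s') + (t + t') * ball_poly m \<rho>" by (simp add: algebra_simps)
  then show ?thesis
    by (simp only:) (intro qmodI psd_add st)
qed

lemma hermitian_conj_ball_poly [simp]: "hermitian_conj (ball_poly m \<rho>) = ball_poly m \<rho>"
  unfolding ball_poly_def hermitian_conj_simps
  by (simp add: add_mset_commute[of "- _"])

lemma band_ball_poly [simp]: "ball_poly m \<rho> \<in> band \<rho>"
  unfolding ball_poly_def by (intro band_diff band_1 band_sum band_single) auto

text \<open>As there is a single constraint, the quadratic module is a preordering.\<close>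

lemma qmod_mult: "p \<in> qmod m \<rho> \<Longrightarrow> q \<in> qmod m \<rho> \<Longrightarrow> p * q \<in> qmod m \<rho>"
proof -
  let ?g = "ball_poly m \<rho>"
  assume "p \<in> qmod m \<rho>" "q \<in> qmod m \<rho>"
  then obtain s t s' t' where "p = s + t * ?g" "q = s' + t' * ?g"
    and st: "s \<in> psd \<rho>" "t \<in> psd \<rho>" "s' \<in> psd \<rho>" "t' \<in> psd \<rho>"
    by (auto simp: qmod_def)
  \<comment> \<open>The constraint is self-conjugate, so its square is a Hermitian square and joins
    the unconstrained summand.\<close>
  then have "p * q = (s * s' + (t * t') * (hermitian_conj ?g * ?g)) + (s * t' + t * s') * ?g"
    by (simp add: algebra_simps)
  then show ?thesis
    by (simp only:) (intro qmodI psd_add psd_mult_square psd_mult[OF st(1,3)] psd_mult[OF st(2,4)]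
        psd_mult[OF st(1,4)] psd_mult[OF st(2,3)] band_ball_poly)
qed

lemma qmod_cst: "0 \<le> r \<Longrightarrow> cst (of_real r) \<in> qmod m \<rho>"
  by (intro psd_subset_qmod psd_cst)

lemma qmod_0 [simp]: "0 \<in> qmod m \<rho>" and qmod_1 [simp]: "1 \<in> qmod m \<rho>"
  using qmod_cst[of 0] qmod_cst[of 1] by simp_all

lemma qmod_square: "q \<in> band \<rho> \<Longrightarrow> hermitian_conj q * q \<in> qmod m \<rho>"
  by (intro psd_subset_qmod psd_square)

lemma qmod_sum: "(\<And>i. i \<in> I \<Longrightarrow> f i \<in> qmod m \<rho>) \<Longrightarrow> (\<Sum>i\<in>I. f i) \<in> qmod m \<rho>"
  by (induction I rule: infinite_finite_induct) (simp_all add: qmod_add)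

lemma qmod_prod: "(\<And>i. i \<in> I \<Longrightarrow> f i \<in> qmod m \<rho>) \<Longrightarrow> (\<Prod>i\<in>I. f i) \<in> qmod m \<rho>"
  by (induction I rule: infinite_finite_induct) (simp_all add: qmod_mult)

lemma qmod_power: "p \<in> qmod m \<rho> \<Longrightarrow> p ^ k \<in> qmod m \<rho>"
  by (induction k) (simp_all add: qmod_mult)

lemma qmod_of_nat: "of_nat k \<in> qmod m \<rho>"
  by (induction k) (auto intro: qmod_add)

lemma qmod_ball_poly [simp]: "ball_poly m \<rho> \<in> qmod m \<rho>"
  using qmodI[OF psd_0 psd_cst[of 1]] by simp


section \<open>Boundedness\<close>

definition freqs :: "nat \<Rightarrow> (int ^ 'n) set" where
  "freqs \<rho> = {a. freq_degree a \<le> \<rho>}"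

lemma finite_freqs [simp]: "finite (freqs \<rho>)"
  by (simp add: freqs_def finite_freq_degree_le)

lemma freqs_uminus [simp]: "- a \<in> freqs \<rho> \<longleftrightarrow> a \<in> freqs \<rho>"
  by (simp add: freqs_def)

definition var :: "int ^ 'n \<Rightarrow> ('n::finite) cpoly" where
  "var a = Poly_Mapping.single {#a#} 1"

lemma hermitian_conj_var [simp]: "hermitian_conj (var a) = var (- a)"
  by (simp add: var_def)

lemma band_var: "a \<in> freqs \<rho> \<Longrightarrow> var a \<in> band \<rho>"
  by (auto simp: var_def freqs_def intro: band_single)

lemma eval_cpoly_var [simp]: "eval_cpoly z (var a) = z a"
  by (simp add: var_def eval_cpoly_single)

lemma weight_ge_1: "1 \<le> weight m (a :: int ^ 'n)"
proof -
  have "(0::int) \<le> (\<Sum>i\<in>UNIV. (a $ i)\<^sup>2)" by (intro sum_nonneg) auto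
  then have "(1::real) \<le> 1 + of_int (\<Sum>i\<in>UNIV. (a $ i)\<^sup>2)" by linarith
  then show ?thesis unfolding weight_def by (rule one_le_power)
qed

lemma ball_poly_eq:
  "ball_poly m \<rho> = 1 - (\<Sum>a\<in>freqs \<rho>. cst (of_real (weight m a)) * (hermitian_conj (var a) * var a))"
  by (simp add: ball_poly_def freqs_def var_def cst_def mult_single add_mset_commute[of "- _"])

lemma eval_cpoly_ball_poly:
  assumes "hermitian_point z"
  shows "eval_cpoly z (ball_poly m \<rho>) = of_real (1 - (\<Sum>a\<in>freqs \<rho>. weight m a * (cmod (z a))\<^sup>2))"
proof -
  have "z (- a) * z a = of_real ((cmod (z a))\<^sup>2)" for a
    using assms by (simp add: hermitian_point_def complex_norm_square mult.commute del: of_real_power)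
  then show ?thesis
    by (simp add: ball_poly_eq eval_cpoly_diff eval_cpoly_sum eval_cpoly_mult del: of_real_power)
qed

text \<open>All weights are at least 1, so whatever the constraint subtracts beyond |c_a|^2 is a
  nonnegative combination of Hermitian squares and can be added back.\<close>

lemma var_bounded:
  assumes a: "a \<in> freqs \<rho>"
  shows "1 - hermitian_conj (var a) * var a \<in> qmod m \<rho>"
proof -
  let ?f = "\<lambda>b. hermitian_conj (var b) * var b"
  have "1 - ?f a = ball_poly m \<rho> + (\<Sum>b\<in>freqs \<rho> - {a}. cst (of_real (weight m b)) * ?f b)
      + cst (of_real (weight m a - 1)) * ?f a"
    using a by (simp add: ball_poly_eq sum.remove[of _ a] cst_diff algebra_simps)
  also have "\<dots> \<in> qmod m \<rho>"
  proof (intro qmod_add qmod_sum qmod_mult[OF qmod_cst qmod_square] band_var qmod_ball_poly)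
    show "0 \<le> weight m b" "0 \<le> weight m b - 1" for b :: "int ^ 'n"
      using weight_ge_1[of m b] by simp_all
  qed (use a in auto)
  finally show ?thesis .
qed

text \<open>The Archimedean property, stated for Hermitian squares so that it makes sense for
  elements that are not self-conjugate.\<close>

definition bounded_cpoly :: "nat \<Rightarrow> nat \<Rightarrow> ('n::finite) cpoly \<Rightarrow> bool" where
  "bounded_cpoly m \<rho> h \<longleftrightarrow> (\<exists>K\<ge>0. cst (of_real K) - hermitian_conj h * h \<in> qmod m \<rho>)"

lemma bounded_cpoly_mult:
  assumes "bounded_cpoly m \<rho> p" "bounded_cpoly m \<rho> q" and "p \<in> band \<rho>"
  shows "bounded_cpoly m \<rho> (p * q)"
proof -
  obtain K where K: "K \<ge> 0" "cst (of_real K) - hermitian_conj p * p \<in> qmod m \<rho>"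
    using assms by (auto simp: bounded_cpoly_def)
  obtain M where M: "M \<ge> 0" "cst (of_real M) - hermitian_conj q * q \<in> qmod m \<rho>"
    using assms by (auto simp: bounded_cpoly_def)
  have "cst (of_real (K * M)) - hermitian_conj (p * q) * (p * q)
    = (cst (of_real K) - hermitian_conj p * p) * cst (of_real M)
     + (hermitian_conj p * p) * (cst (of_real M) - hermitian_conj q * q)"
    by (simp add: cst_mult hermitian_conj_simps algebra_simps)
  also have "\<dots> \<in> qmod m \<rho>"
    by (intro qmod_add qmod_mult qmod_square qmod_cst K M assms)
  finally show ?thesis
    using K M unfolding bounded_cpoly_def by (intro exI[of _ "K * M"]) auto
qed

text \<open>Parallelogram law: |p + q|^2 + |p - q|^2 = 2 |p|^2 + 2 |q|^2, where the square of p - q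
  serves as slack.\<close>

lemma bounded_cpoly_add:
  assumes "bounded_cpoly m \<rho> p" "bounded_cpoly m \<rho> q" and "p \<in> band \<rho>" "q \<in> band \<rho>"
  shows "bounded_cpoly m \<rho> (p + q)"
proof -
  obtain K where K: "K \<ge> 0" "cst (of_real K) - hermitian_conj p * p \<in> qmod m \<rho>"
    using assms by (auto simp: bounded_cpoly_def)
  obtain M where M: "M \<ge> 0" "cst (of_real M) - hermitian_conj q * q \<in> qmod m \<rho>"
    using assms by (auto simp: bounded_cpoly_def)
  have "cst (of_real (2 * K + 2 * M)) - hermitian_conj (p + q) * (p + q)
    = cst (of_real 2) * (cst (of_real K) - hermitian_conj p * p)
     + cst (of_real 2) * (cst (of_real M) - hermitian_conj q * q) + hermitian_conj (p - q) * (p - q)"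
    by (simp add: cst_mult cst_add cst_numeral hermitian_conj_simps algebra_simps)
  also have "\<dots> \<in> qmod m \<rho>"
    by (intro qmod_add qmod_mult qmod_square qmod_cst band_diff K M assms) auto
  finally show ?thesis
    using K M unfolding bounded_cpoly_def by (intro exI[of _ "2 * K + 2 * M"]) auto
qed

lemma bounded_cpoly_cst: "bounded_cpoly m \<rho> (cst c :: ('n::finite) cpoly)"
proof -
  have "cst (of_real ((cmod c)\<^sup>2)) - hermitian_conj (cst c) * cst c = (0 :: 'n cpoly)"
    unfolding hermitian_conj_cst cst_mult[symmetric] complex_norm_square by (simp add: mult.commute)
  then show ?thesis unfolding bounded_cpoly_def by (intro exI[of _ "(cmod c)\<^sup>2"]) auto
qed

lemma single_add_mset: "Poly_Mapping.single (add_mset a \<alpha>) c = var a * Poly_Mapping.single \<alpha> c"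
  by (simp add: var_def mult_single)

text \<open>Membership in \<open>band\<close> is repeated in the conclusion because the sum rule
  needs it for both summands, whereas \<open>band_induct\<close> hands over only the induction
  hypothesis there.\<close>

lemma bounded_cpoly_band: "p \<in> band \<rho> \<Longrightarrow> p \<in> band \<rho> \<and> bounded_cpoly m \<rho> p"
proof (induction rule: band_induct)
  case (single \<alpha> c)
  then show ?case
  proof (induction \<alpha>)
    case empty
    show ?case using bounded_cpoly_cst[of m \<rho> c] band_cst[of c \<rho>] by (simp add: cst_def)
  next
    case (add a \<alpha>)
    then have a: "a \<in> freqs \<rho>" by (simp add: freqs_def)
    have "bounded_cpoly m \<rho> (var a)"
      using var_bounded[OF a, of m] unfolding bounded_cpoly_def by (intro exI[of _ 1]) simp
    with add a show ?case
      by (auto simp: single_add_mset intro: band_mult bounded_cpoly_mult band_var)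
  qed
qed (auto intro: bounded_cpoly_add band_add)

section \<open>Bernstein partitions of unity\<close>

text \<open>Defined over any commutative ring because x will be an element of the polynomial ring,
  not a number.\<close>

definition bern :: "nat \<Rightarrow> nat \<Rightarrow> 'a::comm_ring_1 \<Rightarrow> 'a" where
  "bern N k x = of_nat (N choose k) * x ^ k * (1 - x) ^ (N - k)"

lemma sum_bern: "(\<Sum>k\<le>N. bern N k x) = 1"
  using binomial_ring[of x "1 - x" N] by (simp add: bern_def)

text \<open>The absorption identity for binomial coefficients; each application trades a factor k
  for a factor N x and reduces the moments of the Bernstein weights to their total sum.\<close>

lemma bern_Suc_Suc: "of_nat (Suc k) * bern (Suc N) (Suc k) x = of_nat (Suc N) * x * bern N k x"
proof -
  have "(of_nat (Suc k) * of_nat (Suc N choose Suc k) :: 'a) = of_nat (Suc N) * of_nat (N choose k)"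
    unfolding of_nat_mult[symmetric] by (simp only: Suc_times_binomial_eq mult.commute)
  then have "of_nat (Suc k) * bern (Suc N) (Suc k) x
      = (of_nat (Suc N) * of_nat (N choose k)) * (x ^ Suc k * (1 - x) ^ (N - k))"
    unfolding bern_def by (simp only: diff_Suc_Suc mult.assoc[symmetric])
  then show ?thesis by (simp only: bern_def power_Suc mult_ac)
qed

lemma sum_k_bern: "(\<Sum>k\<le>N. of_nat k * bern N k x) = of_nat N * x"
proof (cases N)
  case (Suc M)
  have "(\<Sum>k\<le>N. of_nat k * bern N k x) = (\<Sum>k\<le>M. of_nat (Suc k) * bern (Suc M) (Suc k) x)"
    unfolding Suc by (subst sum.atMost_Suc_shift) simp
  also have "\<dots> = (\<Sum>k\<le>M. of_nat (Suc M) * x * bern M k x)"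
    by (simp only: bern_Suc_Suc)
  finally show ?thesis by (simp only: Suc sum_distrib_left[symmetric] sum_bern mult_1_right)
qed simp

lemma sum_kk_bern: "(\<Sum>k\<le>N. of_nat k * of_nat k * bern N k x) = of_nat N * x + of_nat N * (of_nat N - 1) * x * x"
proof (cases N)
  case (Suc M)
  have "(\<Sum>k\<le>N. of_nat k * of_nat k * bern N k x)
      = (\<Sum>k\<le>M. of_nat (Suc k) * (of_nat (Suc k) * bern (Suc M) (Suc k) x))"
    unfolding Suc by (subst sum.atMost_Suc_shift) (simp add: mult.assoc)
  also have "\<dots> = (\<Sum>k\<le>M. of_nat (Suc M) * x * (bern M k x + of_nat k * bern M k x))"
    unfolding bern_Suc_Suc by (intro sum.cong refl) (simp add: algebra_simps)
  also have "\<dots> = of_nat (Suc M) * x * (1 + of_nat M * x)"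
    by (simp only: sum_distrib_left[symmetric] sum.distrib sum_bern sum_k_bern)
  finally show ?thesis by (simp add: Suc algebra_simps)
qed simp

text \<open>The variance of the binomial distribution, valid as a polynomial identity and therefore
  for ring elements x.\<close>

lemma bern_variance:
  "(\<Sum>k\<le>N. bern N k x * (of_nat N * x - of_nat k)\<^sup>2) = of_nat N * x * (1 - x)"
proof -
  have eq: "(\<Sum>k\<le>N. bern N k x * (of_nat N * x - of_nat k)\<^sup>2)
    = (of_nat N * x)\<^sup>2 * (\<Sum>k\<le>N. bern N k x) - 2 * of_nat N * x * (\<Sum>k\<le>N. of_nat k * bern N k x)
      + (\<Sum>k\<le>N. of_nat k * of_nat k * bern N k x)"
    unfolding sum_distrib_left sum.distrib[symmetric] sum_subtractf[symmetric]
    by (intro sum.cong refl) (simp add: power2_eq_square algebra_simps)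
  show ?thesis
    unfolding eq sum_bern sum_k_bern sum_kk_bern by (simp add: power2_eq_square algebra_simps)
qed

section \<open>Positivity on the ball\<close>

text \<open>The self-conjugate elements (c_a + c_{-a})/2 and (c_a - c_{-a})/(2 \<i>), that is, real
  and imaginary part of c_a; the flag \<open>True\<close> selects the imaginary part.\<close>

definition real_coord :: "(int ^ 'n) \<times> bool \<Rightarrow> ('n::finite) cpoly" where
  "real_coord = (\<lambda>(a, im). if im then cst (- \<i> / 2) * (var a - var (- a)) else cst (1 / 2) * (var a + var (- a)))"

definition unit_coord :: "(int ^ 'n) \<times> bool \<Rightarrow> ('n::finite) cpoly" where
  "unit_coord i = cst (1 / 2) * (1 + real_coord i)"

lemma hermitian_conj_real_coord [simp]: "hermitian_conj (real_coord i) = real_coord i"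
  by (cases i) (simp add: real_coord_def hermitian_conj_simps add.commute cst_uminus algebra_simps)

lemma hermitian_conj_unit_coord [simp]: "hermitian_conj (unit_coord i) = unit_coord i"
  by (simp add: unit_coord_def hermitian_conj_simps)

lemma band_real_coord: "i \<in> freqs \<rho> \<times> UNIV \<Longrightarrow> real_coord i \<in> band \<rho>"
  by (cases i) (auto simp: real_coord_def intro!: band_mult band_diff band_add band_var)

lemma band_unit_coord: "i \<in> freqs \<rho> \<times> UNIV \<Longrightarrow> unit_coord i \<in> band \<rho>"
  unfolding unit_coord_def by (intro band_mult band_add band_real_coord) auto

lemma cst_mult_mult: "(cst a * p) * (cst b * q) = cst (a * b) * (p * q)"
  by (simp add: cst_mult mult_ac)

lemma real_coord_sum_squares:
  fixes a :: "int ^ 'n"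
  shows "real_coord (a, False) * real_coord (a, False) + real_coord (a, True) * real_coord (a, True) = var (- a) * var a"
proof -
  let ?s = "var a + var (- a) :: 'n cpoly" and ?d = "var a - var (- a) :: 'n cpoly"
  have "real_coord (a, False) * real_coord (a, False) + real_coord (a, True) * real_coord (a, True)
      = cst (1/4) * (?s * ?s) + cst (- (1/4)) * (?d * ?d)"
    by (simp add: real_coord_def cst_mult_mult)
  also have "\<dots> = cst (1/4) * (?s * ?s - ?d * ?d)"
    by (simp only: cst_uminus right_diff_distrib) simp
  also have "?s * ?s - ?d * ?d = cst 4 * (var (- a) * var a)"
    by (simp add: cst_numeral algebra_simps)
  also have "cst (1/4) * (cst 4 * (var (- a) * var a)) = cst (1/4 * 4) * (var (- a) * var a :: 'n cpoly)"
    by (simp only: cst_mult mult.assoc)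
  finally show ?thesis by simp
qed

text \<open>The sum of the squares of the two parts is |c_a|^2, so one minus the square of one part
  is 1 - |c_a|^2 plus the square of the other.\<close>

lemma real_coord_bounded:
  assumes i: "i \<in> freqs \<rho> \<times> UNIV"
  shows "1 - real_coord i * real_coord i \<in> qmod m \<rho>"
proof -
  obtain a b where ab: "i = (a, b)" "a \<in> freqs \<rho>" using i by auto
  have "1 - real_coord i * real_coord i = (1 - hermitian_conj (var a) * var a) + hermitian_conj (real_coord (a, \<not> b)) * real_coord (a, \<not> b)"
    using real_coord_sum_squares[of a] by (cases b) (simp_all add: ab algebra_simps)
  also have "\<dots> \<in> qmod m \<rho>"
    using ab by (intro qmod_add var_bounded qmod_square band_real_coord) auto
  finally show ?thesis .
qed

lemma cst_half_add: "cst (1/2) * p + cst (1/2) * p = p"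
  unfolding distrib_right[symmetric] cst_add[symmetric] by simp

text \<open>From (1 + h)^2 + (1 - h^2) = 2 (1 + h): a bound on the square of h yields a linear
  bound. Applied to h and to -h it puts u and 1 - u into the quadratic module.\<close>

lemma qmod_half:
  assumes h: "h \<in> band \<rho>" "hermitian_conj h = h" "1 - h * h \<in> qmod m \<rho>"
  shows "cst (1/2) * (1 + h) \<in> qmod m \<rho>"
proof -
  have "cst (of_real (1/4)) * (hermitian_conj (1 + h) * (1 + h) + (1 - h * h)) = cst (1/4) * (2 * (1 + h))"
    by (simp add: hermitian_conj_simps h algebra_simps)
  also have "\<dots> = cst (1/4 * 2) * (1 + h)"
    by (simp only: cst_mult cst_numeral mult.assoc)
  finally have "cst (1/2) * (1 + h) = cst (of_real (1/4)) * (hermitian_conj (1 + h) * (1 + h) + (1 - h * h))"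
    by simp
  also have "\<dots> \<in> qmod m \<rho>"
    by (intro qmod_mult qmod_add qmod_cst qmod_square band_add h) auto
  finally show ?thesis .
qed

lemma unit_coord_qmod:
  assumes i: "i \<in> freqs \<rho> \<times> UNIV"
  shows "unit_coord i \<in> qmod m \<rho>" "1 - unit_coord i \<in> qmod m \<rho>"
proof -
  show "unit_coord i \<in> qmod m \<rho>"
    unfolding unit_coord_def by (intro qmod_half band_real_coord real_coord_bounded i) simp
  have "cst (1/2) * (1 + - real_coord i) \<in> qmod m \<rho>"
    using real_coord_bounded[OF i, of m] band_real_coord[OF i]
    by (intro qmod_half) (simp_all add: band_uminus hermitian_conj_uminus)
  moreover have "1 - unit_coord i = cst (1/2) * (1 + - real_coord i)"
    using cst_half_add[of "1 :: 'a cpoly"] by (simp add: unit_coord_def algebra_simps)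
  ultimately show "1 - unit_coord i \<in> qmod m \<rho>" by simp
qed

section \<open>Approximating polynomials by their values at points of the cube\<close>

definition cube :: "('i \<Rightarrow> real) set" where
  "cube = {v. \<forall>i. 0 \<le> v i \<and> v i \<le> 1}"

text \<open>The squared Euclidean distance from the coordinate vector to v as a ring element; a
  positive functional reads it as a variance around v.\<close>

definition dispersion :: "nat \<Rightarrow> ((int ^ 'n) \<times> bool \<Rightarrow> real) \<Rightarrow> ('n::finite) cpoly" where
  "dispersion \<rho> v = (\<Sum>i\<in>freqs \<rho> \<times> UNIV. (unit_coord i - cst (of_real (v i)))\<^sup>2)"

text \<open>A form of Lipschitz continuity in the point \<open>v\<close> that positive functionals can exploit.\<close>

definition small :: "nat \<Rightarrow> nat \<Rightarrow> (((int ^ 'n) \<times> bool \<Rightarrow> real) \<Rightarrow> ('n::finite) cpoly) \<Rightarrow> bool" where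
  "small m \<rho> d \<longleftrightarrow> (\<forall>v\<in>cube. d v \<in> band \<rho>) \<and>
     (\<exists>C\<ge>0. \<forall>v\<in>cube. cst (of_real C) * dispersion \<rho> v - hermitian_conj (d v) * d v \<in> qmod m \<rho>)"

lemma small_unit_coord:
  fixes i :: "(int ^ 'n) \<times> bool"
  assumes i: "i \<in> freqs \<rho> \<times> UNIV"
  shows "small m \<rho> (\<lambda>v. unit_coord i - cst (of_real (v i)))"
  unfolding small_def
proof (intro conjI ballI exI[of _ 1])
  fix v :: "(int ^ 'n) \<times> bool \<Rightarrow> real"
  have "cst (of_real 1) * dispersion \<rho> v - hermitian_conj (unit_coord i - cst (of_real (v i))) * (unit_coord i - cst (of_real (v i)))
     = (\<Sum>j\<in>freqs \<rho> \<times> UNIV - {i}. hermitian_conj (unit_coord j - cst (of_real (v j))) * (unit_coord j - cst (of_real (v j))))"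
    using i by (simp add: dispersion_def sum.remove[of _ i] hermitian_conj_simps power2_eq_square)
  also have "\<dots> \<in> qmod m \<rho>"
    by (intro qmod_sum qmod_square band_diff band_unit_coord) auto
  finally show "cst (of_real 1) * dispersion \<rho> v - hermitian_conj (unit_coord i - cst (of_real (v i))) * (unit_coord i - cst (of_real (v i)))
    \<in> qmod m \<rho>" .
qed (simp_all add: band_diff band_unit_coord[OF i])

lemma small_0 [simp]: "small m \<rho> (\<lambda>v. 0)"
  by (auto simp: small_def)

lemma small_add:
  assumes "small m \<rho> d" "small m \<rho> e"
  shows "small m \<rho> (\<lambda>v. d v + e v)"
proof -
  obtain C where C: "0 \<le> C" "\<And>v. v \<in> cube \<Longrightarrow> cst (of_real C) * dispersion \<rho> v - hermitian_conj (d v) * d v \<in> qmod m \<rho>"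
    using assms by (auto simp: small_def)
  obtain D where D: "0 \<le> D" "\<And>v. v \<in> cube \<Longrightarrow> cst (of_real D) * dispersion \<rho> v - hermitian_conj (e v) * e v \<in> qmod m \<rho>"
    using assms by (auto simp: small_def)
  have b: "d v \<in> band \<rho>" "e v \<in> band \<rho>" if "v \<in> cube" for v
    using assms that by (auto simp: small_def)
  show ?thesis
    unfolding small_def
  proof (intro conjI ballI exI[of _ "2 * C + 2 * D"])
    fix v :: "(int ^ 'a) \<times> bool \<Rightarrow> real" assume v: "v \<in> cube"
    have "cst (of_real (2 * C + 2 * D)) * dispersion \<rho> v - hermitian_conj (d v + e v) * (d v + e v)
      = cst (of_real 2) * (cst (of_real C) * dispersion \<rho> v - hermitian_conj (d v) * d v)
       + cst (of_real 2) * (cst (of_real D) * dispersion \<rho> v - hermitian_conj (e v) * e v)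
       + hermitian_conj (d v - e v) * (d v - e v)"
      by (simp add: cst_mult cst_add cst_numeral hermitian_conj_simps algebra_simps)
    also have "\<dots> \<in> qmod m \<rho>"
      by (intro qmod_add qmod_mult[OF qmod_cst] qmod_square band_diff C D b v) auto
    finally show "cst (of_real (2 * C + 2 * D)) * dispersion \<rho> v - hermitian_conj (d v + e v) * (d v + e v) \<in> qmod m \<rho>" .
  qed (use C D b in \<open>auto intro: band_add\<close>)
qed

text \<open>A fixed polynomial factor is bounded in the Archimedean sense; this is what boundedness
  of all of \<open>band\<close> is for.\<close>

lemma small_mult:
  assumes "small m \<rho> d" and p: "p \<in> band \<rho>"
  shows "small m \<rho> (\<lambda>v. d v * p)"
proof -
  obtain C where C: "0 \<le> C" "\<And>v. v \<in> cube \<Longrightarrow> cst (of_real C) * dispersion \<rho> v - hermitian_conj (d v) * d v \<in> qmod m \<rho>"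
    using assms by (auto simp: small_def)
  obtain K where K: "0 \<le> K" "cst (of_real K) - hermitian_conj p * p \<in> qmod m \<rho>"
    using bounded_cpoly_band[OF p, of m] by (auto simp: bounded_cpoly_def)
  have b: "d v \<in> band \<rho>" if "v \<in> cube" for v
    using assms that by (auto simp: small_def)
  show ?thesis
    unfolding small_def
  proof (intro conjI ballI exI[of _ "C * K"])
    fix v :: "(int ^ 'a) \<times> bool \<Rightarrow> real" assume v: "v \<in> cube"
    have "cst (of_real (C * K)) * dispersion \<rho> v - hermitian_conj (d v * p) * (d v * p)
      = (cst (of_real C) * dispersion \<rho> v - hermitian_conj (d v) * d v) * cst (of_real K)
       + (hermitian_conj (d v) * d v) * (cst (of_real K) - hermitian_conj p * p)"
      by (simp add: cst_mult hermitian_conj_simps algebra_simps)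
    also have "\<dots> \<in> qmod m \<rho>"
      by (intro qmod_add qmod_mult[OF _ qmod_cst] qmod_mult[OF qmod_square] C K b v)
    finally show "cst (of_real (C * K)) * dispersion \<rho> v - hermitian_conj (d v * p) * (d v * p) \<in> qmod m \<rho>" .
  qed (use C K b p in \<open>auto intro: band_mult\<close>)
qed

text \<open>The scalar may vary with v as long as it is bounded on the cube, which is how
  coordinates of the cube point enter as factors.\<close>

lemma small_scale:
  assumes "small m \<rho> d" and k: "\<And>v. v \<in> cube \<Longrightarrow> cmod (k v) \<le> K"
  shows "small m \<rho> (\<lambda>v. cst (k v) * d v)"
proof -
  obtain C where C: "0 \<le> C" "\<And>v. v \<in> cube \<Longrightarrow> cst (of_real C) * dispersion \<rho> v - hermitian_conj (d v) * d v \<in> qmod m \<rho>"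
    using assms by (auto simp: small_def)
  have b: "d v \<in> band \<rho>" if "v \<in> cube" for v
    using assms that by (auto simp: small_def)
  show ?thesis
    unfolding small_def
  proof (intro conjI ballI exI[of _ "K\<^sup>2 * C"])
    fix v :: "(int ^ 'a) \<times> bool \<Rightarrow> real" assume v: "v \<in> cube"
    have kk: "cst (cnj (k v)) * cst (k v) = (cst (of_real ((cmod (k v))\<^sup>2)) :: 'a cpoly)"
      unfolding cst_mult[symmetric] complex_norm_square by (simp add: mult.commute)
    have "hermitian_conj (cst (k v) * d v) * (cst (k v) * d v)
       = (cst (cnj (k v)) * cst (k v)) * (hermitian_conj (d v) * d v)"
      by (simp add: hermitian_conj_simps mult_ac)
    then have "cst (of_real (K\<^sup>2 * C)) * dispersion \<rho> v - hermitian_conj (cst (k v) * d v) * (cst (k v) * d v)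
      = cst (of_real (K\<^sup>2)) * (cst (of_real C) * dispersion \<rho> v - hermitian_conj (d v) * d v)
       + cst (of_real (K\<^sup>2 - (cmod (k v))\<^sup>2)) * (hermitian_conj (d v) * d v)"
      unfolding kk by (simp add: cst_mult cst_diff algebra_simps del: of_real_power)
    also have "\<dots> \<in> qmod m \<rho>"
      using power_mono[OF k[OF v], of 2]
      by (intro qmod_add qmod_mult[OF qmod_cst] qmod_square C b v) auto
    finally show "cst (of_real (K\<^sup>2 * C)) * dispersion \<rho> v - hermitian_conj (cst (k v) * d v) * (cst (k v) * d v) \<in> qmod m \<rho>" .
  qed (use C b in \<open>auto intro: band_mult\<close>)
qed

text \<open>
  The four coordinates of \<open>a\<close> and \<open>-a\<close> enter symmetrically, which makes the point hermitian.
\<close>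

definition cube_point :: "nat \<Rightarrow> ((int ^ 'n) \<times> bool \<Rightarrow> real) \<Rightarrow> int ^ 'n \<Rightarrow> complex" where
  "cube_point \<rho> v a = (if a \<in> freqs \<rho>
     then Complex (v (a, False) + v (- a, False) - 1) (v (a, True) - v (- a, True)) else 0)"

lemma hermitian_point_cube_point: "hermitian_point (cube_point \<rho> v)"
  by (simp add: hermitian_point_def cube_point_def complex_eq_iff)

lemma cube_point_bound:
  assumes "v \<in> cube"
  shows "cmod (cube_point \<rho> v a) \<le> 2"
proof -
  have "0 \<le> v i" "v i \<le> 1" for i
    using assms by (simp_all add: cube_def del: split_paired_All)
  then have "\<bar>v (a, False) + v (- a, False) - 1\<bar> \<le> 1" "\<bar>v (a, True) - v (- a, True)\<bar> \<le> 1"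
    by (smt (verit))+
  then show ?thesis
    using cmod_le[of "cube_point \<rho> v a"] by (auto simp: cube_point_def)
qed

text \<open>As polynomials, the real parts of c_a and c_{-a} agree and the imaginary parts are
  opposite. Hence c_a = (u + u' - 1) + \<i> (v - v') with u, u' the real and v, v' the imaginary
  unit coordinates of a and -a, the very formula that defines \<open>cube_point\<close>. The error
  is a fixed linear combination of four coordinate errors.\<close>

lemma small_var:
  assumes a: "a \<in> freqs \<rho>"
  shows "small m \<rho> (\<lambda>v. var a - cst (cube_point \<rho> v a))"
proof -
  let ?w = "\<lambda>a b v. unit_coord (a, b) - cst (of_real (v (a, b)))"
  have e1: "cst (1/2) * real_coord (a, False) + cst (1/2) * real_coord (- a, False) = cst (1/2) * (var a + var (- a))"
    using cst_half_add[of "real_coord (a, False)"] by (simp add: real_coord_def add.commute)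
  have e2: "cst \<i> * (cst (1/2) * real_coord (a, True)) - cst \<i> * (cst (1/2) * real_coord (- a, True)) = cst (1/2) * (var a - var (- a))"
  proof -
    have "cst \<i> * (cst (1/2) * real_coord (a, True)) - cst \<i> * (cst (1/2) * real_coord (- a, True))
       = (cst \<i> * cst (1/2) * cst (- \<i> / 2) + cst \<i> * cst (1/2) * cst (- \<i> / 2)) * (var a - var (- a))"
      by (simp add: real_coord_def algebra_simps)
    also have "\<dots> = cst (1/2) * (var a - var (- a))"
      by (simp flip: cst_mult cst_add)
    finally show ?thesis .
  qed
  have "var a - cst (cube_point \<rho> v a) = (?w a False v + ?w (- a) False v) + cst \<i> * (?w a True v + cst (- 1) * ?w (- a) True v)" for v
  proof -
    have cz: "cst (cube_point \<rho> v a) = cst (of_real (v (a, False))) + cst (of_real (v (- a, False))) - 1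
        + cst \<i> * (cst (of_real (v (a, True))) - cst (of_real (v (- a, True))))"
    proof -
      have "cube_point \<rho> v a = of_real (v (a, False)) + of_real (v (- a, False)) - 1
        + \<i> * (of_real (v (a, True)) - of_real (v (- a, True)))"
        using a by (simp add: cube_point_def complex_eq_iff)
      then show ?thesis by (simp add: cst_add cst_diff cst_mult)
    qed
    have "(unit_coord (a, False) + unit_coord (- a, False)) + cst \<i> * (unit_coord (a, True) - unit_coord (- a, True)) = var a + 1"
    proof -
      have "(unit_coord (a, False) + unit_coord (- a, False)) + cst \<i> * (unit_coord (a, True) - unit_coord (- a, True))
         = (cst (1/2) * real_coord (a, False) + cst (1/2) * real_coord (- a, False))
           + (cst \<i> * (cst (1/2) * real_coord (a, True)) - cst \<i> * (cst (1/2) * real_coord (- a, True)))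
           + (cst (1/2) * 1 + cst (1/2) * 1)"
        by (simp add: unit_coord_def algebra_simps)
      also have "\<dots> = (cst (1/2) * var a + cst (1/2) * var a) + 1"
        unfolding e1 e2 cst_half_add[of 1] by (simp add: distrib_left right_diff_distrib)
      finally show ?thesis by (simp only: cst_half_add)
    qed
    then have va: "var a = (unit_coord (a, False) + unit_coord (- a, False)) + cst \<i> * (unit_coord (a, True) - unit_coord (- a, True)) - 1"
      by (simp only: eq_diff_eq)
    show ?thesis
      unfolding va cz by (simp add: cst_uminus algebra_simps)
  qed
  then show ?thesis
    using a by (simp only:) (intro small_add small_scale[where K = 1] small_unit_coord; simp)
qed

text \<open>Product rule along a monomial: with z the cube point, c_a q - z_a q(z) = (c_a - z_a) q +
  z_a (q - q(z)).\<close>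

lemma small_band:
  assumes "p \<in> band \<rho>"
  shows "small m \<rho> (\<lambda>v. p - cst (eval_cpoly (cube_point \<rho> v) p))"
  using assms
proof (induction rule: band_induct)
  case (single \<alpha> c)
  then show ?case
  proof (induction \<alpha>)
    case empty
    then show ?case by (simp add: eval_cpoly_single) (simp flip: cst_def)
  next
    case (add a \<alpha>)
    let ?q = "Poly_Mapping.single \<alpha> c"
    have a: "a \<in> freqs \<rho>" and q: "?q \<in> band \<rho>" using add.prems by (auto simp: freqs_def intro: band_single)
    have "var a * ?q - cst (eval_cpoly (cube_point \<rho> v) (var a * ?q))
      = (var a - cst (cube_point \<rho> v a)) * ?q + cst (cube_point \<rho> v a) * (?q - cst (eval_cpoly (cube_point \<rho> v) ?q))" for v
      by (simp add: eval_cpoly_mult cst_mult algebra_simps)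
    moreover have "small m \<rho> (\<lambda>v. ?q - cst (eval_cpoly (cube_point \<rho> v) ?q))"
      using add by simp
    ultimately show ?case
      unfolding single_add_mset
      by (simp only:) (intro small_add small_mult small_scale[where K = 2] small_var a q cube_point_bound)
  qed
next
  case (add p q)
  have "p + q - cst (eval_cpoly (cube_point \<rho> v) (p + q))
    = (p - cst (eval_cpoly (cube_point \<rho> v) p)) + (q - cst (eval_cpoly (cube_point \<rho> v) q))" for v
    by (simp add: eval_cpoly_add cst_add algebra_simps)
  then show ?case using small_add[OF add] by (simp only:)
qed


text \<open>Real-valued and homogeneous over real scalars only, so that the real part of a Riesz
  functional and all its localizations are instances.\<close>

locale positive_functional =
  fixes m \<rho> :: nat and L :: "('n::finite) cpoly \<Rightarrow> real"
  assumes add: "L (p + q) = L p + L q"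
    and scale: "L (cst (of_real r) * p) = r * L p"
    and nonneg: "p \<in> qmod m \<rho> \<Longrightarrow> 0 \<le> L p"
begin

lemma zero [simp]: "L 0 = 0"
  using scale[of 0 0] by simp

lemma uminus: "L (- p) = - L p"
  using scale[of "-1" p] by (simp add: cst_uminus)

lemma diff: "L (p - q) = L p - L q"
  using add[of p "- q"] by (simp add: uminus)

lemma const: "L (cst (of_real r)) = r * L 1"
  using scale[of r 1] by simp

lemma sum: "L (\<Sum>i\<in>I. f i) = (\<Sum>i\<in>I. L (f i))"
  by (induction I rule: infinite_finite_induct) (simp_all add: add)

text \<open>Positivity survives because the quadratic module is closed under products.\<close>

lemma localize:
  assumes "b \<in> qmod m \<rho>"
  shows "positive_functional m \<rho> (\<lambda>p. L (b * p))"
proof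
  fix r :: real and p :: "'n cpoly"
  have "b * (cst (of_real r) * p) = cst (of_real r) * (b * p)" by (simp add: mult_ac)
  then show "L (b * (cst (of_real r) * p)) = r * L (b * p)" by (simp only: scale)
qed (simp_all add: distrib_left add nonneg qmod_mult assms)

text \<open>Cauchy-Schwarz in additive form, from expanding the squares of \<eta> + h and \<eta> -
  h. Unlike the form with square roots, the bound is linear in L, so it can be summed over a
  partition of unity, and it is meaningful when L 1 = 0.\<close>

lemma abs_le:
  assumes h: "h \<in> band \<rho>" "hermitian_conj h = h"
    and S: "cst (of_real C) * S - hermitian_conj h * h \<in> qmod m \<rho>" and \<eta>: "0 < \<eta>"
  shows "\<bar>L h\<bar> \<le> \<eta> / 2 * L 1 + C / (2 * \<eta>) * L S"
proof -
  have S': "L (h * h) \<le> C * L S"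
    using nonneg[OF S] by (simp add: diff scale h)
  have *: "L h \<ge> - (\<eta> / 2 * L 1 + C / (2 * \<eta>) * L S)"
    if h: "h \<in> band \<rho>" "hermitian_conj h = h" "L (h * h) \<le> C * L S" for h
  proof -
    have "hermitian_conj (cst (of_real \<eta>) + h) * (cst (of_real \<eta>) + h)
        = cst (of_real (\<eta> * \<eta>)) + cst (of_real (2 * \<eta>)) * h + h * h"
      by (simp add: hermitian_conj_simps h cst_mult cst_numeral algebra_simps)
    then have "0 \<le> L (cst (of_real (\<eta> * \<eta>)) + cst (of_real (2 * \<eta>)) * h + h * h)"
      using nonneg[OF qmod_square[OF band_add[OF band_cst h(1)]], of "of_real \<eta>"] by simp
    then have "0 \<le> \<eta> * \<eta> * L 1 + 2 * \<eta> * L h + C * L S"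
      using h(3) by (simp only: add const scale)
    then show ?thesis using \<eta> by (simp add: field_simps)
  qed
  from *[OF h S'] *[of "- h"] h S' show ?thesis
    by (auto simp: band_uminus hermitian_conj_uminus uminus abs_le_iff)
qed

end

section \<open>The multivariate Bernstein partition of unity and its total variance\<close>

definition bernstein_partition :: "nat \<Rightarrow> nat \<Rightarrow> ((int ^ 'n) \<times> bool \<Rightarrow> nat) \<Rightarrow> ('n::finite) cpoly" where
  "bernstein_partition \<rho> N e = (\<Prod>i\<in>freqs \<rho> \<times> UNIV. bern N (e i) (unit_coord i))"

definition grid :: "nat \<Rightarrow> nat \<Rightarrow> ((int ^ 'n) \<times> bool \<Rightarrow> nat) set" where
  "grid \<rho> N = PiE (freqs \<rho> \<times> UNIV) (\<lambda>_. {..N})"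

text \<open>The truncation is inactive on the grid; it puts all values into the unit interval.\<close>

definition grid_point :: "nat \<Rightarrow> ((int ^ 'n) \<times> bool \<Rightarrow> nat) \<Rightarrow> (int ^ 'n) \<times> bool \<Rightarrow> real" where
  "grid_point N e i = min 1 (e i / N)"

lemma grid_point_cube: "grid_point N e \<in> cube"
  by (auto simp: grid_point_def cube_def)

lemma finite_grid [simp]: "finite (grid \<rho> N)"
  by (simp add: grid_def finite_PiE)

lemma bern_qmod: "x \<in> qmod m \<rho> \<Longrightarrow> 1 - x \<in> qmod m \<rho> \<Longrightarrow> bern N k x \<in> qmod m \<rho>"
  unfolding bern_def by (intro qmod_mult qmod_power qmod_of_nat)

lemma bernstein_partition_qmod: "bernstein_partition \<rho> N e \<in> qmod m \<rho>"
  unfolding bernstein_partition_def by (intro qmod_prod bern_qmod unit_coord_qmod)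

lemma sum_bernstein_partition: "(\<Sum>e\<in>grid \<rho> N. bernstein_partition \<rho> N e) = 1"
  unfolding bernstein_partition_def grid_def by (subst prod_sum_PiE[symmetric]) (simp_all add: sum_bern)

text \<open>Once the squared deviation is absorbed into the j-th factor, the sum over the grid
  factors over the coordinates. All factors but the j-th sum to 1, and the j-th is the
  one-dimensional variance.\<close>

lemma bernstein_partition_variance:
  fixes j :: "(int ^ 'n) \<times> bool"
  assumes N: "0 < N" and j: "j \<in> freqs \<rho> \<times> UNIV"
  shows "(\<Sum>e\<in>grid \<rho> N. bernstein_partition \<rho> N e * (unit_coord j - cst (of_real (grid_point N e j)))\<^sup>2)
    = cst (of_real (1 / N)) * (unit_coord j * (1 - unit_coord j))"
proof -
  let ?I = "freqs \<rho> \<times> (UNIV :: bool set)"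
  let ?d = "\<lambda>k. (unit_coord j - cst (of_real (k / N)))\<^sup>2"
  have "(\<Sum>e\<in>grid \<rho> N. bernstein_partition \<rho> N e * (unit_coord j - cst (of_real (grid_point N e j)))\<^sup>2)
      = (\<Sum>e\<in>grid \<rho> N. \<Prod>i\<in>?I. bern N (e i) (unit_coord i) * (if i = j then ?d (e i) else 1))"
  proof (rule sum.cong[OF refl])
    fix e :: "(int ^ 'n) \<times> bool \<Rightarrow> nat" assume e: "e \<in> grid \<rho> N"
    then have "e j \<le> N" using j by (auto simp: grid_def PiE_iff)
    then have "grid_point N e j = e j / N"
      using N by (simp add: grid_point_def)
    then show "bernstein_partition \<rho> N e * (unit_coord j - cst (of_real (grid_point N e j)))\<^sup>2
        = (\<Prod>i\<in>?I. bern N (e i) (unit_coord i) * (if i = j then ?d (e i) else 1))"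
      using j by (simp add: prod.distrib bernstein_partition_def prod.delta)
  qed
  also have "\<dots> = (\<Prod>i\<in>?I. \<Sum>k\<le>N. bern N k (unit_coord i) * (if i = j then ?d k else 1))"
    unfolding grid_def by (subst prod_sum_PiE) simp_all
  also have "\<dots> = (\<Prod>i\<in>?I. if i = j then \<Sum>k\<le>N. bern N k (unit_coord i) * ?d k else 1)"
    by (intro prod.cong refl) (simp add: sum_bern)
  also have "\<dots> = (\<Sum>k\<le>N. bern N k (unit_coord j) * ?d k)"
    using j by (simp add: prod.delta)
  also have "\<dots> = (\<Sum>k\<le>N. cst (of_real (1 / (N * N))) * (bern N k (unit_coord j) * (of_nat N * unit_coord j - of_nat k)\<^sup>2))"
  proof (rule sum.cong[OF refl])
    fix k
    have "unit_coord j - cst (of_real (k / N)) = cst (of_real (1 / N)) * (of_nat N * unit_coord j - of_nat k)"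
    proof -
      have "cst (of_real (1 / N)) * of_nat N = (1 :: 'n cpoly)"
        using N by (simp flip: cst_of_nat cst_mult)
      moreover have "cst (of_real (1 / N)) * of_nat k = (cst (of_real (k / N)) :: 'n cpoly)"
        by (simp flip: cst_of_nat cst_mult)
      ultimately show ?thesis by (simp only: right_diff_distrib mult.assoc[symmetric]) simp
    qed
    then have "?d k = cst (of_real (1 / (N * N))) * (of_nat N * unit_coord j - of_nat k)\<^sup>2"
      by (simp only: power2_eq_square cst_mult_mult) simp
    then show "bern N k (unit_coord j) * ?d k = cst (of_real (1 / (N * N))) * (bern N k (unit_coord j) * (of_nat N * unit_coord j - of_nat k)\<^sup>2)"
      by (simp only: mult_ac)
  qed
  also have "\<dots> = cst (of_real (1 / (N * N))) * (of_nat N * unit_coord j * (1 - unit_coord j))"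
    by (simp only: sum_distrib_left[symmetric] bern_variance)
  also have "\<dots> = cst (of_real (1 / (N * N)) * of_nat N) * (unit_coord j * (1 - unit_coord j))"
    by (simp only: cst_mult cst_of_nat mult_ac)
  finally show ?thesis using N by simp
qed

text \<open>Each coordinate contributes L (u (1 - u)) / N, and 1 - u (1 - u) = (1 - u) + u^2 lies in
  the quadratic module. The number of grid points does not enter.\<close>

lemma (in positive_functional) sum_dispersion_le:
  assumes N: "0 < N"
  shows "(\<Sum>e\<in>grid \<rho> N. L (bernstein_partition \<rho> N e * dispersion \<rho> (grid_point N e))) \<le> card (freqs \<rho> \<times> (UNIV :: bool set) :: ((int ^ 'n) \<times> bool) set) * L 1 / N"
proof -
  let ?I = "freqs \<rho> \<times> UNIV :: ((int ^ 'n) \<times> bool) set"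
  have "(\<Sum>e\<in>grid \<rho> N. L (bernstein_partition \<rho> N e * dispersion \<rho> (grid_point N e)))
      = L (\<Sum>i\<in>?I. \<Sum>e\<in>grid \<rho> N. bernstein_partition \<rho> N e * (unit_coord i - cst (of_real (grid_point N e i)))\<^sup>2)"
    unfolding sum[symmetric] dispersion_def sum_distrib_left by (subst sum.swap) (rule refl)
  also have "\<dots> = (\<Sum>i\<in>?I. 1 / N * L (unit_coord i * (1 - unit_coord i)))"
    unfolding sum by (intro sum.cong refl, subst sum[symmetric]) (simp only: bernstein_partition_variance[OF N] scale)
  also have "\<dots> \<le> (\<Sum>i\<in>?I. 1 / N * L 1)"
  proof (intro sum_mono mult_left_mono)
    fix i assume i: "i \<in> ?I"
    have "1 - unit_coord i * (1 - unit_coord i) = (1 - unit_coord i) + hermitian_conj (unit_coord i) * unit_coord i"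
      by (simp add: algebra_simps)
    also have "\<dots> \<in> qmod m \<rho>"
      by (intro qmod_add unit_coord_qmod qmod_square band_unit_coord i)
    finally show "L (unit_coord i * (1 - unit_coord i)) \<le> L 1"
      using nonneg by (force simp: diff)
  qed simp
  finally show ?thesis by simp
qed

text \<open>On a monomial of degree d contraction multiplies the value by s^d, and Bernoulli's
  inequality gives 1 - s^d \<le> d (1 - s). The radius 2 is the one that covers all cube
  points.\<close>

lemma eval_cpoly_scale:
  fixes p :: "('n::finite) cpoly"
  shows "\<exists>D\<ge>0. \<forall>z s. (\<forall>a. cmod (z a) \<le> 2) \<longrightarrow> 0 \<le> s \<longrightarrow> s \<le> 1 \<longrightarrow>
    cmod (eval_cpoly (\<lambda>a. of_real s * z a) p - eval_cpoly z p) \<le> D * (1 - s)"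
proof (induction p rule: cpoly_induct)
  case (single \<alpha> c)
  show ?case
  proof (intro exI[of _ "cmod c * 2 ^ size \<alpha> * real (size \<alpha>)"] conjI allI impI)
    fix z :: "int ^ 'n \<Rightarrow> complex" and s :: real
    assume z: "\<forall>a. cmod (z a) \<le> 2" and s: "0 \<le> s" "s \<le> 1"
    have sc: "(\<Prod>a\<in>#\<alpha>. of_real s * z a) = of_real (s ^ size \<alpha>) * (\<Prod>a\<in>#\<alpha>. z a)"
      by (induction \<alpha>) simp_all
    have le: "cmod (\<Prod>a\<in>#\<alpha>. z a) \<le> 2 ^ size \<alpha>"
      using z by (induction \<alpha>) (simp_all add: norm_mult mult_mono)
    have "1 + real (size \<alpha>) * (s - 1) \<le> (1 + (s - 1)) ^ size \<alpha>"
      using s by (intro Bernoulli_inequality) auto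
    then have s': "1 - s ^ size \<alpha> \<le> real (size \<alpha>) * (1 - s)" by (simp add: algebra_simps)
    have "s ^ size \<alpha> \<le> 1" using s by (simp add: power_le_one)
    then have "cmod (of_real (s ^ size \<alpha>) - 1) = 1 - s ^ size \<alpha>"
      using norm_of_real[of "s ^ size \<alpha> - 1", where 'a = complex] by simp
    moreover have "eval_cpoly (\<lambda>a. of_real s * z a) (Poly_Mapping.single \<alpha> c) - eval_cpoly z (Poly_Mapping.single \<alpha> c)
       = c * (\<Prod>a\<in>#\<alpha>. z a) * (of_real (s ^ size \<alpha>) - 1)"
      unfolding eval_cpoly_single sc by (simp add: algebra_simps)
    ultimately have "cmod (eval_cpoly (\<lambda>a. of_real s * z a) (Poly_Mapping.single \<alpha> c) - eval_cpoly z (Poly_Mapping.single \<alpha> c))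
       = cmod c * cmod (\<Prod>a\<in>#\<alpha>. z a) * (1 - s ^ size \<alpha>)"
      by (simp only: norm_mult)
    also have "\<dots> \<le> cmod c * 2 ^ size \<alpha> * (real (size \<alpha>) * (1 - s))"
      using le s' \<open>s ^ size \<alpha> \<le> 1\<close> by (intro mult_mono mult_left_mono) auto
    finally show "cmod (eval_cpoly (\<lambda>a. of_real s * z a) (Poly_Mapping.single \<alpha> c) - eval_cpoly z (Poly_Mapping.single \<alpha> c))
       \<le> cmod c * 2 ^ size \<alpha> * real (size \<alpha>) * (1 - s)" by (simp add: mult_ac)
  qed simp
next
  case (add p q)
  then obtain C D where C: "C \<ge> 0" "\<And>z s. (\<forall>a. cmod (z a) \<le> 2) \<Longrightarrow> 0 \<le> s \<Longrightarrow> s \<le> 1 \<Longrightarrow>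
      cmod (eval_cpoly (\<lambda>a. of_real s * z a) p - eval_cpoly z p) \<le> C * (1 - s)"
    and D: "D \<ge> 0" "\<And>z s. (\<forall>a. cmod (z a) \<le> 2) \<Longrightarrow> 0 \<le> s \<Longrightarrow> s \<le> 1 \<Longrightarrow>
      cmod (eval_cpoly (\<lambda>a. of_real s * z a) q - eval_cpoly z q) \<le> D * (1 - s)"
    by blast
  show ?case
  proof (intro exI[of _ "C + D"] conjI allI impI)
    fix z :: "int ^ 'n \<Rightarrow> complex" and s :: real
    assume z: "\<forall>a. cmod (z a) \<le> 2" and s: "0 \<le> s" "s \<le> 1"
    have "eval_cpoly (\<lambda>a. of_real s * z a) (p + q) - eval_cpoly z (p + q)
       = (eval_cpoly (\<lambda>a. of_real s * z a) p - eval_cpoly z p) + (eval_cpoly (\<lambda>a. of_real s * z a) q - eval_cpoly z q)"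
      by (simp add: eval_cpoly_add)
    then show "cmod (eval_cpoly (\<lambda>a. of_real s * z a) (p + q) - eval_cpoly z (p + q)) \<le> (C + D) * (1 - s)"
      using norm_triangle_mono[OF C(2)[OF z s] D(2)[OF z s]] by (simp add: distrib_right)
  qed (use C D in auto)
qed

text \<open>The finite-dimensional section of the ball at level \<rho>: coefficient families of
  trigonometric polynomials in the Sobolev ball.\<close>

definition ball_point :: "nat \<Rightarrow> nat \<Rightarrow> (int ^ 'n \<Rightarrow> complex) \<Rightarrow> bool" where
  "ball_point m \<rho> z \<longleftrightarrow> hermitian_point z \<and> (\<forall>a. a \<notin> freqs \<rho> \<longrightarrow> z a = 0) \<and>
     (\<Sum>a\<in>freqs \<rho>. weight m a * (cmod (z a))\<^sup>2) \<le> 1"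

text \<open>Grid points need not lie in the ball. A point with weighted square norm W > 1 is
  contracted by s = 1 / sqrt W onto the sphere, where p is nonnegative; p changes by at most D (1 -
  s), which the violation W - 1 of the constraint controls.\<close>

lemma lower_bound_off_ball:
  fixes p :: "('n::finite) cpoly"
  assumes pos: "\<And>z. ball_point m \<rho> z \<Longrightarrow> 0 \<le> Re (eval_cpoly z p)"
  shows "\<exists>D\<ge>0. \<forall>z. hermitian_point z \<longrightarrow> (\<forall>a. a \<notin> freqs \<rho> \<longrightarrow> z a = 0) \<longrightarrow> (\<forall>a. cmod (z a) \<le> 2) \<longrightarrow>
    - (D * max 0 (- Re (eval_cpoly z (ball_poly m \<rho>)))) \<le> Re (eval_cpoly z p)"
proof -
  obtain D where D: "D \<ge> 0" "\<And>z s. (\<forall>a. cmod (z a) \<le> 2) \<Longrightarrow> 0 \<le> s \<Longrightarrow> s \<le> 1 \<Longrightarrow>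
      cmod (eval_cpoly (\<lambda>a. of_real s * z a) p - eval_cpoly z p) \<le> D * (1 - s)"
    using eval_cpoly_scale[of p] by blast
  show ?thesis
  proof (intro exI[of _ D] conjI allI impI D(1))
    fix z :: "int ^ 'n \<Rightarrow> complex"
    assume h: "hermitian_point z" and supp: "\<forall>a. a \<notin> freqs \<rho> \<longrightarrow> z a = 0" and z: "\<forall>a. cmod (z a) \<le> 2"
    define W where "W = (\<Sum>a\<in>freqs \<rho>. weight m a * (cmod (z a))\<^sup>2)"
    have g: "Re (eval_cpoly z (ball_poly m \<rho>)) = 1 - W"
      by (simp add: eval_cpoly_ball_poly[OF h] W_def)
    show "- (D * max 0 (- Re (eval_cpoly z (ball_poly m \<rho>)))) \<le> Re (eval_cpoly z p)"
    proof (cases "W \<le> 1")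
      case True
      then have "0 \<le> Re (eval_cpoly z p)"
        using h supp by (intro pos) (simp add: ball_point_def W_def)
      moreover have "0 \<le> D * max 0 (- Re (eval_cpoly z (ball_poly m \<rho>)))" using D(1) by simp
      ultimately show ?thesis by linarith
    next
      case False
      define s where "s = 1 / sqrt W"
      have s: "0 \<le> s" "s \<le> 1" "s\<^sup>2 * W = 1"
        using False by (auto simp: s_def power_divide)
      have "ball_point m \<rho> (\<lambda>a. of_real s * z a)"
      proof -
        have "(\<Sum>a\<in>freqs \<rho>. weight m a * (cmod (of_real s * z a))\<^sup>2) = s\<^sup>2 * W"
          by (simp add: W_def sum_distrib_left norm_mult power_mult_distrib mult_ac)
        then show ?thesis
          using s h supp by (simp add: ball_point_def hermitian_point_def)
      qed
      then have "0 \<le> Re (eval_cpoly (\<lambda>a. of_real s * z a) p)" by (rule pos)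
      moreover have "Re (eval_cpoly (\<lambda>a. of_real s * z a) p - eval_cpoly z p) \<le> D * (1 - s)"
        using D(2)[OF z s(1,2)] complex_Re_le_cmod order_trans by blast
      \<comment> \<open>As s \<le> 1, s is at least its square 1/W, and 1 - 1/W \<le> W - 1 because
        W + 1/W \<ge> 2.\<close>
      moreover have "1 - s \<le> W - 1"
      proof -
        have "1 / W \<le> s"
        proof -
          have "1 / W = s * s" using s(3) False by (simp add: field_simps power2_eq_square)
          then show ?thesis using mult_left_mono[OF s(2,1)] by simp
        qed
        moreover have "1 - 1 / W \<le> W - 1"
          using False sum_squares_bound[of W 1] by (simp add: field_simps power2_eq_square)
        ultimately show ?thesis by linarith
      qed
      then have "D * (1 - s) \<le> D * max 0 (- Re (eval_cpoly z (ball_poly m \<rho>)))"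
        using D(1) by (intro mult_left_mono) (auto simp: g)
      ultimately show ?thesis by simp
    qed
  qed
qed

text \<open>Each localized functional M acts nearly as M 1 times evaluation at its grid point.
  Applied to the constraint, this shows that a grid point far outside the ball carries little mass;
  applied to p, it gives a lower bound whose error is summable over the grid.\<close>

theorem (in positive_functional) nonneg_on_ball:
  assumes p: "p \<in> band \<rho>" "hermitian_conj p = p"
    and pos: "\<And>z. ball_point m \<rho> z \<Longrightarrow> 0 \<le> Re (eval_cpoly z p)"
  shows "0 \<le> L p"
proof -
  let ?g = "ball_poly m \<rho> :: 'n cpoly" and ?z = "\<lambda>v. cube_point \<rho> v"
  define n where "n = card (freqs \<rho> \<times> UNIV :: ((int ^ 'n) \<times> bool) set)"
  obtain D where D: "D \<ge> 0" "\<And>z. hermitian_point z \<Longrightarrow> (\<forall>a. a \<notin> freqs \<rho> \<longrightarrow> z a = 0) \<Longrightarrow> (\<forall>a. cmod (z a) \<le> 2) \<Longrightarrow>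
    - (D * max 0 (- Re (eval_cpoly z ?g))) \<le> Re (eval_cpoly z p)"
    using lower_bound_off_ball[OF pos] by blast
  have ev_real: "eval_cpoly (?z v) h = of_real (Re (eval_cpoly (?z v) h))" if "hermitian_conj h = h" for v and h :: "'n cpoly"
    using eval_cpoly_hermitian_conj[OF hermitian_point_cube_point, of \<rho> v h] that by (simp add: complex_eq_iff)
  \<comment> \<open>C stems from the quadratic module alone, so it serves all functionals M, all
    \<eta> and all cube points; this uniformity permits summation over the grid.\<close>
  have approx: "\<exists>C\<ge>0. \<forall>M \<eta>. positive_functional m \<rho> M \<longrightarrow> 0 < \<eta> \<longrightarrow> (\<forall>v\<in>cube.
      \<bar>M h - Re (eval_cpoly (?z v) h) * M 1\<bar> \<le> \<eta> / 2 * M 1 + C / (2 * \<eta>) * M (dispersion \<rho> v))"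
    if h: "h \<in> band \<rho>" "hermitian_conj h = h" for h :: "'n cpoly"
  proof -
    obtain C where C: "C \<ge> 0" and S: "\<And>v. v \<in> cube \<Longrightarrow> cst (of_real C) * dispersion \<rho> v
        - hermitian_conj (h - cst (eval_cpoly (?z v) h)) * (h - cst (eval_cpoly (?z v) h)) \<in> qmod m \<rho>"
      using small_band[OF h(1), of m] unfolding small_def by blast
    show ?thesis
    proof (intro exI[of _ C] conjI C allI impI ballI)
      fix M :: "'n cpoly \<Rightarrow> real" and \<eta> :: real and v :: "(int ^ 'n) \<times> bool \<Rightarrow> real"
      assume "positive_functional m \<rho> M" and \<eta>: "0 < \<eta>" and v: "v \<in> cube"
      then interpret M: positive_functional m \<rho> M by simp
      have "hermitian_conj (h - cst (eval_cpoly (?z v) h)) = h - cst (eval_cpoly (?z v) h)"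
        using eval_cpoly_hermitian_conj[OF hermitian_point_cube_point, of \<rho> v h] by (simp add: hermitian_conj_simps h)
      then have "\<bar>M (h - cst (eval_cpoly (?z v) h))\<bar> \<le> \<eta> / 2 * M 1 + C / (2 * \<eta>) * M (dispersion \<rho> v)"
        using M.abs_le[OF _ _ S[OF v] \<eta>] by (simp add: band_diff h)
      then show "\<bar>M h - Re (eval_cpoly (?z v) h) * M 1\<bar> \<le> \<eta> / 2 * M 1 + C / (2 * \<eta>) * M (dispersion \<rho> v)"
        by (subst (asm) ev_real[OF h(2)]) (simp only: M.diff M.const)
    qed
  qed
  obtain Cp where Cp: "Cp \<ge> 0" "\<And>M \<eta> v. positive_functional m \<rho> M \<Longrightarrow> 0 < \<eta> \<Longrightarrow> v\<in>cube \<Longrightarrow>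
      \<bar>M p - Re (eval_cpoly (?z v) p) * M 1\<bar> \<le> \<eta> / 2 * M 1 + Cp / (2 * \<eta>) * M (dispersion \<rho> v)"
    using approx[OF p] by blast
  obtain Cg where Cg: "Cg \<ge> 0" "\<And>M \<eta> v. positive_functional m \<rho> M \<Longrightarrow> 0 < \<eta> \<Longrightarrow> v\<in>cube \<Longrightarrow>
      \<bar>M ?g - Re (eval_cpoly (?z v) ?g) * M 1\<bar> \<le> \<eta> / 2 * M 1 + Cg / (2 * \<eta>) * M (dispersion \<rho> v)"
    using approx[OF band_ball_poly hermitian_conj_ball_poly, of m] by blast
  \<comment> \<open>M of the constraint is nonnegative, so the violation at the grid point times M 1
    is at most the approximation error r. The constant D turns this into a lower bound for the value
    of p times M 1.\<close>
  have local: "- ((1 + D) * (\<eta> / 2) * M 1 + (Cp + D * Cg) / (2 * \<eta>) * M (dispersion \<rho> v)) \<le> M p"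
    if M: "positive_functional m \<rho> M" and \<eta>: "0 < \<eta>" and v: "v \<in> cube" for M \<eta> v
  proof -
    interpret M: positive_functional m \<rho> M by fact
    have M1: "0 \<le> M 1" and Mg: "0 \<le> M ?g" by (simp_all add: M.nonneg)
    let ?G = "Re (eval_cpoly (?z v) ?g)"
    define r where "r = \<eta> / 2 * M 1 + Cg / (2 * \<eta>) * M (dispersion \<rho> v)"
    have "- (?G * M 1) \<le> r" "0 \<le> r"
      using Cg(2)[OF M \<eta> v] Mg unfolding r_def by linarith+
    then have "max 0 (- ?G) * M 1 \<le> r" by (auto simp: max_def)
    then have "D * (max 0 (- ?G) * M 1) \<le> D * r" using D(1) by (rule mult_left_mono)
    moreover have "- (D * max 0 (- ?G)) * M 1 \<le> Re (eval_cpoly (?z v) p) * M 1"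
      using M1 cube_point_bound[OF v]
      by (intro mult_right_mono D(2) hermitian_point_cube_point) (auto simp: cube_point_def)
    ultimately have "- (D * r) - (\<eta> / 2 * M 1 + Cp / (2 * \<eta>) * M (dispersion \<rho> v)) \<le> M p"
      using Cp(2)[OF M \<eta> v] by (simp add: mult.assoc)
    then show ?thesis by (simp add: r_def algebra_simps add_divide_distrib)
  qed
  have L1: "0 \<le> L 1" by (simp add: nonneg)
  have bound: "- ((1 + D) * (\<eta> / 2) * L 1 + (Cp + D * Cg) / (2 * \<eta>) * (n * L 1 / N)) \<le> L p"
    if \<eta>: "0 < \<eta>" and N: "0 < N" for \<eta> and N :: nat
  proof -
    let ?b = "\<lambda>e. (1 + D) * (\<eta> / 2) * L (bernstein_partition \<rho> N e * 1)
        + (Cp + D * Cg) / (2 * \<eta>) * L (bernstein_partition \<rho> N e * dispersion \<rho> (grid_point N e))"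
    have "(\<Sum>e\<in>grid \<rho> N. L (bernstein_partition \<rho> N e * q)) = L q" for q
      unfolding sum[symmetric] sum_distrib_right[symmetric] sum_bernstein_partition by simp
    note sumL = this
    have "(\<Sum>e\<in>grid \<rho> N. - ?b e) \<le> (\<Sum>e\<in>grid \<rho> N. L (bernstein_partition \<rho> N e * p))"
      by (intro sum_mono local[OF localize \<eta>] bernstein_partition_qmod grid_point_cube)
    then have "- (\<Sum>e\<in>grid \<rho> N. ?b e) \<le> L p"
      unfolding sumL by (simp only: sum_negf)
    moreover have "(\<Sum>e\<in>grid \<rho> N. ?b e)
      = (1 + D) * (\<eta> / 2) * L 1 + (Cp + D * Cg) / (2 * \<eta>) * (\<Sum>e\<in>grid \<rho> N. L (bernstein_partition \<rho> N e * dispersion \<rho> (grid_point N e)))"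
      unfolding sum.distrib sum_distrib_left[symmetric] sumL ..
    ultimately have le: "- ((1 + D) * (\<eta> / 2) * L 1 + (Cp + D * Cg) / (2 * \<eta>) * (\<Sum>e\<in>grid \<rho> N. L (bernstein_partition \<rho> N e * dispersion \<rho> (grid_point N e)))) \<le> L p"
      by simp
    have "(Cp + D * Cg) / (2 * \<eta>) * (\<Sum>e\<in>grid \<rho> N. L (bernstein_partition \<rho> N e * dispersion \<rho> (grid_point N e))) \<le> (Cp + D * Cg) / (2 * \<eta>) * (n * L 1 / N)"
      using sum_dispersion_le[OF N] Cp(1) Cg(1) D(1) \<eta> unfolding n_def by (intro mult_left_mono) auto
    with le show ?thesis by linarith
  qed
  define B where "B = (1 + D) * L 1 / 2 + (Cp + D * Cg) * (n * L 1) / 2"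
  \<comment> \<open>One error is of order \<eta>, the other of order 1 / (\<eta> N); with \<eta> =
    1/k and N = k^2 both are of order 1/k.\<close>
  have "- (B / real k) \<le> L p" if k: "0 < k" for k :: nat
  proof -
    have "(1 + D) * ((1 / real k) / 2) * L 1 + (Cp + D * Cg) / (2 * (1 / real k)) * (n * L 1 / real (k * k)) = B / real k"
    proof -
      have "(1 + D) * ((1 / real k) / 2) * L 1 = ((1 + D) * L 1 / 2) / real k" by simp
      moreover have "(Cp + D * Cg) / (2 * (1 / real k)) * (n * L 1 / real (k * k)) = ((Cp + D * Cg) * (n * L 1) / 2) / real k"
        using k by simp
      ultimately show ?thesis unfolding B_def by (simp only: add_divide_distrib)
    qed
    then show ?thesis using bound[of "1 / real k" "k * k"] k by simp
  qed
  then have "\<forall>k\<ge>1. - (B / real k) \<le> L p" by simp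
  moreover have "(\<lambda>k. - (B / real k)) \<longlonglongrightarrow> - 0"
    by (intro tendsto_minus lim_const_over_n)
  ultimately show ?thesis
    by (intro LIMSEQ_le_const2[of _ "- 0 :: real", simplified]) auto
qed


text \<open>Polarization: a functional that is nonnegative on Hermitian squares must be real on
  self-conjugate elements.\<close>

lemma hermitian_square_difference:
  assumes "hermitian_conj h = h"
  shows "cst 4 * h = hermitian_conj (1 + h) * (1 + h) - hermitian_conj (1 - h) * (1 - h)"
  by (simp add: hermitian_conj_simps assms cst_numeral algebra_simps)

section \<open>Riesz functionals that are nonnegative on the quadratic module\<close>

context
  fixes m :: nat and y :: "(int ^ 'n::finite) multiset \<Rightarrow> complex"
  assumes pos: "\<And>p. p \<in> quad_module_inf m \<Longrightarrow> riesz y p \<in> \<real>\<^sub>\<ge>\<^sub>0"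
begin

lemma riesz_hermitian_real:
  assumes h: "h \<in> band \<rho>" "hermitian_conj h = h"
  shows "Im (riesz y h) = 0"
proof -
  have *: "Im (riesz y (hermitian_conj q * q)) = 0" if "q \<in> band \<rho>" for q
  proof -
    have "hermitian_conj q * q \<in> quad_module_inf m"
      using that qmod_square qmod_subset by blast
    then show ?thesis using pos by (auto simp: complex_nonneg_Reals_iff)
  qed
  have "4 * riesz y h = riesz y (hermitian_conj (1 + h) * (1 + h)) - riesz y (hermitian_conj (1 - h) * (1 - h))"
    by (simp only: riesz_cst_mult[symmetric] riesz_diff[symmetric] hermitian_square_difference[OF h(2)])
  then have "Im (4 * riesz y h) = 0"
    by (simp only: minus_complex.simps *[OF band_add[OF band_1 h(1)]] *[OF band_diff[OF band_1 h(1)]] diff_0_right)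
  then show ?thesis by simp
qed

lemma riesz_hermitian_conj:
  assumes p: "p \<in> band \<rho>"
  shows "riesz y (hermitian_conj p) = cnj (riesz y p)"
proof -
  have "Im (riesz y (p + hermitian_conj p)) = 0"
    using p by (intro riesz_hermitian_real[of _ \<rho>])
      (simp_all add: hermitian_conj_simps band_add band_hermitian_conj add.commute)
  moreover have "Im (riesz y (cst \<i> * (p - hermitian_conj p))) = 0"
    using p by (intro riesz_hermitian_real[of _ \<rho>])
      (simp_all add: hermitian_conj_simps band_diff band_mult band_hermitian_conj cst_uminus algebra_simps)
  ultimately show ?thesis
    by (simp add: riesz_add riesz_cst_mult riesz_diff complex_eq_iff)
qed

text \<open>The theorem on positive functionals concerns self-conjugate polynomials, so it is
  applied to p plus its conjugate; this doubles the real part of both the point values and the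
  functional.\<close>

lemma riesz_nonneg_on_ball:
  assumes p: "p \<in> band \<rho>" and nonneg: "\<And>z. ball_point m \<rho> z \<Longrightarrow> 0 \<le> Re (eval_cpoly z p)"
  shows "0 \<le> Re (riesz y p)"
proof -
  interpret L: positive_functional m \<rho> "\<lambda>p. Re (riesz y p)"
  proof
    show "0 \<le> Re (riesz y p)" if "p \<in> qmod m \<rho>" for p
      using pos[of p] that qmod_subset by (auto simp: complex_nonneg_Reals_iff)
  qed (simp_all add: riesz_add riesz_cst_mult)
  have "0 \<le> Re (riesz y (p + hermitian_conj p))"
  proof (rule L.nonneg_on_ball)
    show "0 \<le> Re (eval_cpoly z (p + hermitian_conj p))" if "ball_point m \<rho> z" for z
      using nonneg[OF that] that by (simp add: eval_cpoly_add eval_cpoly_hermitian_conj ball_point_def)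
  qed (simp_all add: hermitian_conj_simps p band_add band_hermitian_conj add.commute)
  then show ?thesis by (simp add: riesz_add riesz_hermitian_conj[OF p])
qed

end

section \<open>Square-integrable functions on the torus\<close>

text \<open>Integrate the square of c h - I, where c is the total mass and I the integral of h, and
  divide by c; zero mass is treated separately.\<close>

lemma (in finite_measure) integral_square_le:
  fixes h :: "'a \<Rightarrow> real"
  assumes h [measurable]: "h \<in> borel_measurable M" and h2: "integrable M (\<lambda>x. (h x)\<^sup>2)"
  shows "(integral\<^sup>L M h)\<^sup>2 \<le> measure M (space M) * (LINT x|M. (h x)\<^sup>2)"
proof -
  define c I J where "c = measure M (space M)" and "I = integral\<^sup>L M h" and "J = (LINT x|M. (h x)\<^sup>2)"
  have h1: "integrable M h"
    by (rule square_integrable_imp_integrable[OF h h2])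
  have "0 \<le> (LINT x|M. (c * h x - I)\<^sup>2)" by simp
  also have "\<dots> = (LINT x|M. c\<^sup>2 * (h x)\<^sup>2 - 2 * c * I * h x + I\<^sup>2)"
    by (intro Bochner_Integration.integral_cong) (simp_all add: power2_eq_square algebra_simps)
  also have "\<dots> = c\<^sup>2 * J - 2 * c * I * I + I\<^sup>2 * c"
    using h1 h2 by (simp add: I_def J_def c_def)
  finally have *: "0 \<le> c * (c * J - I\<^sup>2)" by (simp add: power2_eq_square algebra_simps)
  show ?thesis
  proof (cases "c = 0")
    case True
    then have "emeasure M (space M) = 0" unfolding c_def using emeasure_eq_measure by simp
    then have "AE x in M. False" by (intro AE_I[of _ _ "space M"]) auto
    then have "I = 0" unfolding I_def by (intro integral_eq_zero_AE) auto
    then show ?thesis using True by (simp add: c_def I_def)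
  next
    case False
    then have "0 < c" unfolding c_def by (simp add: order_less_le)
    then show ?thesis using * by (simp add: c_def I_def J_def zero_le_mult_iff)
  qed
qed

lemma sets_torus_measure: "sets (torus_measure :: (real ^ 'n) measure) = sets (restrict_space borel (cbox 0 1))"
  by (auto simp: torus_measure_def sets_restrict_space)

lemma space_torus_measure [simp]: "space torus_measure = cbox 0 1"
  by (simp add: torus_measure_def space_restrict_space)

lemma emeasure_torus_measure: "emeasure (torus_measure :: (real ^ 'n) measure) (cbox 0 1) = 1"
proof -
  have "emeasure (torus_measure :: (real ^ 'n) measure) (cbox 0 1) = emeasure lborel (cbox 0 (1 :: real ^ 'n))"
    unfolding torus_measure_def by (subst emeasure_restrict_space) auto
  also have "\<dots> = 1"
    by (subst emeasure_lborel_cbox) (auto simp: Basis_vec_def inner_axis intro!: prod.neutral)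
  finally show ?thesis .
qed

interpretation torus: finite_measure "torus_measure :: (real ^ 'n) measure"
  by standard (simp add: emeasure_torus_measure)

lemma measure_torus_measure [simp]: "measure torus_measure (cbox 0 (1 :: real ^ 'n)) = 1"
  by (simp add: measure_def emeasure_torus_measure)

lemma square_integrable_measurable: "square_integrable f \<Longrightarrow> f \<in> borel_measurable borel"
  by (simp add: square_integrable_def)

lemma square_integrableI_bounded:
  assumes [measurable]: "f \<in> borel_measurable borel" and "periodic f" and "\<And>x. cmod (f x) \<le> B"
  shows "square_integrable f"
proof -
  have "integrable torus_measure (\<lambda>x. (cmod (f x))\<^sup>2)"
  proof (rule torus.integrable_const_bound)
    show "AE x in torus_measure. norm ((cmod (f x))\<^sup>2) \<le> B\<^sup>2"
      using assms(3) by (intro AE_I2) (simp add: power_mono)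
  qed (rule measurable_torus_measure, measurable)
  then show ?thesis using assms by (simp add: square_integrable_def)
qed

lemma square_integrable_scale: "square_integrable f \<Longrightarrow> square_integrable (\<lambda>x. c * f x)"
  by (auto simp: square_integrable_def periodic_def norm_mult power_mult_distrib)

lemma square_integrable_add: "square_integrable f \<Longrightarrow> square_integrable g \<Longrightarrow> square_integrable (\<lambda>x. f x + g x)"
proof -
  assume "square_integrable f" "square_integrable g"
  then have "square_integrable (\<lambda>x. f x - (- 1) * g x)"
    by (intro square_integrable_diff square_integrable_scale)
  then show ?thesis by simp
qed

lemma square_integrable_sum:
  "(\<And>i. i \<in> I \<Longrightarrow> square_integrable (f i)) \<Longrightarrow> square_integrable (\<lambda>x. \<Sum>i\<in>I. f i x)"
  by (induction I rule: infinite_finite_induct) (simp_all add: square_integrable_zero square_integrable_add)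

lemma square_integrable_imp_integrable:
  assumes "square_integrable f"
  shows "integrable torus_measure f"
proof -
  have [measurable]: "f \<in> borel_measurable torus_measure"
    using assms by (intro measurable_torus_measure) (simp add: square_integrable_def)
  have "integrable torus_measure (\<lambda>x. cmod (f x))"
  proof (rule torus.square_integrable_imp_integrable)
    show "integrable torus_measure (\<lambda>x. (cmod (f x))\<^sup>2)"
      using assms unfolding square_integrable_def by blast
  qed measurable
  then show ?thesis by (simp add: integrable_norm_iff)
qed

definition l2norm :: "(real ^ 'n \<Rightarrow> complex) \<Rightarrow> real" where
  "l2norm f = sqrt (LINT x|torus_measure. (cmod (f x))\<^sup>2)"

lemma l2norm_nonneg [simp]: "0 \<le> l2norm f"
  by (simp add: l2norm_def)

lemma l2norm_power2: "(l2norm f)\<^sup>2 = (LINT x|torus_measure. (cmod (f x))\<^sup>2)"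
  by (simp add: l2norm_def)

lemma integral_cmod_le_l2norm:
  assumes "square_integrable f"
  shows "(LINT x|torus_measure. cmod (f x)) \<le> l2norm f"
proof -
  have [measurable]: "f \<in> borel_measurable torus_measure"
    using assms by (intro measurable_torus_measure) (simp add: square_integrable_def)
  have "(LINT x|torus_measure. cmod (f x))\<^sup>2 \<le> (l2norm f)\<^sup>2"
    using torus.integral_square_le[of "\<lambda>x. cmod (f x)"] assms by (simp add: l2norm_power2 square_integrable_def)
  then show ?thesis by (rule power2_le_imp_le) simp
qed

subsection \<open>The trigonometric basis\<close>

lemma fourier_basis_measurable [measurable]: "fourier_basis a \<in> borel_measurable borel"
  unfolding fourier_basis_def by (intro borel_measurable_continuous_onI continuous_intros)

lemma cmod_fourier_basis [simp]: "cmod (fourier_basis a x) = 1"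
  by (simp add: fourier_basis_def)

lemma fourier_basis_add: "fourier_basis (a + b) x = fourier_basis a x * fourier_basis b x"
  by (simp add: fourier_basis_def exp_add[symmetric] sum.distrib algebra_simps)

lemma fourier_basis_0 [simp]: "fourier_basis 0 x = 1"
  by (simp add: fourier_basis_def)

lemma cnj_fourier_basis: "cnj (fourier_basis a x) = fourier_basis (- a) x"
  by (simp add: fourier_basis_def exp_cnj sum_negf)

lemma periodic_fourier_basis: "periodic (fourier_basis (a :: int ^ 'n))"
  unfolding periodic_def
proof (intro allI)
  fix x :: "real ^ 'n" and k :: "int ^ 'n"
  define K where "K = (\<Sum>i\<in>UNIV. a $ i * k $ i)"
  have "(\<Sum>i\<in>UNIV. of_int (a $ i) * (x + (\<chi> i. of_int (k $ i))) $ i)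
      = (\<Sum>i\<in>UNIV. of_int (a $ i) * x $ i) + real_of_int K"
    by (simp add: K_def algebra_simps sum.distrib)
  then have "fourier_basis a (x + (\<chi> i. of_int (k $ i)))
     = fourier_basis a x * exp (2 * of_real pi * \<i> * of_int (- K))"
    by (simp add: fourier_basis_def exp_add[symmetric] algebra_simps)
  also have "exp (2 * of_real pi * \<i> * of_int (- K)) = 1"
    using exp_integer_2pi[of "of_int (- K)"] by (simp add: mult_ac)
  finally show "fourier_basis a (x + (\<chi> i. of_int (k $ i))) = fourier_basis a x" by simp
qed

lemma square_integrable_fourier_basis: "square_integrable (fourier_basis a)"
  by (rule square_integrableI_bounded[of _ 1]) (simp_all add: periodic_fourier_basis)

lemma integral_exp_unit_interval:
  assumes "k \<noteq> (0 :: int)"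
  shows "(LINT t|lborel. indicator {0..1} t *\<^sub>R exp (- (2 * of_real pi * \<i> * of_real (of_int k * t)))) = 0"
proof -
  define c where "c = - (2 * of_real pi * \<i> * of_int k)"
  have c: "c \<noteq> 0" using assms by (simp add: c_def)
  have "(LINT t|lborel. indicator {0..1} t *\<^sub>R exp (c * of_real t)) = exp (c * of_real 1) / c - exp (c * of_real 0) / c"
  proof (rule integral_FTC_Icc)
    fix t :: real
    have "((\<lambda>z. exp (c * z) / c) has_field_derivative exp (c * of_real t)) (at (of_real t))"
      using c by (auto intro!: derivative_eq_intros)
    then have "((\<lambda>s. exp (c * of_real s) / c) has_vector_derivative exp (c * of_real t)) (at t)"
      using has_vector_derivative_real_field by blast
    then show "((\<lambda>s. exp (c * of_real s) / c) has_vector_derivative exp (c * of_real t)) (at t within {0..1})"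
      by (rule has_vector_derivative_at_within)
  qed (auto intro!: continuous_intros)
  also have "exp (c * of_real 1) = 1"
    using exp_integer_2pi[of "of_int (- k)"] by (simp add: c_def mult_ac)
  finally show ?thesis by (simp add: c_def mult_ac)
qed

text \<open>Lebesgue measure is the image of a product measure over the standard basis and the
  exponential is a product over coordinates, so the integral factors; a coordinate with nonzero
  frequency contributes a factor 0.\<close>

lemma integral_fourier_basis:
  "(LINT x|torus_measure. fourier_basis (a :: int ^ 'n) x) = (if a = 0 then 1 else 0)"
proof (cases "a = 0")
  case True
  then show ?thesis by simp
next
  case False
  \<comment> \<open>The product formula indexes factors by basis vectors; \<open>THE\<close>
    recovers the coordinate i from \<open>axis i 1\<close>.\<close>
  let ?h = "\<lambda>(b :: real ^ 'n) t. indicator {0..1} t *\<^sub>R exp (- (2 * of_real pi * \<i> * of_real (of_int (a $ (THE i. b = axis i 1)) * t))) :: complex"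
  have B: "b \<in> Basis \<longleftrightarrow> (\<exists>i. b = axis i (1 :: real))" for b :: "real ^ 'n"
    by (auto simp: Basis_vec_def)
  have the: "(THE j. axis i (1 :: real) = axis j 1) = i" for i :: 'n
    by (rule the_equality) (auto simp: axis_eq_axis)
  interpret P: product_sigma_finite "\<lambda>_ :: real ^ 'n. lborel :: real measure"
    by standard
  have prod: "indicator (cbox 0 1) x *\<^sub>R fourier_basis a x = (\<Prod>b\<in>Basis. ?h b (x \<bullet> b))" for x :: "real ^ 'n"
  proof -
    have "(\<Prod>b\<in>Basis. ?h b (x \<bullet> b)) = (\<Prod>i\<in>UNIV. ?h (axis i 1) (x \<bullet> axis i 1))"
    proof -
      have *: "Basis = (\<lambda>i :: 'n. axis i (1 :: real)) ` UNIV" using B by auto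
      have "inj (\<lambda>i :: 'n. axis i (1 :: real))" by (auto simp: inj_on_def axis_eq_axis)
      then show ?thesis unfolding * by (subst prod.reindex) (simp_all only: comp_def)
    qed
    also have "\<dots> = (\<Prod>i\<in>UNIV. of_real (indicator {0..1} (x $ i)) * exp (- (2 * of_real pi * \<i> * of_real (of_int (a $ i) * x $ i))))"
      by (simp add: the inner_axis scaleR_conv_of_real)
    also have "\<dots> = of_real (\<Prod>i\<in>UNIV. indicator {0..1} (x $ i)) * fourier_basis a x"
      by (simp add: prod.distrib fourier_basis_def exp_sum[symmetric] sum_negf sum_distrib_left)
    also have "(\<Prod>i\<in>UNIV. indicator {0..1} (x $ i)) = (indicator (cbox 0 1) x :: real)"
      by (auto simp: indicator_def mem_box_cart intro: prod_zero)
    finally show ?thesis by (simp add: scaleR_conv_of_real)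
  qed
  have "continuous_on {0..1} (\<lambda>t. exp (- (2 * of_real pi * \<i> * of_real (of_int k * t))))" for k :: int
    by (intro continuous_intros)
  then have int: "integrable lborel (?h b)" for b
    by (intro borel_integrable_compact compact_Icc)
  obtain i where i: "a $ i \<noteq> 0" using False by (auto simp: vec_eq_iff)
  have e1: "(LINT x|torus_measure. fourier_basis a x) = (LINT x|lborel. indicator (cbox 0 1) x *\<^sub>R fourier_basis a x)"
    unfolding torus_measure_def by (rule integral_restrict_space) simp
  have e2: "(LINT x|lborel. indicator (cbox 0 1) x *\<^sub>R fourier_basis a x) = integral\<^sup>L lborel (\<lambda>x. \<Prod>b\<in>Basis. ?h b (x \<bullet> b))"
    by (simp only: prod)
  have e3: "integral\<^sup>L lborel (\<lambda>x :: real ^ 'n. \<Prod>b\<in>Basis. ?h b (x \<bullet> b))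
      = integral\<^sup>L (\<Pi>\<^sub>M b\<in>Basis. lborel) (\<lambda>f. \<Prod>b\<in>Basis. ?h b ((\<Sum>b\<in>Basis. f b *\<^sub>R b) \<bullet> b))"
    unfolding lborel_def[where 'a = "real ^ 'n"] lborel_eq_real[symmetric]
    by (subst integral_distr) (auto intro!: borel_measurable_prod)
  have e4: "integral\<^sup>L (\<Pi>\<^sub>M b\<in>Basis. lborel) (\<lambda>f. \<Prod>b\<in>Basis. ?h b ((\<Sum>b\<in>Basis. f b *\<^sub>R b) \<bullet> b))
      = integral\<^sup>L (\<Pi>\<^sub>M b\<in>Basis. lborel) (\<lambda>f. \<Prod>b\<in>Basis. ?h b (f b))"
    by (intro Bochner_Integration.integral_cong prod.cong refl) (simp add: inner_sum_left_Basis)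
  have e5: "integral\<^sup>L (\<Pi>\<^sub>M b\<in>Basis. lborel) (\<lambda>f. \<Prod>b\<in>Basis. ?h b (f b)) = (\<Prod>b\<in>Basis. integral\<^sup>L lborel (?h b))"
    by (rule P.product_integral_prod[where f = ?h, OF finite_Basis int])
  have e6: "(\<Prod>b\<in>Basis. integral\<^sup>L lborel (?h b)) = 0"
  proof (rule prod_zero)
    show "\<exists>b\<in>Basis. integral\<^sup>L lborel (?h b) = 0"
      using integral_exp_unit_interval[OF i] by (intro bexI[of _ "axis i 1"]) (simp_all add: the)
  qed simp
  show ?thesis
    unfolding e1 e2 e3 e4 e5 e6 using False by simp
qed

definition fcoeff :: "(real ^ 'n \<Rightarrow> complex) \<Rightarrow> int ^ 'n \<Rightarrow> complex" where
  "fcoeff f a = (LINT x|torus_measure. f x * fourier_basis a x)"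

lemma integrable_mult_fourier_basis:
  assumes "square_integrable f"
  shows "integrable torus_measure (\<lambda>x. f x * fourier_basis a x)"
proof (rule Bochner_Integration.integrable_bound[OF square_integrable_imp_integrable[OF assms]])
  have [measurable]: "f \<in> borel_measurable borel" by (rule square_integrable_measurable[OF assms])
  show "(\<lambda>x. f x * fourier_basis a x) \<in> borel_measurable torus_measure"
    by (rule measurable_torus_measure) measurable
qed (simp add: norm_mult)

lemma fcoeff_add: "square_integrable f \<Longrightarrow> square_integrable g \<Longrightarrow> fcoeff (\<lambda>x. f x + g x) a = fcoeff f a + fcoeff g a"
  and fcoeff_diff: "square_integrable f \<Longrightarrow> square_integrable g \<Longrightarrow> fcoeff (\<lambda>x. f x - g x) a = fcoeff f a - fcoeff g a"
  and fcoeff_scale: "fcoeff (\<lambda>x. c * f x) a = c * fcoeff f a"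
  by (simp_all add: fcoeff_def distrib_right left_diff_distrib integrable_mult_fourier_basis mult.assoc)

lemma fcoeff_0 [simp]: "fcoeff (\<lambda>x. 0) a = 0"
  by (simp add: fcoeff_def)

lemma fcoeff_sum: "(\<And>i. i \<in> I \<Longrightarrow> square_integrable (f i)) \<Longrightarrow>
    fcoeff (\<lambda>x. \<Sum>i\<in>I. f i x) a = (\<Sum>i\<in>I. fcoeff (f i) a)"
  by (induction I rule: infinite_finite_induct) (simp_all add: fcoeff_add square_integrable_sum)

lemma fcoeff_le_l2norm:
  assumes "square_integrable f"
  shows "cmod (fcoeff f a) \<le> l2norm f"
proof -
  have "cmod (fcoeff f a) \<le> (LINT x|torus_measure. cmod (f x * fourier_basis a x))"
    unfolding fcoeff_def by (rule integral_norm_bound)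
  also have "\<dots> \<le> l2norm f" using integral_cmod_le_l2norm[OF assms] by (simp add: norm_mult)
  finally show ?thesis .
qed

lemma fcoeff_fourier_basis: "fcoeff (fourier_basis (- b)) a = (if a = b then 1 else 0)"
  unfolding fcoeff_def fourier_basis_add[symmetric] integral_fourier_basis by simp

text \<open>The pairing that defines the coefficients has no conjugate, so e_{-a} is dual to e_a and
  carries the coefficient z_a.\<close>

definition trigpoly :: "(int ^ 'n \<Rightarrow> complex) \<Rightarrow> (int ^ 'n) set \<Rightarrow> real ^ 'n \<Rightarrow> complex" where
  "trigpoly z D x = (\<Sum>a\<in>D. z a * fourier_basis (- a) x)"

lemma square_integrable_trigpoly: "square_integrable (trigpoly z D)"
  unfolding trigpoly_def by (intro square_integrable_sum square_integrable_scale square_integrable_fourier_basis)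

lemma fcoeff_trigpoly:
  assumes "finite D"
  shows "fcoeff (trigpoly z D) a = (if a \<in> D then z a else 0)"
  unfolding trigpoly_def using assms
  by (subst fcoeff_sum) (auto simp: fcoeff_scale fcoeff_fourier_basis square_integrable_fourier_basis square_integrable_scale if_distrib[of "\<lambda>x. _ * x"] sum.delta cong: if_cong)

lemma fcoeff_cnj_trigpoly:
  assumes f: "square_integrable f" and D: "finite D"
  shows "(LINT x|torus_measure. f x * cnj (trigpoly z D x)) = (\<Sum>a\<in>D. cnj (z a) * fcoeff f a)"
proof -
  have "(LINT x|torus_measure. f x * cnj (trigpoly z D x)) = (LINT x|torus_measure. (\<Sum>a\<in>D. cnj (z a) * (f x * fourier_basis a x)))"
    by (simp add: trigpoly_def sum_distrib_left cnj_fourier_basis mult_ac)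
  also have "\<dots> = (\<Sum>a\<in>D. cnj (z a) * fcoeff f a)"
    unfolding fcoeff_def by (subst Bochner_Integration.integral_sum) (auto intro: integrable_mult_fourier_basis[OF f])
  finally show ?thesis .
qed

lemma l2norm_trigpoly:
  assumes "finite D"
  shows "(l2norm (trigpoly z D))\<^sup>2 = (\<Sum>a\<in>D. (cmod (z a))\<^sup>2)"
proof -
  have "complex_of_real ((l2norm (trigpoly z D))\<^sup>2) = (LINT x|torus_measure. trigpoly z D x * cnj (trigpoly z D x))"
    unfolding l2norm_power2 integral_complex_of_real[symmetric] by (simp only: complex_norm_square)
  also have "\<dots> = of_real (\<Sum>a\<in>D. (cmod (z a))\<^sup>2)"
    using assms by (simp add: fcoeff_cnj_trigpoly square_integrable_trigpoly fcoeff_trigpoly complex_norm_square mult.commute del: of_real_power)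
  finally show ?thesis by (simp only: of_real_eq_iff)
qed

lemma trigpoly_diff:
  assumes "finite E" "D \<subseteq> E"
  shows "trigpoly z E x - trigpoly z D x = trigpoly z (E - D) x"
  unfolding trigpoly_def using sum.subset_diff[OF assms(2,1), of "\<lambda>a. z a * fourier_basis (- a) x"] by simp

text \<open>Expands the nonnegative square norm of f minus its partial sum; the cross term and the
  norm of the partial sum are the same sum of squares.\<close>

lemma bessel:
  assumes f: "square_integrable f" and D: "finite D"
  shows "(\<Sum>a\<in>D. (cmod (fcoeff f a))\<^sup>2) \<le> (l2norm f)\<^sup>2"
proof -
  let ?g = "trigpoly (fcoeff f) D"
  have g: "square_integrable ?g" by (rule square_integrable_trigpoly)
  define S where "S = (\<Sum>a\<in>D. (cmod (fcoeff f a))\<^sup>2)"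
  have fg: "(LINT x|torus_measure. f x * cnj (?g x)) = of_real S"
    using f D by (simp add: fcoeff_cnj_trigpoly S_def complex_norm_square mult.commute del: of_real_power)
  have [measurable]: "f \<in> borel_measurable borel" "?g \<in> borel_measurable borel"
    using f g by (auto intro: square_integrable_measurable)
  have [measurable]: "cnj \<in> borel_measurable borel"
    by (intro borel_measurable_continuous_onI continuous_intros)
  have if2: "integrable torus_measure (\<lambda>x. (cmod (f x))\<^sup>2)" and ig2: "integrable torus_measure (\<lambda>x. (cmod (?g x))\<^sup>2)"
    using f g by (auto simp: square_integrable_def)
  have ifg: "integrable torus_measure (\<lambda>x. f x * cnj (?g x))"
  proof (rule Bochner_Integration.integrable_bound[OF Bochner_Integration.integrable_add[OF if2 ig2]])
    show "(\<lambda>x. f x * cnj (?g x)) \<in> borel_measurable torus_measure"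
      by (rule measurable_torus_measure) measurable
    have "cmod a * cmod b \<le> (cmod a)\<^sup>2 + (cmod b)\<^sup>2" for a b :: complex
    proof -
      have "0 \<le> cmod a * cmod b" by simp
      then show ?thesis using sum_squares_bound[of "cmod a" "cmod b"] by linarith
    qed
    then show "AE x in torus_measure. norm (f x * cnj (?g x)) \<le> norm ((cmod (f x))\<^sup>2 + (cmod (?g x))\<^sup>2)"
      by (simp add: norm_mult)
  qed
  define P where "P x = f x * cnj (?g x)" for x
  have iP: "integrable torus_measure P" and P: "(LINT x|torus_measure. P x) = of_real S"
    using ifg fg by (simp_all add: P_def[abs_def])
  have expand: "(cmod (u - v))\<^sup>2 = (cmod u)\<^sup>2 - 2 * Re (u * cnj v) + (cmod v)\<^sup>2" for u v
    by (simp only: cmod_power2) (simp add: power2_eq_square algebra_simps)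
  have "0 \<le> (LINT x|torus_measure. (cmod (f x - ?g x))\<^sup>2)" by simp
  also have "\<dots> = (LINT x|torus_measure. (cmod (f x))\<^sup>2 - 2 * Re (P x) + (cmod (?g x))\<^sup>2)"
    by (simp only: expand P_def)
  also have "\<dots> = (l2norm f)\<^sup>2 - 2 * S + (l2norm ?g)\<^sup>2"
    using if2 ig2 iP by (simp add: l2norm_power2 P integral_Re)
  also have "(l2norm ?g)\<^sup>2 = S" using D by (simp add: l2norm_trigpoly S_def)
  finally show ?thesis by (simp add: S_def)
qed


section \<open>Completeness of the space of square-integrable functions\<close>

lemma dist_abs_L2:
  assumes "square_integrable f" "square_integrable g"
  shows "dist (abs_L2 f) (abs_L2 g) = l2norm (\<lambda>x. f x - g x)"
  using assms by (simp add: dist_L2.abs_eq L2_eq_def l2norm_def)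

lemma fourier_coeff_abs_L2: "square_integrable f \<Longrightarrow> fourier_coeff (abs_L2 f) = fcoeff f"
  by (simp add: fourier_coeff.abs_eq L2_eq_def fcoeff_def[abs_def])

lemma L2_cases:
  obtains f where "square_integrable f" "F = abs_L2 f"
proof -
  have "L2_eq (rep_L2 F) (rep_L2 F)" by (rule Quotient3_rep_reflp[OF Quotient3_L2])
  moreover have "abs_L2 (rep_L2 F) = F" by (rule Quotient3_abs_rep[OF Quotient3_L2])
  ultimately show thesis by (intro that[of "rep_L2 F"]) (simp_all add: L2_eq_def)
qed

lemma abs_L2_eq_iff:
  assumes "square_integrable f" "square_integrable g"
  shows "abs_L2 f = abs_L2 g \<longleftrightarrow> (AE x in torus_measure. f x = g x)"
  using Quotient3_rel[OF Quotient3_L2, of f g] assms by (auto simp: L2_eq_def)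

lemma fourier_coeff_lipschitz: "cmod (fourier_coeff F a - fourier_coeff G a) \<le> dist F G"
proof -
  obtain f where f: "square_integrable f" "F = abs_L2 f" by (rule L2_cases)
  obtain g where g: "square_integrable g" "G = abs_L2 g" by (rule L2_cases)
  show ?thesis
    using fcoeff_le_l2norm[OF square_integrable_diff[OF f(1) g(1)], of a] f g
    by (simp add: fourier_coeff_abs_L2 fcoeff_diff dist_abs_L2)
qed

lemma continuous_on_fourier_coeff: "continuous_on S (\<lambda>F. fourier_coeff F a)"
proof (rule continuous_on_subset[of UNIV])
  show "continuous_on UNIV (\<lambda>F. fourier_coeff F a)"
    unfolding continuous_on_iff
  proof (intro ballI allI impI exI conjI)
    fix F G :: "'a L2" and e :: real
    assume "dist G F < e"
    then show "dist (fourier_coeff G a) (fourier_coeff F a) < e"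
      using fourier_coeff_lipschitz[of G a F] by (simp add: dist_norm)
  qed
qed simp

lemma l2norm_nn_integral:
  assumes [measurable]: "f \<in> borel_measurable borel"
    and le: "(\<integral>\<^sup>+x. ennreal ((cmod (f x))\<^sup>2) \<partial>torus_measure) \<le> ennreal (B\<^sup>2)" and B: "0 \<le> B"
  shows "integrable torus_measure (\<lambda>x. (cmod (f x))\<^sup>2)" "l2norm f \<le> B"
proof -
  have [measurable]: "f \<in> borel_measurable torus_measure" by (rule measurable_torus_measure) fact
  show int: "integrable torus_measure (\<lambda>x. (cmod (f x))\<^sup>2)"
    using le by (intro integrableI_bounded) (auto simp: order_le_less_trans)
  have "ennreal ((l2norm f)\<^sup>2) \<le> ennreal (B\<^sup>2)"
    using le nn_integral_eq_integral[OF int] by (simp add: l2norm_power2)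
  then have "(l2norm f)\<^sup>2 \<le> B\<^sup>2" by (simp add: ennreal_le_iff)
  then show "l2norm f \<le> B" using B by (rule power2_le_imp_le)
qed

lemma nn_integral_l2norm:
  assumes "square_integrable f"
  shows "(\<integral>\<^sup>+x. ennreal ((cmod (f x))\<^sup>2) \<partial>torus_measure) = ennreal ((l2norm f)\<^sup>2)"
  using assms by (subst nn_integral_eq_integral) (auto simp: square_integrable_def l2norm_power2)

text \<open>Riesz-Fischer: the L^1 norms of the increments are summable, so the sequence converges
  almost everywhere, and Fatou's lemma carries the L^2 bounds over to the limit.\<close>

lemma L2_fast_cauchy_limit:
  fixes f :: "nat \<Rightarrow> real ^ 'n \<Rightarrow> complex"
  assumes f: "\<And>k. square_integrable (f k)"
    and fast: "\<And>j k. k \<le> j \<Longrightarrow> l2norm (\<lambda>x. f j x - f k x) \<le> (1 / 2) ^ k"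
  shows "\<exists>g. square_integrable g \<and> (\<forall>k. l2norm (\<lambda>x. g x - f k x) \<le> (1 / 2) ^ k)"
proof -
  \<comment> \<open>Taking \<open>lim\<close> at every point makes g Borel and periodic everywhere,
    with no exceptional set, since \<open>lim\<close> depends only on the sequence of
    values.\<close>
  define g where "g x = lim (\<lambda>k. f k x)" for x
  have [measurable]: "f k \<in> borel_measurable borel" for k
    using f by (simp add: square_integrable_def)
  have [measurable]: "g \<in> borel_measurable borel"
    unfolding g_def[abs_def] by measurable
  have tm [measurable]: "h \<in> borel_measurable borel \<Longrightarrow> h \<in> borel_measurable torus_measure" for h :: "real ^ 'n \<Rightarrow> 'z :: topological_space"
    unfolding torus_measure_def by (rule measurable_restrict_space1) simp
  have "periodic g"
    using f by (simp add: periodic_def g_def square_integrable_def)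
  have conv: "AE x in torus_measure. convergent (\<lambda>k. f k x)"
  proof -
    have "(\<integral>\<^sup>+x. suminf (\<lambda>k. ennreal (cmod (f (Suc k) x - f k x))) \<partial>torus_measure)
        = suminf (\<lambda>k. \<integral>\<^sup>+x. ennreal (cmod (f (Suc k) x - f k x)) \<partial>torus_measure)"
      by (intro nn_integral_suminf tm) measurable
    also have "\<dots> \<le> suminf (\<lambda>k. ennreal ((1 / 2) ^ k))"
    proof (intro suminf_le summableI)
      fix k
      have d: "square_integrable (\<lambda>x. f (Suc k) x - f k x)" by (intro square_integrable_diff f)
      have "(\<integral>\<^sup>+x. ennreal (cmod (f (Suc k) x - f k x)) \<partial>torus_measure) = ennreal (LINT x|torus_measure. cmod (f (Suc k) x - f k x))"
        using square_integrable_imp_integrable[OF d] by (intro nn_integral_eq_integral) auto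
      also have "\<dots> \<le> ennreal ((1 / 2) ^ k)"
        using integral_cmod_le_l2norm[OF d] fast[of k "Suc k"] by (intro ennreal_leI) simp
      finally show "(\<integral>\<^sup>+x. ennreal (cmod (f (Suc k) x - f k x)) \<partial>torus_measure) \<le> ennreal ((1 / 2) ^ k)" .
    qed
    also have "\<dots> = ennreal (suminf (\<lambda>k. (1 / 2) ^ k))"
      by (intro suminf_ennreal2) (simp_all add: summable_geometric)
    finally have "(\<integral>\<^sup>+x. suminf (\<lambda>k. ennreal (cmod (f (Suc k) x - f k x))) \<partial>torus_measure) \<noteq> \<infinity>"
      by (auto simp: top_unique)
    then have "AE x in torus_measure. suminf (\<lambda>k. ennreal (cmod (f (Suc k) x - f k x))) \<noteq> \<infinity>"
      by (intro nn_integral_PInf_AE tm) measurable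
    then show ?thesis
    proof eventually_elim
      case (elim x)
      then have "summable (\<lambda>k. cmod (f (Suc k) x - f k x))"
        by (intro summable_suminf_not_top) auto
      then have "summable (\<lambda>k. f (Suc k) x - f k x)" by (rule summable_norm_cancel)
      then have "convergent (\<lambda>n. \<Sum>k<n. f (Suc k) x - f k x)" by (simp add: summable_iff_convergent)
      then have "convergent (\<lambda>n. (f n x - f 0 x) + f 0 x)"
        by (intro convergent_add convergent_const) (simp add: sum_lessThan_telescope[of "\<lambda>k. f k x"])
      then show ?case by simp
    qed
  qed
  have lim: "AE x in torus_measure. (\<lambda>k. f k x) \<longlonglongrightarrow> g x"
    using conv by eventually_elim (simp add: g_def convergent_LIMSEQ_iff)
  have fatou: "(\<integral>\<^sup>+x. ennreal ((cmod (g x - f k x))\<^sup>2) \<partial>torus_measure) \<le> ennreal (((1 / 2) ^ k)\<^sup>2)" for k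
  proof -
    have "(\<integral>\<^sup>+x. ennreal ((cmod (g x - f k x))\<^sup>2) \<partial>torus_measure)
        = (\<integral>\<^sup>+x. liminf (\<lambda>j. ennreal ((cmod (f j x - f k x))\<^sup>2)) \<partial>torus_measure)"
    proof (rule nn_integral_cong_AE, use lim in eventually_elim)
      fix x assume "(\<lambda>j. f j x) \<longlonglongrightarrow> g x"
      then have "(\<lambda>j. ennreal ((cmod (f j x - f k x))\<^sup>2)) \<longlonglongrightarrow> ennreal ((cmod (g x - f k x))\<^sup>2)"
        by (intro tendsto_intros)
      then show "ennreal ((cmod (g x - f k x))\<^sup>2) = liminf (\<lambda>j. ennreal ((cmod (f j x - f k x))\<^sup>2))"
        by (rule lim_imp_Liminf[OF sequentially_bot, symmetric])
    qed
    also have "\<dots> \<le> liminf (\<lambda>j. \<integral>\<^sup>+x. ennreal ((cmod (f j x - f k x))\<^sup>2) \<partial>torus_measure)"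
      by (intro nn_integral_liminf tm) measurable
    also have "\<dots> \<le> ennreal (((1 / 2) ^ k)\<^sup>2)"
    proof (rule Liminf_le)
      have "eventually (\<lambda>j. k \<le> j) sequentially" by (rule eventually_ge_at_top)
      then show "eventually (\<lambda>j. (\<integral>\<^sup>+x. ennreal ((cmod (f j x - f k x))\<^sup>2) \<partial>torus_measure) \<le> ennreal (((1 / 2) ^ k)\<^sup>2)) sequentially"
        by eventually_elim (auto simp: nn_integral_l2norm square_integrable_diff f intro!: ennreal_leI power_mono fast)
    qed simp
    finally show ?thesis .
  qed
  have gk: "integrable torus_measure (\<lambda>x. (cmod (g x - f k x))\<^sup>2)" "l2norm (\<lambda>x. g x - f k x) \<le> (1 / 2) ^ k" for k
    using l2norm_nn_integral[OF _ fatou] by simp_all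
  have per: "periodic (\<lambda>x. g x - f 0 x)"
    using \<open>periodic g\<close> f by (simp add: periodic_def square_integrable_def)
  have "square_integrable (\<lambda>x. g x - f 0 x)"
    unfolding square_integrable_def by (intro conjI gk(1) per) measurable
  then have "square_integrable (\<lambda>x. (g x - f 0 x) + f 0 x)" by (intro square_integrable_add f)
  then show ?thesis using gk(2) by (intro exI[of _ g]) simp
qed

lemma complete_L2: "complete (UNIV :: ('n::finite) L2 set)"
  unfolding complete_def
proof (intro allI impI)
  fix X :: "nat \<Rightarrow> 'n L2" assume "(\<forall>n. X n \<in> UNIV) \<and> Cauchy X"
  then have X: "Cauchy X" by simp
  have "\<exists>N. \<forall>m\<ge>N. \<forall>n\<ge>N. dist (X m) (X n) < (1 / 2) ^ k" for k
    using X unfolding Cauchy_def by simp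
  then obtain N where N: "\<And>k m n. N k \<le> m \<Longrightarrow> N k \<le> n \<Longrightarrow> dist (X m) (X n) < (1 / 2) ^ k" by metis
  \<comment> \<open>The partial sums dominate every N k, and the summand k makes r strictly
    increasing.\<close>
  define r where "r k = (\<Sum>i\<le>k. N i) + k" for k
  have r: "strict_mono r" by (rule strict_monoI_Suc) (simp add: r_def)
  have rN: "N k \<le> r k" for k
    unfolding r_def by (rule trans_le_add1, rule member_le_sum) auto
  have "\<exists>f. square_integrable f \<and> X (r k) = abs_L2 f" for k
  proof -
    obtain f where "square_integrable f" "X (r k) = abs_L2 f" by (rule L2_cases)
    then show ?thesis by (intro exI conjI)
  qed
  then obtain f where f: "\<And>k. square_integrable (f k)" "\<And>k. X (r k) = abs_L2 (f k)" by metis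
  have fast: "l2norm (\<lambda>x. f j x - f k x) \<le> (1 / 2) ^ k" if "k \<le> j" for j k
  proof -
    have "r k \<le> r j" using r that by (simp add: strict_mono_less_eq)
    then have "dist (X (r j)) (X (r k)) < (1 / 2) ^ k"
      by (rule N[OF order_trans[OF rN] rN])
    then show ?thesis using f by (simp add: dist_abs_L2)
  qed
  obtain g where g: "square_integrable g" "\<And>k. l2norm (\<lambda>x. g x - f k x) \<le> (1 / 2) ^ k"
    using L2_fast_cauchy_limit[OF f(1) fast] by auto
  have "(\<lambda>k. dist ((X \<circ> r) k) (abs_L2 g)) \<longlonglongrightarrow> 0"
  proof (rule Lim_null_comparison)
    show "eventually (\<lambda>k. norm (dist ((X \<circ> r) k) (abs_L2 g)) \<le> (1 / 2) ^ k) sequentially"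
      using g f by (intro always_eventually allI) (simp add: dist_commute[of _ "abs_L2 g"] dist_abs_L2)
  qed (simp add: LIMSEQ_power_zero)
  then have "(X \<circ> r) \<longlonglongrightarrow> abs_L2 g" by (rule iffD2[OF tendsto_dist_iff])
  then have "X \<longlonglongrightarrow> abs_L2 g" by (rule Cauchy_converges_subseq[OF X r])
  then show "\<exists>l\<in>UNIV. X \<longlonglongrightarrow> l" by blast
qed

section \<open>Uniqueness of Fourier coefficients\<close>

text \<open>The span of the exponentials, an algebra on which vanishing of all coefficients gives
  orthogonality by induction.\<close>

inductive_set trigonometric :: "(real ^ 'n \<Rightarrow> complex) set" where
  trigonometric_basis: "fourier_basis a \<in> trigonometric"
| trigonometric_add: "f \<in> trigonometric \<Longrightarrow> g \<in> trigonometric \<Longrightarrow> (\<lambda>x. f x + g x) \<in> trigonometric"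
| trigonometric_scale: "f \<in> trigonometric \<Longrightarrow> (\<lambda>x. c * f x) \<in> trigonometric"

lemma trigonometric_const: "(\<lambda>x. c) \<in> trigonometric"
  using trigonometric_scale[OF trigonometric_basis[of 0], of c] by simp

lemma trigonometric_sum: "(\<And>i. i \<in> I \<Longrightarrow> f i \<in> trigonometric) \<Longrightarrow> (\<lambda>x. \<Sum>i\<in>I. f i x) \<in> trigonometric"
  by (induction I rule: infinite_finite_induct) (auto intro: trigonometric_const trigonometric_add)

lemma trigonometric_mult:
  assumes "f \<in> trigonometric" "g \<in> trigonometric"
  shows "(\<lambda>x. f x * g x) \<in> trigonometric"
  using assms(1)
proof induction
  case (trigonometric_basis a)
  show ?case using assms(2)
  proof induction
    case (trigonometric_basis b)
    show ?case unfolding fourier_basis_add[symmetric] by (rule trigonometric.trigonometric_basis)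
  next
    case (trigonometric_add f g)
    then show ?case unfolding distrib_left by (intro trigonometric.trigonometric_add)
  next
    case (trigonometric_scale f c)
    then show ?case using trigonometric.trigonometric_scale[of _ c] by (simp add: mult.left_commute)
  qed
next
  case (trigonometric_add f g)
  then show ?case unfolding distrib_right by (intro trigonometric.trigonometric_add)
next
  case (trigonometric_scale f c)
  then show ?case using trigonometric.trigonometric_scale[of _ c] by (simp add: mult.assoc)
qed

text \<open>Realizes the torus as a compact set in complex n-space, where the Stone-Weierstrass
  theorem for polynomials applies.\<close>

definition torus_embedding :: "real ^ 'n \<Rightarrow> complex ^ 'n" where
  "torus_embedding x = (\<chi> i. cis (2 * pi * x $ i))"

lemma torus_embedding_eq_fourier_basis: "torus_embedding x $ i = fourier_basis (axis i (- 1)) x"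
proof -
  have "(\<Sum>j\<in>UNIV. of_int (axis i (- 1) $ j) * x $ j) = (\<Sum>j\<in>UNIV. if j = i then - x $ j else 0)"
    by (intro sum.cong) (auto simp: axis_def)
  then show ?thesis by (simp add: torus_embedding_def fourier_basis_def cis_conv_exp mult_ac)
qed

text \<open>On the embedded torus each coordinate and its conjugate are exponentials, so real linear
  forms, and with them real polynomials, pull back to trigonometric polynomials.\<close>

lemma trigonometric_real_polynomial_function:
  assumes "real_polynomial_function (p :: complex ^ 'n \<Rightarrow> real)"
  shows "(\<lambda>x. of_real (p (torus_embedding x))) \<in> trigonometric"
  using assms
proof induction
  case (linear f)
  have lin: "linear f" by (rule bounded_linear.linear[OF linear])
  have fv: "f v = (\<Sum>b\<in>Basis. f b * (v \<bullet> b))" for v :: "complex ^ 'n"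
  proof -
    have "f v = f (\<Sum>b\<in>Basis. (v \<bullet> b) *\<^sub>R b)" by (simp only: euclidean_representation)
    then show ?thesis by (simp add: linear_sum[OF lin] linear_scale[OF lin] mult.commute)
  qed
  have "complex_of_real (f (torus_embedding x)) = (\<Sum>b\<in>Basis. of_real (f b) * of_real (torus_embedding x \<bullet> b))" for x
    by (subst fv) (simp only: of_real_sum of_real_mult)
  moreover have "(\<lambda>x. of_real (torus_embedding x \<bullet> b)) \<in> trigonometric" if "b \<in> Basis" for b :: "complex ^ 'n"
  proof -
    obtain i c where b: "b = axis i c" "c \<in> Basis" using \<open>b \<in> Basis\<close> by (auto simp: Basis_vec_def)
    have "of_real (torus_embedding x \<bullet> b) = (if c = 1 then 1 / 2 else - \<i> / 2) * torus_embedding x $ i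
        + (if c = 1 then 1 / 2 else \<i> / 2) * cnj (torus_embedding x $ i)" for x
      using b(2) by (auto simp: b inner_axis Basis_complex_def complex_eq_iff inner_complex_def)
    moreover have "(\<lambda>x. (if c = 1 then 1 / 2 else - \<i> / 2) * torus_embedding x $ i
        + (if c = 1 then 1 / 2 else \<i> / 2) * cnj (torus_embedding x $ i)) \<in> trigonometric"
      unfolding torus_embedding_eq_fourier_basis cnj_fourier_basis by (intro trigonometric_add trigonometric_scale trigonometric_basis)
    ultimately show ?thesis by simp
  qed
  ultimately show ?case by (auto intro!: trigonometric_sum trigonometric_scale)
next
  case (const c)
  show ?case by (rule trigonometric_const)
next
  case (add f g)
  then show ?case unfolding of_real_add by (intro trigonometric_add)
next
  case (mult f g)
  then show ?case unfolding of_real_mult by (intro trigonometric_mult)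
qed

lemma continuous_on_torus_embedding: "continuous_on S torus_embedding"
  unfolding torus_embedding_def by (intro continuous_intros)

text \<open>Points with equal image differ by integers in each coordinate; inside the unit cube a
  differing coordinate must be 0 at one point and 1 at the other.\<close>

lemma torus_embedding_eqD:
  assumes "torus_embedding x = torus_embedding y" "x \<in> cbox 0 1" "y \<in> cbox 0 1" "x \<noteq> y"
  shows "x \<notin> box 0 1" "y \<notin> box 0 1"
proof -
  obtain i where i: "x $ i \<noteq> y $ i" using assms(4) by (auto simp: vec_eq_iff)
  have b: "0 \<le> x $ i" "x $ i \<le> 1" "0 \<le> y $ i" "y $ i \<le> 1"
    using assms(2,3) by (auto simp: mem_box_cart)
  have "cis (2 * pi * x $ i) = cis (2 * pi * y $ i)"
    using assms(1) by (simp add: torus_embedding_def vec_eq_iff)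
  then obtain n :: int where "\<i> * of_real (2 * pi * x $ i) = \<i> * of_real (2 * pi * y $ i) + complex_of_real (real_of_int (2 * n) * pi) * \<i>"
    unfolding cis_conv_exp exp_eq by blast
  then have "2 * pi * x $ i = 2 * pi * y $ i + 2 * pi * n"
    by (simp add: complex_eq_iff mult_ac)
  then have n: "x $ i = y $ i + n" by (simp add: distrib_left[symmetric])
  then have "n \<noteq> 0" "\<bar>real_of_int n\<bar> \<le> 1" using i b by auto
  then have "n = 1 \<or> n = - 1" by linarith
  then have "x $ i \<in> {0, 1}" "y $ i \<in> {0, 1}" using n b by auto
  then show "x \<notin> box 0 1" "y \<notin> box 0 1"
    by (auto simp: mem_box_cart intro!: exI[of _ i])
qed

lemma compact_torus_embedding_image: "compact (torus_embedding ` cbox 0 (1 :: real ^ 'n))"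
  by (intro compact_continuous_image continuous_on_torus_embedding compact_cbox)

text \<open>
  The quotient map from the cube to the torus is closed, so that continuous functions on the cube
  which vanish on its boundary descend to continuous functions on the torus.
\<close>

lemma factor_through_torus_embedding:
  fixes \<phi> :: "real ^ 'n \<Rightarrow> real"
  assumes cont: "continuous_on (cbox 0 1) \<phi>" and zero: "\<And>x. x \<notin> box 0 1 \<Longrightarrow> \<phi> x = 0"
  obtains h where "continuous_on (torus_embedding ` cbox 0 1) h" "\<And>x. x \<in> cbox 0 1 \<Longrightarrow> h (torus_embedding x) = \<phi> x"
proof -
  define s where "s z = (SOME x. x \<in> cbox 0 1 \<and> torus_embedding x = z)" for z :: "complex ^ 'n"
  have s: "s (torus_embedding x) \<in> cbox 0 1 \<and> torus_embedding (s (torus_embedding x)) = torus_embedding x" if "x \<in> cbox 0 1" for x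
    unfolding s_def by (rule someI[of _ x]) (use that in simp)
  have h: "\<phi> (s (torus_embedding x)) = \<phi> x" if "x \<in> cbox 0 1" for x
    using torus_embedding_eqD[of "s (torus_embedding x)" x] s[OF that] that zero by (cases "s (torus_embedding x) = x") auto
  have "continuous_on (torus_embedding ` cbox 0 1) (\<lambda>z. \<phi> (s z))"
    unfolding continuous_on_closed_vimage[OF compact_imp_closed[OF compact_torus_embedding_image]]
  proof (intro allI impI)
    fix C :: "real set" assume "closed C"
    then have "closed (\<phi> -` C \<inter> cbox 0 1)"
      using cont continuous_on_closed_vimage[OF closed_cbox] by blast
    then have "compact (cbox 0 1 \<inter> (\<phi> -` C \<inter> cbox 0 1))"
      by (intro compact_Int_closed compact_cbox)
    then have "compact (torus_embedding ` (cbox 0 1 \<inter> (\<phi> -` C \<inter> cbox 0 1)))"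
      by (intro compact_continuous_image continuous_on_torus_embedding)
    moreover have "(\<lambda>z. \<phi> (s z)) -` C \<inter> torus_embedding ` cbox 0 1 = torus_embedding ` (cbox 0 1 \<inter> (\<phi> -` C \<inter> cbox 0 1))"
      using h by auto
    ultimately show "closed ((\<lambda>z. \<phi> (s z)) -` C \<inter> torus_embedding ` cbox 0 1)"
      by (simp add: compact_imp_closed)
  qed
  then show thesis using h by (intro that[of "\<lambda>z. \<phi> (s z)"]) auto
qed

section \<open>A function orthogonal to all exponentials vanishes almost everywhere\<close>

context
  fixes f :: "real ^ 'n \<Rightarrow> complex"
  assumes f: "square_integrable f" and f0: "\<And>a. fcoeff f a = 0"
begin

lemma orth_trigonometric:
  assumes "g \<in> trigonometric"
  shows "integrable torus_measure (\<lambda>x. f x * g x) \<and> (LINT x|torus_measure. f x * g x) = 0"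
  using assms
proof induction
  case (trigonometric_basis a)
  show ?case using f0[of a] integrable_mult_fourier_basis[OF f] by (simp add: fcoeff_def)
next
  case (trigonometric_add g h)
  then show ?case by (simp add: distrib_left)
next
  case (trigonometric_scale g c)
  then show ?case by (simp add: mult.left_commute[of _ c])
qed

lemma f_measurable [measurable]: "f \<in> borel_measurable borel" "f \<in> borel_measurable torus_measure"
  using f by (auto simp: square_integrable_def intro: measurable_torus_measure)

lemma integrable_mult_bounded:
  assumes [measurable]: "\<phi> \<in> borel_measurable torus_measure" and le: "\<And>x. x \<in> cbox 0 1 \<Longrightarrow> \<bar>\<phi> x\<bar> \<le> B"
  shows "integrable torus_measure (\<lambda>x. f x * of_real (\<phi> x))"
proof (rule Bochner_Integration.integrable_bound)
  show "integrable torus_measure (\<lambda>x. of_real B * f x)"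
    using square_integrable_imp_integrable[OF f] by simp
  show "AE x in torus_measure. norm (f x * of_real (\<phi> x)) \<le> norm (of_real B * f x)"
  proof (rule AE_I2)
    fix x :: "real ^ 'n" assume "x \<in> space torus_measure"
    then have "\<bar>\<phi> x\<bar> \<le> B" using le by simp
    then have "\<bar>\<phi> x\<bar> \<le> \<bar>B\<bar>" by linarith
    then show "norm (f x * of_real (\<phi> x)) \<le> norm (of_real B * f x)"
      by (simp add: norm_mult mult.commute mult_right_mono)
  qed
qed measurable

text \<open>The test function descends to the embedded torus and is uniformly approximated there by
  polynomials; an approximation within e costs at most e times the L^1 norm of f.\<close>

lemma orth_continuous:
  fixes \<phi> :: "real ^ 'n \<Rightarrow> real"
  assumes cont: "continuous_on UNIV \<phi>" and zero: "\<And>x. x \<notin> box 0 1 \<Longrightarrow> \<phi> x = 0"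
  shows "(LINT x|torus_measure. f x * of_real (\<phi> x)) = 0"
proof -
  obtain h where h: "continuous_on (torus_embedding ` cbox 0 1) h" "\<And>x. x \<in> cbox 0 1 \<Longrightarrow> h (torus_embedding x) = \<phi> x"
    using factor_through_torus_embedding[OF continuous_on_subset[OF cont] zero] by auto
  define J where "J = (LINT x|torus_measure. cmod (f x))"
  have [measurable]: "\<phi> \<in> borel_measurable torus_measure"
    using cont by (intro measurable_torus_measure borel_measurable_continuous_onI)
  have le: "cmod (LINT x|torus_measure. f x * of_real (\<phi> x)) \<le> e * J" if e: "0 < e" for e
  proof -
    obtain p where p: "polynomial_function p" "\<And>z. z \<in> torus_embedding ` cbox 0 1 \<Longrightarrow> norm (h z - p z) < e"
      using Stone_Weierstrass_polynomial_function[OF compact_torus_embedding_image h(1) e] by blast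
    then have "real_polynomial_function p"
      using real_polynomial_function_eq by (simp add: real_polynomial_function_eq)
    then have trig: "(\<lambda>x. of_real (p (torus_embedding x))) \<in> trigonometric" by (rule trigonometric_real_polynomial_function)
    have ip: "integrable torus_measure (\<lambda>x. f x * of_real (p (torus_embedding x)))"
      and p0: "(LINT x|torus_measure. f x * of_real (p (torus_embedding x))) = 0"
      using orth_trigonometric[OF trig] by auto
    have pe: "\<bar>\<phi> x - p (torus_embedding x)\<bar> \<le> e" if "x \<in> cbox 0 1" for x
      using p(2)[of "torus_embedding x"] h(2)[OF that] that by auto
    have "bounded (\<phi> ` cbox 0 1)"
      using cont by (intro compact_imp_bounded compact_continuous_image compact_cbox) (auto intro: continuous_on_subset)
    then obtain B where B: "\<And>x. x \<in> cbox 0 1 \<Longrightarrow> \<bar>\<phi> x\<bar> \<le> B"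
      unfolding bounded_iff by auto
    have i\<phi>: "integrable torus_measure (\<lambda>x. f x * of_real (\<phi> x))"
      by (rule integrable_mult_bounded[OF _ B]) measurable
    have "(LINT x|torus_measure. f x * of_real (\<phi> x)) = (LINT x|torus_measure. f x * of_real (\<phi> x) - f x * of_real (p (torus_embedding x)))"
      using i\<phi> ip p0 by simp
    also have "cmod \<dots> \<le> (LINT x|torus_measure. cmod (f x * of_real (\<phi> x) - f x * of_real (p (torus_embedding x))))"
      by (rule integral_norm_bound)
    also have "\<dots> \<le> (LINT x|torus_measure. e * cmod (f x))"
    proof (rule integral_mono)
      show "integrable torus_measure (\<lambda>x. e * cmod (f x))"
        using square_integrable_imp_integrable[OF f] by auto
      show "integrable torus_measure (\<lambda>x. cmod (f x * of_real (\<phi> x) - f x * of_real (p (torus_embedding x))))"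
        using i\<phi> ip by auto
      fix x :: "real ^ 'n" assume "x \<in> space torus_measure"
      then have "\<bar>\<phi> x - p (torus_embedding x)\<bar> * cmod (f x) \<le> e * cmod (f x)"
        using pe by (intro mult_right_mono) auto
      moreover have "f x * of_real (\<phi> x) - f x * of_real (p (torus_embedding x)) = of_real (\<phi> x - p (torus_embedding x)) * f x"
        by (simp add: algebra_simps)
      ultimately show "cmod (f x * of_real (\<phi> x) - f x * of_real (p (torus_embedding x))) \<le> e * cmod (f x)"
        by (simp only: norm_mult norm_of_real)
    qed
    also have "\<dots> = e * J" by (simp add: J_def)
    finally show ?thesis .
  qed
  have "cmod (LINT x|torus_measure. f x * of_real (\<phi> x)) \<le> 0"
  proof (rule field_le_epsilon)
    fix d :: real assume d: "0 < d"
    have J: "0 \<le> J" by (simp add: J_def)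
    have "cmod (LINT x|torus_measure. f x * of_real (\<phi> x)) \<le> d / (J + 1) * J"
      using d J by (intro le) simp
    also have "\<dots> \<le> d" using d J by (simp add: field_simps)
    finally show "cmod (LINT x|torus_measure. f x * of_real (\<phi> x)) \<le> 0 + d" by simp
  qed
  then show ?thesis by simp
qed

text \<open>Truncated multiples of the distance to the complement of V are continuous, vanish off V
  and tend to its indicator; dominated convergence applies with bound |f|.\<close>

lemma orth_open:
  assumes V: "open V" "V \<subseteq> box 0 (1 :: real ^ 'n)"
  shows "(LINT x|torus_measure. f x * of_real (indicator V x)) = 0"
proof -
  \<comment> \<open>The distance to the empty set is 0 by convention, which would spoil the
    approximation.\<close>
  have "V \<noteq> UNIV"
    using V(2) bounded_subset[OF bounded_box] not_bounded_UNIV by metis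
  then have ne: "- V \<noteq> {}" "closed (- V)" using V by auto
  define \<phi> where "\<phi> k x = min 1 (real k * infdist x (- V))" for k x
  have \<phi>cont: "continuous_on UNIV (\<phi> k)" for k
    unfolding \<phi>_def by (intro continuous_intros)
  have \<phi>zero: "\<phi> k x = 0" if "x \<notin> box 0 1" for k x
  proof -
    have "x \<in> - V" using V that by auto
    then show ?thesis by (simp add: \<phi>_def infdist_zero)
  qed
  have [measurable]: "\<phi> k \<in> borel_measurable torus_measure" for k
    by (intro measurable_torus_measure borel_measurable_continuous_onI \<phi>cont)
  have [measurable]: "V \<in> sets borel" using V by simp
  have "(\<lambda>k. LINT x|torus_measure. f x * of_real (\<phi> k x)) \<longlonglongrightarrow> (LINT x|torus_measure. f x * of_real (indicator V x))"
  proof (rule integral_dominated_convergence)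
    show "integrable torus_measure (\<lambda>x. cmod (f x))"
      using square_integrable_imp_integrable[OF f] by auto
    show "(\<lambda>x. f x * of_real (indicator V x)) \<in> borel_measurable torus_measure"
      by (rule measurable_torus_measure) measurable
    show "AE x in torus_measure. (\<lambda>k. f x * of_real (\<phi> k x)) \<longlonglongrightarrow> f x * of_real (indicator V x)"
    proof (intro AE_I2 tendsto_intros)
      fix x :: "real ^ 'n"
      show "(\<lambda>k. \<phi> k x) \<longlonglongrightarrow> indicator V x"
      proof (cases "x \<in> V")
        case True
        then have pos: "0 < infdist x (- V)"
          using ne infdist_pos_not_in_closed[of "- V" x] by auto
        then obtain K where K: "1 < real K * infdist x (- V)" using reals_Archimedean3 by blast
        have "\<phi> k x = 1" if "K \<le> k" for k
        proof -
          have "real K * infdist x (- V) \<le> real k * infdist x (- V)"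
            using that pos by (intro mult_right_mono) auto
          then show ?thesis using K by (simp add: \<phi>_def)
        qed
        then have "eventually (\<lambda>k. \<phi> k x = 1) sequentially"
          unfolding eventually_sequentially by blast
        then show ?thesis using True by (simp add: tendsto_eventually)
      qed (simp add: \<phi>_def)
    qed
    show "AE x in torus_measure. norm (f x * of_real (\<phi> k x)) \<le> cmod (f x)" for k
      by (intro AE_I2) (simp add: \<phi>_def norm_mult infdist_nonneg mult_left_le)
  qed measurable
  then show ?thesis using orth_continuous[OF \<phi>cont \<phi>zero] by (simp add: LIMSEQ_const_iff)
qed

text \<open>Dynkin's argument starting from open sets. Everything is intersected with the open cube
  because only test functions vanishing off it are covered so far.\<close>

lemma orth_borel:
  assumes "A \<in> sets (borel :: (real ^ 'n) measure)"
  shows "(LINT x|torus_measure. f x * of_real (indicator (A \<inter> box 0 1) x)) = 0"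
proof -
  have sets: "A \<in> sets borel \<Longrightarrow> A \<inter> box 0 1 \<in> sets (torus_measure :: (real ^ 'n) measure)" for A
    by (auto simp: sets_torus_measure sets_restrict_space intro!: image_eqI[of _ _ "A \<inter> box 0 1"] dest: box_subset_cbox[THEN subsetD])
  have int: "integrable torus_measure (\<lambda>x. f x * of_real (indicator (A \<inter> box 0 1) x))" if "A \<in> sets borel" for A
    by (intro integrable_mult_bounded[of _ 1] borel_measurable_indicator sets that) (simp add: indicator_def)
  have open_box: "(LINT x|torus_measure. f x * of_real (indicator (box 0 1) x)) = 0"
    by (rule orth_open) auto
  have stable: "Int_stable {S :: (real ^ 'n) set. open S}" by (auto simp: Int_stable_def)
  have sub: "{S :: (real ^ 'n) set. open S} \<subseteq> Pow UNIV" by simp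
  have "A \<in> sigma_sets UNIV {S. open S}"
    using assms by (simp add: borel_def)
  with stable sub show ?thesis
  proof (induction rule: sigma_sets_induct_disjoint)
    case (basic A)
    then show ?case by (intro orth_open) auto
  next
    case (compl A)
    then have A: "A \<in> sets borel" by (simp add: borel_def)
    have "f x * of_real (indicator ((UNIV - A) \<inter> box 0 1) x)
       = f x * of_real (indicator (UNIV \<inter> box 0 1) x) - f x * of_real (indicator (A \<inter> box 0 1) x)" for x
      by (auto simp: indicator_def)
    then show ?case
      using int[OF A] int[of UNIV] compl open_box by simp
  next
    case (union A)
    then have A: "A i \<in> sets borel" for i by (auto simp: borel_def)
    have disj: "disjoint_family (\<lambda>i. A i \<inter> box 0 1)" using union(1) by (auto simp: disjoint_family_on_def)
    have fi: "integrable torus_measure f" by (rule square_integrable_imp_integrable[OF f])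
    have eq: "(LINT x:B|torus_measure. f x) = (LINT x|torus_measure. f x * of_real (indicator B x))" for B
      by (simp add: set_lebesgue_integral_def scaleR_conv_of_real mult.commute)
    have "(LINT x:(\<Union>i. A i \<inter> box 0 1)|torus_measure. f x) = suminf (\<lambda>i. LINT x:(A i \<inter> box 0 1)|torus_measure. f x)"
    proof (rule lebesgue_integral_countable_add)
      show "A i \<inter> box 0 1 \<in> sets torus_measure" for i by (rule sets[OF A])
      show "i \<noteq> j \<Longrightarrow> (A i \<inter> box 0 1) \<inter> (A j \<inter> box 0 1) = {}" for i j
        using disj by (auto simp: disjoint_family_on_def)
      show "set_integrable torus_measure (\<Union>i. A i \<inter> box 0 1) f"
        unfolding set_integrable_def using sets[OF A] fi by (intro integrable_mult_indicator sets.countable_UN) auto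
    qed
    then have "(LINT x:((\<Union>i. A i) \<inter> box 0 1)|torus_measure. f x) = 0"
      using union(3) by (simp add: eq Int_UN_distrib2 del: Int_UN_distrib)
    then show ?case by (simp only: eq)
  qed simp
qed

lemma AE_box: "AE x in torus_measure. x \<in> box 0 (1 :: real ^ 'n)"
proof (rule AE_I[of _ _ "cbox 0 1 - box 0 1"])
  have s: "cbox 0 1 - box 0 (1 :: real ^ 'n) \<in> sets borel" by auto
  have "emeasure torus_measure (cbox 0 1 - box 0 (1 :: real ^ 'n)) = emeasure lborel (cbox 0 1 - box 0 (1 :: real ^ 'n))"
    unfolding torus_measure_def by (rule emeasure_restrict_space) auto
  also have "\<dots> = emeasure lborel (cbox 0 (1 :: real ^ 'n)) - emeasure lborel (box 0 (1 :: real ^ 'n))"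
    by (rule emeasure_Diff) (auto simp: emeasure_lborel_box_eq box_subset_cbox)
  also have "\<dots> = 0" by (simp add: emeasure_lborel_box_eq emeasure_lborel_cbox_eq)
  finally show "emeasure torus_measure (cbox 0 1 - box 0 (1 :: real ^ 'n)) = 0" .
  show "cbox 0 1 - box 0 (1 :: real ^ 'n) \<in> sets torus_measure"
    using s by (auto simp: sets_torus_measure sets_restrict_space)
qed auto

text \<open>Testing against the Borel set where l (f x) > 0 gives a nonnegative integrand with
  integral 0. Plus and minus the real and imaginary parts as l together force f = 0.\<close>

lemma AE_linear_part_nonpos:
  fixes l :: "complex \<Rightarrow> real"
  assumes l: "bounded_linear l"
  shows "AE x in torus_measure. l (f x) \<le> 0"
proof -
  define A where "A = {x. 0 < l (f x)}"
  have [measurable]: "l \<in> borel_measurable borel"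
    using l by (intro borel_measurable_continuous_onI linear_continuous_on)
  have [measurable]: "A \<in> sets borel" unfolding A_def by measurable
  have i: "integrable torus_measure (\<lambda>x. f x * of_real (indicator (A \<inter> box 0 1) x))"
    by (intro integrable_mult_bounded[of _ 1] measurable_torus_measure) (auto simp: indicator_def)
  have eq: "l (f x * of_real (indicator (A \<inter> box 0 1) x)) = l (f x) * indicator (A \<inter> box 0 1) x" for x
    using linear_scale[OF bounded_linear.linear[OF l], of "indicator (A \<inter> box 0 1) x" "f x"]
    by (simp add: scaleR_conv_of_real mult.commute)
  have "(LINT x|torus_measure. l (f x) * indicator (A \<inter> box 0 1) x) = 0"
    using integral_bounded_linear[OF l i] orth_borel[of A] bounded_linear.linear[OF l]
    by (simp add: eq linear_0)
  moreover have "integrable torus_measure (\<lambda>x. l (f x) * indicator (A \<inter> box 0 1) x)"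
    using integrable_bounded_linear[OF l i] by (simp add: eq)
  ultimately have "AE x in torus_measure. l (f x) * indicator (A \<inter> box 0 1) x = 0"
    by (subst (asm) integral_nonneg_eq_0_iff_AE) (auto simp: A_def indicator_def)
  then show ?thesis using AE_box
    by eventually_elim (auto simp: A_def indicator_def split: if_splits)
qed

lemma AE_zero: "AE x in torus_measure. f x = 0"
proof -
  have "bounded_linear (\<lambda>z. - Re z)" "bounded_linear (\<lambda>z. - Im z)"
    by (simp_all add: bounded_linear_minus bounded_linear_Re bounded_linear_Im)
  note AE_linear_part_nonpos[OF this(1)] AE_linear_part_nonpos[OF this(2)]
    AE_linear_part_nonpos[OF bounded_linear_Re] AE_linear_part_nonpos[OF bounded_linear_Im]
  then show ?thesis
    by eventually_elim (simp add: complex_eq_iff)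
qed

end

lemma L2_eqI:
  fixes F G :: "('n::finite) L2"
  assumes "\<And>a. fourier_coeff F a = fourier_coeff G a"
  shows "F = G"
proof -
  obtain f where f: "square_integrable f" "F = abs_L2 f" by (rule L2_cases)
  obtain g where g: "square_integrable g" "G = abs_L2 g" by (rule L2_cases)
  have "AE x in torus_measure. f x - g x = 0"
    using f g assms by (intro AE_zero square_integrable_diff) (simp_all add: fcoeff_diff fourier_coeff_abs_L2)
  then show ?thesis using f g by (simp add: abs_L2_eq_iff)
qed


section \<open>Compactness of the Sobolev ball\<close>

definition fourier_psum :: "('n::finite) L2 \<Rightarrow> (int ^ 'n) set \<Rightarrow> 'n L2" where
  "fourier_psum F D = abs_L2 (trigpoly (fourier_coeff F) D)"

lemma fourier_coeff_trigpoly: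
  "finite D \<Longrightarrow> fourier_coeff (abs_L2 (trigpoly z D)) a = (if a \<in> D then z a else 0)"
  by (simp add: fourier_coeff_abs_L2 square_integrable_trigpoly fcoeff_trigpoly)

lemma dist_psum_fourier_psum:
  assumes "finite E" "D \<subseteq> E"
  shows "(dist (fourier_psum F E) (fourier_psum F D))\<^sup>2 = (\<Sum>a\<in>E - D. (cmod (fourier_coeff F a))\<^sup>2)"
  using assms by (simp add: fourier_psum_def dist_abs_L2 square_integrable_trigpoly trigpoly_diff l2norm_trigpoly)

lemma summable_fourier_coeff: "(\<lambda>a. (cmod (fourier_coeff F a))\<^sup>2) summable_on UNIV"
proof -
  obtain f where f: "square_integrable f" "F = abs_L2 f" by (rule L2_cases)
  show ?thesis
    using bessel[OF f(1)]
    by (intro nonneg_bdd_above_summable_on bdd_aboveI[of _ "(l2norm f)\<^sup>2"]) (auto simp: f fourier_coeff_abs_L2)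
qed

lemma freqs_mono: "\<rho> \<le> \<rho>' \<Longrightarrow> freqs \<rho> \<subseteq> freqs \<rho>'"
  by (auto simp: freqs_def)

lemma finite_subset_freqs:
  assumes "finite D"
  shows "\<exists>\<rho>. D \<subseteq> freqs \<rho>"
proof -
  have "\<forall>a\<in>D. freq_degree a \<le> (\<Sum>a\<in>D. freq_degree a)"
    using assms by (intro ballI member_le_sum) auto
  then show ?thesis by (auto simp: freqs_def intro!: exI[of _ "\<Sum>a\<in>D. freq_degree a"])
qed

text \<open>Square-summability of the coefficients makes the partial sums Cauchy. Their limit has
  the coefficients of F by continuity, and uniqueness identifies it with F.\<close>

lemma fourier_psum_tendsto: "(\<lambda>k. fourier_psum F (freqs k)) \<longlonglongrightarrow> F"
proof -
  let ?c = "\<lambda>a. (cmod (fourier_coeff F a))\<^sup>2"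
  have "Cauchy (\<lambda>k. fourier_psum F (freqs k))"
    unfolding Cauchy_altdef2
  proof (intro allI impI)
    fix e :: real assume e: "0 < e"
    have s: "sum ?c X \<le> infsum ?c UNIV" if "finite X" for X
      by (rule finite_sum_le_infsum[OF summable_fourier_coeff that]) auto
    obtain X where X: "finite X" "dist (sum ?c X) (infsum ?c UNIV) \<le> e\<^sup>2 / 2"
      using infsum_finite_approximation[OF summable_fourier_coeff, of "e\<^sup>2 / 2"] e by auto
    obtain K where K: "X \<subseteq> freqs K" using finite_subset_freqs[OF X(1)] by blast
    have "dist (fourier_psum F (freqs k)) (fourier_psum F (freqs K)) < e" if "K \<le> k" for k
    proof -
      have sub: "freqs K \<subseteq> (freqs k :: (int ^ 'a) set)" using that by (rule freqs_mono)
      have "(dist (fourier_psum F (freqs k)) (fourier_psum F (freqs K)))\<^sup>2 = sum ?c (freqs k) - sum ?c (freqs K)"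
        by (simp add: dist_psum_fourier_psum sub sum_diff)
      also have "\<dots> \<le> infsum ?c UNIV - sum ?c X"
        using s[of "freqs k"] sum_mono2[OF _ K, of ?c] by simp
      also have "\<dots> < e\<^sup>2" using X(2) zero_less_power[OF e, of 2] unfolding dist_real_def by linarith
      finally show ?thesis using e by (simp add: power_less_imp_less_base)
    qed
    then show "\<exists>N. \<forall>n\<ge>N. dist (fourier_psum F (freqs n)) (fourier_psum F (freqs N)) < e" by blast
  qed
  then obtain G where G: "(\<lambda>k. fourier_psum F (freqs k)) \<longlonglongrightarrow> G"
    using complete_L2 by (auto simp: complete_def)
  have "fourier_coeff F a = fourier_coeff G a" for a
  proof (rule LIMSEQ_unique)
    show "(\<lambda>k. fourier_coeff (fourier_psum F (freqs k)) a) \<longlonglongrightarrow> fourier_coeff G a"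
      using continuous_on_fourier_coeff[of UNIV a] G
      by (auto simp: continuous_on_tendsto_compose[of UNIV "\<lambda>F. fourier_coeff F a"])
    obtain K where K: "{a} \<subseteq> freqs K" using finite_subset_freqs[of "{a}"] by blast
    have "fourier_coeff (fourier_psum F (freqs k)) a = fourier_coeff F a" if "K \<le> k" for k
      using subsetD[OF freqs_mono[OF that], of a] K by (auto simp: fourier_psum_def fourier_coeff_trigpoly)
    then have "eventually (\<lambda>k. fourier_coeff (fourier_psum F (freqs k)) a = fourier_coeff F a) sequentially"
      unfolding eventually_sequentially by blast
    then show "(\<lambda>k. fourier_coeff (fourier_psum F (freqs k)) a) \<longlonglongrightarrow> fourier_coeff F a"
      by (rule tendsto_eventually)
  qed
  then have "F = G" by (rule L2_eqI)
  with G show ?thesis by simp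
qed

lemma dist_fourier_psum_le:
  assumes B: "0 \<le> B" "\<And>k. \<rho> \<le> k \<Longrightarrow> (\<Sum>a\<in>freqs k - freqs \<rho>. (cmod (fourier_coeff F a))\<^sup>2) \<le> B\<^sup>2"
  shows "dist F (fourier_psum F (freqs \<rho>)) \<le> B"
proof (rule LIMSEQ_le_const2)
  show "(\<lambda>k. dist (fourier_psum F (freqs k)) (fourier_psum F (freqs \<rho>))) \<longlonglongrightarrow> dist F (fourier_psum F (freqs \<rho>))"
    by (intro tendsto_dist fourier_psum_tendsto tendsto_const)
  have "dist (fourier_psum F (freqs k)) (fourier_psum F (freqs \<rho>)) \<le> B" if "\<rho> \<le> k" for k
  proof (rule power2_le_imp_le[OF _ B(1)])
    show "(dist (fourier_psum F (freqs k)) (fourier_psum F (freqs \<rho>)))\<^sup>2 \<le> B\<^sup>2"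
      using B(2)[OF that] by (simp add: dist_psum_fourier_psum[OF finite_freqs freqs_mono[OF that]])
  qed
  then show "\<exists>N. \<forall>n\<ge>N. dist (fourier_psum F (freqs n)) (fourier_psum F (freqs \<rho>)) \<le> B" by blast
qed

lemma weight_nonneg: "0 \<le> weight m (a :: int ^ 'n)"
  using weight_ge_1[of m a] by linarith

text \<open>Growth of the weights, which is where m > 0 enters; linear growth suffices to make the
  tails uniformly small.\<close>

lemma weight_ge:
  assumes "a \<notin> freqs \<rho>" "0 < m"
  shows "real \<rho> \<le> weight m (a :: int ^ 'n)"
proof -
  obtain i where i: "int \<rho> < \<bar>a $ i\<bar>" using assms by (auto simp: freqs_def freq_degree_le_iff not_le)
  have "int \<rho> \<le> \<bar>a $ i\<bar> * \<bar>a $ i\<bar>"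
    using i mult_mono[of 1 "\<bar>a $ i\<bar>" "\<bar>a $ i\<bar>" "\<bar>a $ i\<bar>"] by linarith
  also have "\<dots> = (a $ i)\<^sup>2" by (simp add: power2_eq_square)
  also have "\<dots> \<le> (\<Sum>i\<in>UNIV. (a $ i)\<^sup>2)" by (intro member_le_sum) auto
  finally have "real \<rho> \<le> 1 + of_int (\<Sum>i\<in>UNIV. (a $ i)\<^sup>2)" by linarith
  also have "\<dots> = weight 1 a" by (simp add: weight_def)
  also have "\<dots> \<le> weight m a"
    using weight_ge_1[of 1 a] assms(2) unfolding weight_def by (intro power_increasing) auto
  finally show ?thesis .
qed

text \<open>Replaces the infinite sum by conditions on finitely many coefficients each. They are
  closed in L^2, and the k-th is nonnegativity of the constraint
  \<open>ball_poly m k\<close>.\<close>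

lemma sobolev_ball_iff:
  "F \<in> sobolev_ball m \<longleftrightarrow> hermitian_coeffs F \<and>
     (\<forall>k. (\<Sum>a\<in>freqs k. weight m a * (cmod (fourier_coeff F a))\<^sup>2) \<le> 1)"
proof -
  let ?c = "\<lambda>a. weight m a * (cmod (fourier_coeff F a))\<^sup>2"
  have nn: "0 \<le> ?c a" for a by (simp add: weight_nonneg)
  have "F \<in> sobolev_space m \<and> sobolev_norm m F \<le> 1 \<longleftrightarrow> (\<forall>k. sum ?c (freqs k) \<le> 1)"
  proof
    assume F: "F \<in> sobolev_space m \<and> sobolev_norm m F \<le> 1"
    then have "infsum ?c UNIV \<le> 1" by (simp add: sobolev_norm_def)
    moreover have "sum ?c (freqs k) \<le> infsum ?c UNIV" for k
      using F by (intro finite_sum_le_infsum) (auto simp: sobolev_space_def nn)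
    ultimately show "\<forall>k. sum ?c (freqs k) \<le> 1" using order_trans by blast
  next
    assume le: "\<forall>k. sum ?c (freqs k) \<le> 1"
    have le': "sum ?c X \<le> 1" if "finite X" for X
    proof -
      obtain K where "X \<subseteq> freqs K" using finite_subset_freqs \<open>finite X\<close> by blast
      then have "sum ?c X \<le> sum ?c (freqs K)" by (intro sum_mono2 nn) auto
      then show ?thesis using le order_trans by blast
    qed
    then have "?c summable_on UNIV"
      by (intro nonneg_bdd_above_summable_on bdd_aboveI[of _ 1] nn) auto
    moreover from this have "infsum ?c UNIV \<le> 1"
      by (rule infsum_le_finite_sums) (use le' in auto)
    ultimately show "F \<in> sobolev_space m \<and> sobolev_norm m F \<le> 1"
      by (simp add: sobolev_space_def sobolev_norm_def)
  qed
  then show ?thesis by (auto simp: sobolev_ball_def)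
qed

lemma closed_sobolev_ball: "closed (sobolev_ball m :: ('n::finite) L2 set)"
proof -
  have "sobolev_ball m = (\<Inter>a. {F :: 'n L2. cnj (fourier_coeff F a) = fourier_coeff F (- a)})
      \<inter> (\<Inter>k. {F. (\<Sum>a\<in>freqs k. weight m a * (cmod (fourier_coeff F a))\<^sup>2) \<le> 1})"
    by (auto simp: sobolev_ball_iff hermitian_coeffs_def)
  also have "closed \<dots>"
    by (intro closed_Int closed_INT ballI closed_Collect_eq closed_Collect_le continuous_intros continuous_on_fourier_coeff)
  finally show ?thesis .
qed

text \<open>Connects algebra and analysis: a polynomial that is nonnegative on the function ball is
  nonnegative at all these finite-dimensional points.\<close>

lemma sobolev_ball_trigpoly:
  assumes z: "ball_point m \<rho> z"
  obtains F where "F \<in> sobolev_ball m" "fourier_coeff F = z"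
proof -
  define F where "F = abs_L2 (trigpoly z (freqs \<rho>))"
  have Fz: "fourier_coeff F = z"
    using z by (auto simp: F_def fourier_coeff_trigpoly ball_point_def)
  have "(\<Sum>a\<in>freqs k. weight m a * (cmod (z a))\<^sup>2) \<le> 1" for k
  proof -
    have "(\<Sum>a\<in>freqs k. weight m a * (cmod (z a))\<^sup>2) = (\<Sum>a\<in>freqs k \<inter> freqs \<rho>. weight m a * (cmod (z a))\<^sup>2)"
      using z by (intro sum.mono_neutral_right) (auto simp: ball_point_def)
    also have "\<dots> \<le> (\<Sum>a\<in>freqs \<rho>. weight m a * (cmod (z a))\<^sup>2)"
      by (intro sum_mono2) (auto simp: weight_nonneg)
    also have "\<dots> \<le> 1" using z by (simp add: ball_point_def)
    finally show ?thesis .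
  qed
  then have "F \<in> sobolev_ball m"
    using z by (simp add: sobolev_ball_iff Fz hermitian_coeffs_def ball_point_def hermitian_point_def)
  then show thesis using Fz by (rule that)
qed

lemma dist_psum_fourier_psum':
  assumes "finite D"
  shows "(dist (fourier_psum F D) (fourier_psum G D))\<^sup>2 = (\<Sum>a\<in>D. (cmod (fourier_coeff F a - fourier_coeff G a))\<^sup>2)"
proof -
  have "trigpoly z D x - trigpoly z' D x = trigpoly (\<lambda>a. z a - z' a) D x" for z z' and x :: "real ^ 'a"
    by (simp add: trigpoly_def sum_subtractf left_diff_distrib)
  then show ?thesis
    using assms by (simp add: fourier_psum_def dist_abs_L2 square_integrable_trigpoly l2norm_trigpoly)
qed

lemma sobolev_ball_coeff_le_1:
  assumes "F \<in> sobolev_ball m"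
  shows "cmod (fourier_coeff F a) \<le> 1"
proof -
  obtain K where K: "a \<in> freqs K" using finite_subset_freqs[of "{a}"] by auto
  have "(cmod (fourier_coeff F a))\<^sup>2 \<le> weight m a * (cmod (fourier_coeff F a))\<^sup>2"
    using mult_right_mono[OF weight_ge_1[of m a], of "(cmod (fourier_coeff F a))\<^sup>2"] by simp
  also have "\<dots> \<le> (\<Sum>a\<in>freqs K. weight m a * (cmod (fourier_coeff F a))\<^sup>2)"
    using K by (intro member_le_sum) (auto simp: weight_nonneg)
  also have "\<dots> \<le> 1\<^sup>2" using assms by (simp add: sobolev_ball_iff)
  finally show ?thesis by (rule power2_le_imp_le) simp
qed

text \<open>High frequencies contribute uniformly little on the ball, as the weights tend to infinity.\<close>

lemma sobolev_ball_tail: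
  assumes F: "F \<in> sobolev_ball m" and m: "0 < m" and \<rho>: "0 < \<rho>"
  shows "dist F (fourier_psum F (freqs \<rho>)) \<le> 1 / sqrt \<rho>"
proof (rule dist_fourier_psum_le)
  fix k assume k: "\<rho> \<le> k"
  have "\<rho> * (\<Sum>a\<in>freqs k - freqs \<rho>. (cmod (fourier_coeff F a))\<^sup>2) \<le> (\<Sum>a\<in>freqs k - freqs \<rho>. weight m a * (cmod (fourier_coeff F a))\<^sup>2)"
    unfolding sum_distrib_left using weight_ge[OF _ m] by (intro sum_mono mult_right_mono) auto
  also have "\<dots> \<le> (\<Sum>a\<in>freqs k. weight m a * (cmod (fourier_coeff F a))\<^sup>2)"
    by (intro sum_mono2) (auto simp: weight_nonneg)
  also have "\<dots> \<le> 1" using F by (simp add: sobolev_ball_iff)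
  finally show "(\<Sum>a\<in>freqs k - freqs \<rho>. (cmod (fourier_coeff F a))\<^sup>2) \<le> (1 / sqrt \<rho>)\<^sup>2"
    using \<rho> by (simp add: power_divide field_simps)
qed simp

text \<open>Total boundedness: tails beyond \<rho> are uniformly small, and the finitely many
  remaining coefficients are bounded by 1 and sorted into cells of width \<delta>. One
  representative per occupied cell forms the net.\<close>

lemma compact_sobolev_ball:
  assumes m: "0 < m"
  shows "compact (sobolev_ball m :: ('n::finite) L2 set)"
  unfolding compact_eq_totally_bounded
proof (intro conjI allI impI)
  show "complete (sobolev_ball m :: 'n L2 set)"
    using complete_closed_subset[OF closed_sobolev_ball _ complete_L2] by simp
  fix \<epsilon> :: real assume \<epsilon>: "0 < \<epsilon>"
  obtain \<rho> :: nat where \<rho>: "0 < \<rho>" "1 / sqrt \<rho> < \<epsilon> / 3"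
  proof -
    obtain \<rho> :: nat where \<rho>: "(3 / \<epsilon>)\<^sup>2 < \<rho>" using reals_Archimedean2 by blast
    then have pos: "0 < real \<rho>" using zero_le_power2[of "3 / \<epsilon>"] by linarith
    have "3 / \<epsilon> < sqrt \<rho>" using \<rho> by (rule real_less_rsqrt)
    then have "1 / sqrt \<rho> < \<epsilon> / 3" using \<epsilon> pos by (simp add: field_simps)
    then show thesis using pos by (intro that) auto
  qed
  define D where "D = (freqs \<rho> :: (int ^ 'n) set)"
  have D: "finite D" by (simp add: D_def)
  \<comment> \<open>Coefficients in one cell differ by at most 2 \<delta>, so the partial sums
    differ by at most (1 + |D|) 2 \<delta> = \<epsilon>/3; the other two thirds are the
    tails.\<close>
  define \<delta> where "\<delta> = \<epsilon> / (6 * (1 + real (card D)))"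
  have \<delta>: "0 < \<delta>" using \<epsilon> by (simp add: \<delta>_def)
  define \<phi> where "\<phi> F = restrict (\<lambda>a. (\<lfloor>Re (fourier_coeff F a) / \<delta>\<rfloor>, \<lfloor>Im (fourier_coeff F a) / \<delta>\<rfloor>)) D" for F :: "'n L2"
  define S where "S = {\<lfloor>- 1 / \<delta>\<rfloor>..\<lfloor>1 / \<delta>\<rfloor>}"
  have S: "\<lfloor>t / \<delta>\<rfloor> \<in> S" if "\<bar>t\<bar> \<le> 1" for t
    unfolding S_def atLeastAtMost_iff using \<delta> that by (intro conjI floor_mono divide_right_mono) auto
  have "\<phi> ` sobolev_ball m \<subseteq> PiE D (\<lambda>_. S \<times> S)"
  proof (rule image_subsetI)
    fix F :: "'n L2" assume F: "F \<in> sobolev_ball m"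
    have "\<bar>Re (fourier_coeff F a)\<bar> \<le> 1" "\<bar>Im (fourier_coeff F a)\<bar> \<le> 1" for a
      using sobolev_ball_coeff_le_1[OF F, of a] abs_Re_le_cmod abs_Im_le_cmod order_trans by blast+
    then show "\<phi> F \<in> PiE D (\<lambda>_. S \<times> S)"
      by (auto simp: \<phi>_def S)
  qed
  then have fin: "finite (\<phi> ` sobolev_ball m)"
    by (rule finite_subset) (simp add: finite_PiE D S_def)
  define R where "R = inv_into (sobolev_ball m) \<phi> ` \<phi> ` sobolev_ball m"
  have "\<exists>G\<in>R. dist G F < \<epsilon>" if F: "F \<in> sobolev_ball m" for F
  proof -
    define G where "G = inv_into (sobolev_ball m) \<phi> (\<phi> F)"
    have G: "G \<in> sobolev_ball m" "\<phi> G = \<phi> F" "G \<in> R"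
      using F by (auto simp: G_def R_def inv_into_into f_inv_into_f)
    have fl: "\<bar>s - t\<bar> \<le> \<delta>" if "\<lfloor>s / \<delta>\<rfloor> = \<lfloor>t / \<delta>\<rfloor>" for s t
    proof -
      have "\<bar>s / \<delta> - t / \<delta>\<bar> \<le> 1"
        using that floor_correct[of "s / \<delta>"] floor_correct[of "t / \<delta>"] by linarith
      then have "\<bar>s - t\<bar> / \<delta> \<le> 1" using \<delta> by (simp add: diff_divide_distrib[symmetric] abs_divide)
      then show ?thesis using \<delta> by (simp add: field_simps)
    qed
    have c: "cmod (fourier_coeff G a - fourier_coeff F a) \<le> 2 * \<delta>" if "a \<in> D" for a
    proof -
      have "\<phi> G a = \<phi> F a" using G by simp
      then have "\<bar>Re (fourier_coeff G a - fourier_coeff F a)\<bar> \<le> \<delta>" "\<bar>Im (fourier_coeff G a - fourier_coeff F a)\<bar> \<le> \<delta>"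
        using that fl by (auto simp: \<phi>_def)
      then show ?thesis using cmod_le[of "fourier_coeff G a - fourier_coeff F a"] by linarith
    qed
    have "(dist (fourier_psum G D) (fourier_psum F D))\<^sup>2 \<le> (\<Sum>a\<in>D. (2 * \<delta>)\<^sup>2)"
      unfolding dist_psum_fourier_psum'[OF D] using c by (intro sum_mono power_mono) auto
    also have "\<dots> = card D * (2 * \<delta>)\<^sup>2" by simp
    also have "\<dots> \<le> (1 + real (card D))\<^sup>2 * (2 * \<delta>)\<^sup>2"
      by (intro mult_right_mono) (auto simp: power2_eq_square algebra_simps)
    also have "\<dots> = (\<epsilon> / 3)\<^sup>2"
    proof -
      have "(1 + real (card D)) * (2 * \<delta>) = \<epsilon> / 3"
      by (simp add: \<delta>_def add_nonneg_eq_0_iff divide_simps)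
      then show ?thesis by (simp only: power_mult_distrib[symmetric])
    qed
    finally have "dist (fourier_psum G D) (fourier_psum F D) \<le> \<epsilon> / 3"
      by (rule power2_le_imp_le) (use \<epsilon> in simp)
    moreover have "dist F (fourier_psum F D) < \<epsilon> / 3" "dist G (fourier_psum G D) < \<epsilon> / 3"
      using sobolev_ball_tail[OF F m \<rho>(1)] sobolev_ball_tail[OF G(1) m \<rho>(1)] \<rho>(2) by (auto simp: D_def)
    moreover have "dist G F \<le> dist G (fourier_psum G D) + dist (fourier_psum G D) (fourier_psum F D) + dist F (fourier_psum F D)"
      using dist_triangle[of G F "fourier_psum G D"] dist_triangle[of "fourier_psum G D" F "fourier_psum F D"] by (simp add: dist_commute)
    ultimately have "dist G F < \<epsilon>" by linarith
    then show ?thesis using G(3) by blast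
  qed
  then have cover: "(sobolev_ball m :: 'n L2 set) \<subseteq> (\<Union>x\<in>R. ball x \<epsilon>)" by auto
  have "finite R" unfolding R_def by (intro finite_imageI fin)
  then show "\<exists>k. finite k \<and> (sobolev_ball m :: 'n L2 set) \<subseteq> (\<Union>x\<in>k. ball x \<epsilon>)"
    using cover by blast
qed

section \<open>Moments of measures on the ball\<close>

definition monomial_at :: "(int ^ 'n) multiset \<Rightarrow> ('n::finite) L2 \<Rightarrow> complex" where
  "monomial_at \<alpha> F = (\<Prod>a\<in>#\<alpha>. fourier_coeff F a)"

definition moment_vector :: "((int ^ 'n) multiset) ^ 'N \<Rightarrow> ('n::finite) L2 \<Rightarrow> complex ^ 'N" where
  "moment_vector A F = (\<chi> j. monomial_at (A $ j) F)"

lemma continuous_on_monomial_at: "continuous_on S (monomial_at \<alpha>)"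
proof (induction \<alpha>)
  case (add a \<alpha>)
  have "monomial_at (add_mset a \<alpha>) = (\<lambda>F. fourier_coeff F a * monomial_at \<alpha> F)"
    by (simp add: monomial_at_def fun_eq_iff)
  then show ?case using add by (simp add: continuous_on_mult continuous_on_fourier_coeff)
qed (simp add: monomial_at_def[abs_def])

lemma continuous_on_moment_vector: "continuous_on S (moment_vector A)"
  unfolding moment_vector_def using continuous_on_monomial_at by (intro continuous_intros) (simp add: eta_contract_eq)

lemma monomial_at_le_1:
  assumes "F \<in> sobolev_ball m"
  shows "cmod (monomial_at \<alpha> F) \<le> 1"
  unfolding monomial_at_def using sobolev_ball_coeff_le_1[OF assms]
  by (induction \<alpha>) (simp_all add: norm_mult mult_le_one)

lemma sobolev_ball_borel [measurable, simp]: "sobolev_ball m \<in> sets borel"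
  by (rule borel_closed[OF closed_sobolev_ball])

lemma monomial_at_borel [measurable]: "monomial_at \<alpha> \<in> borel_measurable borel"
  by (intro borel_measurable_continuous_onI continuous_on_monomial_at)

lemma radon_measure_ball_finite:
  fixes \<mu> :: "('n::finite) L2 measure"
  assumes m: "0 < m" and \<mu>: "radon_measure \<mu>" "AE F in \<mu>. F \<in> sobolev_ball m"
  shows "finite_measure \<mu>"
proof
  have sets: "sets \<mu> = sets borel" using \<mu>(1) by (simp add: radon_measure_def)
  have sp: "space \<mu> = UNIV" using sets_eq_imp_space_eq[OF sets] by simp
  have "\<forall>F. \<exists>U. open U \<and> F \<in> U \<and> emeasure \<mu> U < \<infinity>"
    using \<mu>(1) by (simp add: radon_measure_def)
  then obtain U where U: "\<And>F. open (U F)" "\<And>F. F \<in> U F" "\<And>F. emeasure \<mu> (U F) < \<infinity>" by metis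
  have [simp]: "U F \<in> sets borel" for F by (rule borel_open[OF U(1)])
  obtain T where T: "T \<subseteq> (sobolev_ball m :: 'n L2 set)" "finite T" "sobolev_ball m \<subseteq> (\<Union>F\<in>T. U F)"
    using compactE_image[OF compact_sobolev_ball[OF m], of "sobolev_ball m" U] U(1,2)
    by (metis UN_I subsetI)
  have "emeasure \<mu> (space \<mu>) = emeasure \<mu> (sobolev_ball m)"
    using \<mu>(2) by (intro emeasure_eq_AE) (auto simp: sets sp)
  also have "\<dots> \<le> emeasure \<mu> (\<Union>F\<in>T. U F)"
    using T(2,3) by (intro emeasure_mono) (auto simp: sets)
  also have "\<dots> \<le> (\<Sum>F\<in>T. emeasure \<mu> (U F))"
    using T(2) U(1) by (intro emeasure_subadditive_finite) (auto simp: sets)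
  also have "\<dots> < \<infinity>"
    using T(2) U(3) by (simp add: less_top[symmetric])
  finally show "emeasure \<mu> (space \<mu>) \<noteq> \<infinity>" by simp
qed

text \<open>The weights sit on moment vectors; choosing a preimage in the ball for each of them
  transports the weighted point measure to a measure on functions.\<close>

lemma moment_vector_atomic_moment_cone:
  fixes A :: "((int ^ 'n::finite) multiset) ^ 'N" and w :: "complex ^ 'N \<Rightarrow> real"
  assumes T: "finite T" "T \<subseteq> moment_vector A ` sobolev_ball m" and w: "\<And>x. x \<in> T \<Longrightarrow> 0 \<le> w x"
  shows "(\<Sum>x\<in>T. w x *\<^sub>R x) \<in> moment_cone m A"
proof -
  define G where "G = inv_into (sobolev_ball m) (moment_vector A)"
  have G: "G x \<in> sobolev_ball m" "moment_vector A (G x) = x" if "x \<in> T" for x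
    using that T(2) by (auto simp: G_def inv_into_into f_inv_into_f)
  define P where "P = point_measure T (\<lambda>x. ennreal (w x))"
  define \<mu> where "\<mu> = distr P borel G"
  have Gm [measurable]: "G \<in> measurable P borel"
    by (simp add: P_def)
  have sets: "sets \<mu> = sets borel" by (simp add: \<mu>_def)
  have em: "emeasure \<mu> E = (\<Sum>x\<in>G -` E \<inter> T. ennreal (w x))" if "E \<in> sets borel" for E
    unfolding \<mu>_def using T(1) that
    by (simp add: emeasure_distr P_def space_point_measure emeasure_point_measure_finite)
  have fin: "emeasure \<mu> UNIV < \<infinity>"
    using T(1) by (simp add: em less_top[symmetric])
  have "radon_measure \<mu>"
    unfolding radon_measure_def
  proof (intro conjI allI ballI)
    show "sets \<mu> = sets borel" by (rule sets)
    show "\<exists>U. open U \<and> F \<in> U \<and> emeasure \<mu> U < \<infinity>" for F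
      using fin by (intro exI[of _ UNIV]) simp
    fix E :: "'n L2 set" assume E: "E \<in> sets borel"
    have c: "compact (E \<inter> G ` T)" using T(1) by (intro finite_imp_compact) simp
    have cs: "E \<inter> G ` T \<in> sets borel" using compact_imp_closed[OF c] by simp
    \<comment> \<open>All mass lies on the finite set of chosen preimages, whose part in E is
      compact and already attains the supremum.\<close>
    have "emeasure \<mu> E = emeasure \<mu> (E \<inter> G ` T)"
      unfolding em[OF E] em[OF cs] by (intro sum.cong) auto
    also have "\<dots> \<le> (SUP K\<in>{K. compact K \<and> K \<subseteq> E}. emeasure \<mu> K)"
      using c by (intro SUP_upper) simp
    finally have "emeasure \<mu> E \<le> (SUP K\<in>{K. compact K \<and> K \<subseteq> E}. emeasure \<mu> K)" .
    moreover have "(SUP K\<in>{K. compact K \<and> K \<subseteq> E}. emeasure \<mu> K) \<le> emeasure \<mu> E"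
      using E by (intro SUP_least emeasure_mono) (auto simp: sets)
    ultimately show "emeasure \<mu> E = (SUP K\<in>{K. compact K \<and> K \<subseteq> E}. emeasure \<mu> K)"
      by (rule antisym)
  qed
  moreover have "AE F in \<mu>. F \<in> sobolev_ball m"
  proof (rule AE_I[of _ _ "- sobolev_ball m"])
    have "- sobolev_ball m \<in> sets (borel :: 'n L2 measure)" by (intro borel_comp) simp
    then have "emeasure \<mu> (- sobolev_ball m) = (\<Sum>x\<in>G -` (- sobolev_ball m) \<inter> T. ennreal (w x))" by (rule em)
    also have "G -` (- sobolev_ball m) \<inter> T = {}" using G by auto
    finally show "emeasure \<mu> (- sobolev_ball m) = 0" by simp
    show "- sobolev_ball m \<in> sets \<mu>" unfolding sets by (intro borel_comp) simp
  qed auto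
  moreover have "(LINT F:sobolev_ball m|\<mu>. (\<Prod>a\<in>#A $ j. fourier_coeff F a)) = (\<Sum>x\<in>T. w x *\<^sub>R x) $ j" for j
  proof -
    have "(LINT F:sobolev_ball m|\<mu>. monomial_at (A $ j) F) = (LINT x|P. indicator (sobolev_ball m) (G x) *\<^sub>R monomial_at (A $ j) (G x))"
      unfolding set_lebesgue_integral_def \<mu>_def by (rule integral_distr[OF Gm]) measurable
    also have "\<dots> = (\<Sum>x\<in>T. w x *\<^sub>R (indicator (sobolev_ball m) (G x) *\<^sub>R monomial_at (A $ j) (G x)))"
      unfolding P_def using T(1) w by (intro lebesgue_integral_point_measure_finite) auto
    also have "\<dots> = (\<Sum>x\<in>T. w x *\<^sub>R (x $ j))"
    proof (rule sum.cong[OF refl])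
      fix x assume x: "x \<in> T"
      have "monomial_at (A $ j) (G x) = x $ j" using arg_cong[OF G(2)[OF x], of "\<lambda>v. v $ j"] by (simp add: moment_vector_def)
      then show "w x *\<^sub>R (indicator (sobolev_ball m) (G x) *\<^sub>R monomial_at (A $ j) (G x)) = w x *\<^sub>R (x $ j)"
        using G(1)[OF x] by simp
    qed
    finally show ?thesis by (simp add: monomial_at_def)
  qed
  ultimately show ?thesis
    unfolding moment_cone_def by (auto simp: vec_eq_iff intro!: exI[of _ \<mu>])
qed

section \<open>The cone of moment vectors of finitely supported measures\<close>

definition atomic_cone :: "nat \<Rightarrow> ((int ^ 'n::finite) multiset) ^ 'N \<Rightarrow> (complex ^ 'N) set" where
  "atomic_cone m A = conic hull (convex hull (moment_vector A ` sobolev_ball m))"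

lemma convex_atomic_cone: "convex (atomic_cone m A)"
  unfolding atomic_cone_def by (intro convex_conic_hull convex_convex_hull)

lemma atomic_cone_scale: "F \<in> sobolev_ball m \<Longrightarrow> 0 \<le> t \<Longrightarrow> t *\<^sub>R moment_vector A F \<in> atomic_cone m A"
  unfolding atomic_cone_def
  by (intro conic_mul conic_conic_hull hull_inc imageI)

lemma atomic_cone_subset_moment_cone: "atomic_cone m A \<subseteq> moment_cone m A"
proof
  fix z assume "z \<in> atomic_cone m A"
  then obtain c x where c: "0 \<le> c" "z = c *\<^sub>R x" "x \<in> convex hull (moment_vector A ` sobolev_ball m)"
    by (auto simp: atomic_cone_def conic_hull_explicit)
  then obtain T u where T: "finite T" "T \<subseteq> moment_vector A ` sobolev_ball m" "\<And>v. v \<in> T \<Longrightarrow> 0 \<le> u v" "x = (\<Sum>v\<in>T. u v *\<^sub>R v)"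
    unfolding convex_hull_explicit by auto
  have "z = (\<Sum>v\<in>T. (c * u v) *\<^sub>R v)" by (simp add: c T scaleR_sum_right)
  also have "\<dots> \<in> moment_cone m A"
    using c T by (intro moment_vector_atomic_moment_cone) auto
  finally show "z \<in> moment_cone m A" .
qed

lemma zero_sobolev_ball:
  obtains F :: "('n::finite) L2" where "F \<in> sobolev_ball m"
proof -
  have "ball_point m 0 (\<lambda>_ :: int ^ 'n. 0)" by (simp add: ball_point_def hermitian_point_def)
  then show thesis using sobolev_ball_trigpoly that by blast
qed

text \<open>The empty collection gives a coordinate that is constantly 1, so the compact convex hull
  lies in a hyperplane missing 0, and the cone over a compact set without 0 is closed.\<close>

lemma closed_atomic_cone:
  assumes "0 < m" and j: "A $ j = {#}"
  shows "closed (atomic_cone m A)"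
proof -
  have "compact (moment_vector A ` sobolev_ball m)"
    by (intro compact_continuous_image continuous_on_moment_vector compact_sobolev_ball assms)
  then have "compact (convex hull (moment_vector A ` sobolev_ball m))" by (rule compact_convex_hull)
  moreover have "0 \<notin> convex hull (moment_vector A ` sobolev_ball m)"
  proof
    assume "0 \<in> convex hull (moment_vector A ` sobolev_ball m)"
    moreover have "convex hull (moment_vector A ` sobolev_ball m) \<subseteq> {v. axis j 1 \<bullet> v = 1}"
      using j by (intro hull_minimal convex_hyperplane) (auto simp: moment_vector_def monomial_at_def inner_axis' inner_complex_def)
    ultimately show False by auto
  qed
  ultimately show ?thesis
    unfolding atomic_cone_def by (intro closed_conic_hull_strong) simp
qed

text \<open>Bipolar argument: separation provides an affine inequality, and invariance of the cone
  under scaling makes it homogeneous.\<close>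

lemma closure_atomic_coneI:
  fixes z :: "complex ^ 'N"
  assumes sep: "\<And>b. (\<And>F. F \<in> sobolev_ball m \<Longrightarrow> 0 \<le> b \<bullet> moment_vector A F) \<Longrightarrow> 0 \<le> b \<bullet> z"
  shows "z \<in> closure (atomic_cone m (A :: ((int ^ 'n::finite) multiset) ^ 'N))"
proof (rule ccontr)
  assume "z \<notin> closure (atomic_cone m A)"
  then obtain b c where b: "b \<bullet> z < c" "\<And>x. x \<in> closure (atomic_cone m A) \<Longrightarrow> c < b \<bullet> x"
    using separating_hyperplane_closed_point[of "closure (atomic_cone m A)" z] convex_closure[OF convex_atomic_cone]
    by blast
  have lt: "c < t * (b \<bullet> moment_vector A F)" if "F \<in> sobolev_ball m" "0 \<le> t" for F t
    using b(2)[of "t *\<^sub>R moment_vector A F"] atomic_cone_scale[OF that] closure_subset by auto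
  obtain F0 :: "'n L2" where "F0 \<in> sobolev_ball m" by (rule zero_sobolev_ball)
  then have c: "c < 0" using lt[of F0 0] by simp
  have "0 \<le> b \<bullet> moment_vector A F" if F: "F \<in> sobolev_ball m" for F
  proof (rule ccontr)
    assume neg: "\<not> 0 \<le> b \<bullet> moment_vector A F"
    \<comment> \<open>The scaling factor is chosen so that the scaled value equals c itself,
      contradicting strict separation.\<close>
    have "c < (c / (b \<bullet> moment_vector A F)) * (b \<bullet> moment_vector A F)"
      using neg c by (intro lt F) (simp add: divide_nonpos_neg)
    then show False using neg by simp
  qed
  then have "0 \<le> b \<bullet> z" by (rule sep)
  then show False using b(1) c by simp
qed

lemma moment_cone_subset:
  assumes m: "0 < m"
  shows "moment_cone m A \<subseteq> closure (atomic_cone m (A :: ((int ^ 'n::finite) multiset) ^ 'N))"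
proof
  fix z assume "z \<in> moment_cone m A"
  then obtain \<mu> :: "'n L2 measure" where \<mu>: "radon_measure \<mu>" "AE F in \<mu>. F \<in> sobolev_ball m"
    and z: "z = (\<chi> j. LINT F:sobolev_ball m|\<mu>. monomial_at (A $ j) F)"
    by (auto simp: moment_cone_def monomial_at_def)
  interpret finite_measure \<mu> by (rule radon_measure_ball_finite[OF m \<mu>])
  have sets [measurable_cong]: "sets \<mu> = sets borel" using \<mu>(1) by (simp add: radon_measure_def)
  let ?g = "\<lambda>j F. indicator (sobolev_ball m) F *\<^sub>R monomial_at (A $ j) F"
  have int: "integrable \<mu> (?g j)" for j
    by (rule integrable_const_bound[of _ 1]) (auto simp: indicator_def monomial_at_le_1)
  show "z \<in> closure (atomic_cone m A)"
  proof (rule closure_atomic_coneI)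
    fix b :: "complex ^ 'N" assume b: "\<And>F. F \<in> sobolev_ball m \<Longrightarrow> 0 \<le> b \<bullet> moment_vector A F"
    have "b \<bullet> z = (\<Sum>j\<in>UNIV. LINT F|\<mu>. b $ j \<bullet> ?g j F)"
      unfolding inner_vec_def z set_lebesgue_integral_def
      by (intro sum.cong refl) (simp only: vec_lambda_beta integral_inner_right[OF int])
    also have "\<dots> = (LINT F|\<mu>. (\<Sum>j\<in>UNIV. b $ j \<bullet> ?g j F))"
      by (rule Bochner_Integration.integral_sum[symmetric]) (intro integrable_inner_right int)
    also have "\<dots> = (LINT F|\<mu>. indicator (sobolev_ball m) F * (b \<bullet> moment_vector A F))"
      by (simp add: inner_vec_def moment_vector_def sum_distrib_left)
    also have "0 \<le> \<dots>"
      using b by (intro integral_nonneg_AE AE_I2) (auto simp: indicator_def)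
    finally show "0 \<le> b \<bullet> z" .
  qed
qed

lemma outer_cone_subset: "outer_cone m A \<subseteq> closure (atomic_cone m (A :: ((int ^ 'n::finite) multiset) ^ 'N))"
proof
  fix z assume "z \<in> outer_cone m A"
  then obtain y where z: "z = (\<chi> j. y (A $ j))" and y: "\<And>p. p \<in> quad_module_inf m \<Longrightarrow> riesz y p \<in> \<real>\<^sub>\<ge>\<^sub>0"
    by (auto simp: outer_cone_def)
  show "z \<in> closure (atomic_cone m A)"
  proof (rule closure_atomic_coneI)
    fix b :: "complex ^ 'N" assume b: "\<And>F. F \<in> sobolev_ball m \<Longrightarrow> 0 \<le> b \<bullet> moment_vector A F"
    \<comment> \<open>The conjugated coefficients make the real part of p at a point the real inner
      product of b with the moment vector there.\<close>
    define p where "p = (\<Sum>j\<in>UNIV. Poly_Mapping.single (A $ j) (cnj (b $ j)))"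
    have re: "Re (cnj u * v) = u \<bullet> v" for u v by (simp add: inner_complex_def)
    obtain \<rho> where \<rho>: "(\<Union>j. set_mset (A $ j)) \<subseteq> freqs \<rho>"
      using finite_subset_freqs[of "\<Union>j. set_mset (A $ j)"] by auto
    have "p \<in> band \<rho>"
      unfolding p_def using \<rho> by (intro band_sum band_single) (auto simp: freqs_def)
    moreover have "0 \<le> Re (eval_cpoly c p)" if c: "ball_point m \<rho> c" for c
    proof -
      obtain F where F: "F \<in> sobolev_ball m" "fourier_coeff F = c" by (rule sobolev_ball_trigpoly[OF c])
      have "Re (eval_cpoly c p) = b \<bullet> moment_vector A F"
        by (simp add: p_def eval_cpoly_sum eval_cpoly_single re[symmetric] inner_vec_def moment_vector_def monomial_at_def F(2) del: times_complex.sel)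
      then show ?thesis using b[OF F(1)] by simp
    qed
    ultimately have "0 \<le> Re (riesz y p)" using y by (intro riesz_nonneg_on_ball)
    also have "Re (riesz y p) = b \<bullet> z"
      by (simp add: p_def riesz_sum re[symmetric] inner_vec_def z del: times_complex.sel)
    finally show "0 \<le> b \<bullet> z" .
  qed
qed

section \<open>Moment sequences of contracted measures\<close>

text \<open>
  Splitting off one element embeds the nonempty multisets into pairs, which yields a geometric series.
\<close>

lemma sum_prod_mset_le:
  fixes x :: "'a \<Rightarrow> real"
  assumes D: "finite D" and x: "\<And>a. a \<in> D \<Longrightarrow> 0 \<le> x a" and s: "sum x D \<le> s" "s < 1"
    and S: "finite S" "\<And>\<alpha>. \<alpha> \<in> S \<Longrightarrow> set_mset \<alpha> \<subseteq> D"
  shows "(\<Sum>\<alpha>\<in>S. \<Prod>a\<in>#\<alpha>. x a) \<le> 1 / (1 - s)"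
proof -
  have s0: "0 \<le> s" using sum_nonneg[of D x] x s by fastforce
  have nn: "0 \<le> (\<Prod>a\<in>#\<alpha>. x a)" if "set_mset \<alpha> \<subseteq> D" for \<alpha>
    using that x by (induction \<alpha>) auto
  \<comment> \<open>The size bound d drives the induction, as removing an element lowers it. The
    constant 1 / (1 - s) is the fixed point of v = 1 + s v.\<close>
  have main: "(\<Sum>\<alpha>\<in>S. \<Prod>a\<in>#\<alpha>. x a) \<le> 1 / (1 - s)"
    if "finite S" "\<And>\<alpha>. \<alpha> \<in> S \<Longrightarrow> set_mset \<alpha> \<subseteq> D \<and> size \<alpha> \<le> d" for S d
    using that
  proof (induction d arbitrary: S)
    case 0
    then have "S \<subseteq> {{#}}" by auto
    then have "S = {} \<or> S = {{#}}" by blast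
    then show ?case using s s0 by (auto simp: field_simps)
  next
    case (Suc d)
    \<comment> \<open>All remainders of members of S after removal of one element. A multiset may
      arise from several pairs, which only enlarges the upper bound.\<close>
    define S' where "S' = {\<beta>. set_mset \<beta> \<subseteq> D \<and> (\<exists>a\<in>D. add_mset a \<beta> \<in> S)}"
    have "S' \<subseteq> (\<lambda>(a, \<alpha>). \<alpha> - {#a#}) ` (D \<times> S)"
      by (force simp: S'_def)
    then have S': "finite S'" using D Suc.prems(1) finite_subset by blast
    have "S - {{#}} \<subseteq> (\<lambda>(a, \<beta>). add_mset a \<beta>) ` (D \<times> S')"
    proof
      fix \<alpha> assume \<alpha>: "\<alpha> \<in> S - {{#}}"
      then obtain a \<beta> where ab: "\<alpha> = add_mset a \<beta>" by (cases \<alpha>) auto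
      moreover have "a \<in> D" "\<beta> \<in> S'" using \<alpha> ab Suc.prems(2)[of \<alpha>] by (auto simp: S'_def)
      ultimately show "\<alpha> \<in> (\<lambda>(a, \<beta>). add_mset a \<beta>) ` (D \<times> S')" by auto
    qed
    then have "(\<Sum>\<alpha>\<in>S - {{#}}. \<Prod>a\<in>#\<alpha>. x a) \<le> (\<Sum>\<alpha>\<in>(\<lambda>(a, \<beta>). add_mset a \<beta>) ` (D \<times> S'). \<Prod>a\<in>#\<alpha>. x a)"
      using D S' by (intro sum_mono2 nn) (auto simp: S'_def)
    also have "\<dots> \<le> (\<Sum>(a, \<beta>)\<in>D \<times> S'. x a * (\<Prod>a\<in>#\<beta>. x a))"
      using D S' x nn sum_image_le[of "D \<times> S'" "\<lambda>\<alpha>. \<Prod>a\<in>#\<alpha>. x a" "\<lambda>(a, \<beta>). add_mset a \<beta>"]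
      by (auto simp: S'_def case_prod_beta comp_def)
    also have "\<dots> = sum x D * (\<Sum>\<beta>\<in>S'. \<Prod>a\<in>#\<beta>. x a)"
      by (simp add: sum.cartesian_product[symmetric] sum_product)
    also have "\<dots> \<le> s * (1 / (1 - s))"
    proof (rule mult_mono)
      show "(\<Sum>\<beta>\<in>S'. \<Prod>a\<in>#\<beta>. x a) \<le> 1 / (1 - s)"
        using Suc.prems(2) by (intro Suc.IH S') (force simp: S'_def)
      show "0 \<le> (\<Sum>\<beta>\<in>S'. \<Prod>a\<in>#\<beta>. x a)"
        by (intro sum_nonneg nn) (auto simp: S'_def)
    qed (use s s0 in auto)
    finally have le: "(\<Sum>\<alpha>\<in>S - {{#}}. \<Prod>a\<in>#\<alpha>. x a) \<le> s * (1 / (1 - s))" .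
    have "(\<Sum>\<alpha>\<in>S. \<Prod>a\<in>#\<alpha>. x a) \<le> (\<Sum>\<alpha>\<in>insert {#} (S - {{#}}). \<Prod>a\<in>#\<alpha>. x a)"
      using Suc.prems by (intro sum_mono2) auto
    also have "\<dots> = 1 + (\<Sum>\<alpha>\<in>S - {{#}}. \<Prod>a\<in>#\<alpha>. x a)"
      using Suc.prems(1) by (subst sum.insert) auto
    also have "\<dots> \<le> 1 + s * (1 / (1 - s))" using le by simp
    also have "\<dots> = 1 / (1 - s)" using s by (simp add: field_simps)
    finally show ?case .
  qed
  show ?thesis
  proof (rule main[OF S(1), of "\<Sum>\<alpha>\<in>S. size \<alpha>"])
    fix \<alpha> assume "\<alpha> \<in> S"
    then show "set_mset \<alpha> \<subseteq> D \<and> size \<alpha> \<le> (\<Sum>\<alpha>\<in>S. size \<alpha>)"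
      using S by (auto intro: member_le_sum)
  qed
qed

lemma eval_cpoly_sos:
  assumes "p \<in> sos r \<rho>" and z: "hermitian_point z"
  shows "eval_cpoly z p \<in> \<real>\<^sub>\<ge>\<^sub>0"
proof -
  obtain q K where p: "p = (\<Sum>k<(K::nat). hermitian_conj (q k) * q k)" using assms by (auto simp: sos_def)
  have "eval_cpoly z p = of_real (\<Sum>k<K. (cmod (eval_cpoly z (q k)))\<^sup>2)"
    by (simp add: p eval_cpoly_sum eval_cpoly_mult eval_cpoly_hermitian_conj[OF z] complex_norm_square mult.commute del: of_real_power)
  also have "\<dots> \<in> \<real>\<^sub>\<ge>\<^sub>0" by (simp only: nonneg_Reals_of_real_iff sum_nonneg zero_le_power2)
  finally show ?thesis .
qed

text \<open>The point may have infinitely many nonzero coordinates, since it will be the full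
  coefficient family of a function; the constraint is therefore required at every level.\<close>

lemma eval_cpoly_quad_module_inf:
  assumes p: "p \<in> quad_module_inf m" and z: "hermitian_point z"
    and le: "\<And>\<rho>. (\<Sum>a\<in>freqs \<rho>. weight m a * (cmod (z a))\<^sup>2) \<le> 1"
  shows "eval_cpoly z p \<in> \<real>\<^sub>\<ge>\<^sub>0"
proof -
  obtain r \<rho> s t where st: "p = s + t * ball_poly m \<rho>" "s \<in> sos (int r) \<rho>" "t \<in> sos (int r - 1) \<rho>"
    using p by (auto simp: quad_module_inf_def quad_module_def)
  have "eval_cpoly z (ball_poly m \<rho>) \<in> \<real>\<^sub>\<ge>\<^sub>0"
    unfolding eval_cpoly_ball_poly[OF z] by (simp only: nonneg_Reals_of_real_iff) (simp add: le)
  then show ?thesis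
    using eval_cpoly_sos[OF st(2) z] eval_cpoly_sos[OF st(3) z] by (simp add: st(1) eval_cpoly_add eval_cpoly_mult)
qed

text \<open>Contraction is what makes the family square-summable: point mass at the constant
  function 1 has moment 1 on every power of c_0. After contraction by t the squared coordinates of a
  ball point sum to at most t^2, and the squared monomials to at most 1 / (1 - t^2).\<close>

lemma moment_cone_subset_closure_outer_cone:
  assumes m: "0 < m"
  shows "moment_cone m A \<subseteq> closure (outer_cone m (A :: ((int ^ 'n::finite) multiset) ^ 'N))"
proof
  fix z assume "z \<in> moment_cone m A"
  then obtain \<mu> :: "'n L2 measure" where \<mu>: "radon_measure \<mu>" "AE F in \<mu>. F \<in> sobolev_ball m"
    and z: "z = (\<chi> j. LINT F:sobolev_ball m|\<mu>. monomial_at (A $ j) F)"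
    by (auto simp: moment_cone_def monomial_at_def)
  interpret finite_measure \<mu> by (rule radon_measure_ball_finite[OF m \<mu>])
  have sets [measurable_cong]: "sets \<mu> = sets borel" using \<mu>(1) by (simp add: radon_measure_def)
  let ?B = "sobolev_ball m :: 'n L2 set"
  let ?g = "\<lambda>\<alpha> F. indicator ?B F *\<^sub>R monomial_at \<alpha> F"
  have int: "integrable \<mu> (?g \<alpha>)" for \<alpha>
    by (rule integrable_const_bound[of _ 1]) (auto simp: indicator_def monomial_at_le_1)
  define M where "M = measure \<mu> (space \<mu>)"
  \<comment> \<open>These are the moments of the image of the measure under F to t F, written down
    without forming that measure.\<close>
  define y where "y t \<alpha> = of_real (t ^ size \<alpha>) * (LINT F|\<mu>. ?g \<alpha> F)" for t :: real and \<alpha>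
  have outer: "(\<chi> j. y t (A $ j)) \<in> outer_cone m A" if t: "0 < t" "t < 1" for t
  proof -
    have "integrable \<mu> (\<lambda>F. indicator ?B F *\<^sub>R eval_cpoly (\<lambda>a. of_real t * fourier_coeff F a) p) \<and>
        riesz (y t) p = (LINT F|\<mu>. indicator ?B F *\<^sub>R eval_cpoly (\<lambda>a. of_real t * fourier_coeff F a) p)" for p
    proof (induction p rule: cpoly_induct)
      case (single \<alpha> c)
      have "(\<Prod>a\<in>#\<alpha>. of_real t * fourier_coeff F a) = of_real (t ^ size \<alpha>) * monomial_at \<alpha> F" for F
        unfolding monomial_at_def by (induction \<alpha>) simp_all
      then have eq: "indicator ?B F *\<^sub>R eval_cpoly (\<lambda>a. of_real t * fourier_coeff F a) (Poly_Mapping.single \<alpha> c)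
          = (c * of_real (t ^ size \<alpha>)) * ?g \<alpha> F" for F
        by (simp add: eval_cpoly_single scaleR_conv_of_real mult_ac)
      show ?case
        unfolding eq riesz_single y_def
        by (intro conjI integrable_mult_right int) (simp only: integral_mult_right_zero mult.assoc)
    next
      case (add p q)
      then show ?case by (simp add: eval_cpoly_add riesz_add scaleR_add_right)
    qed
    note riesz = this
    have "riesz (y t) p \<in> \<real>\<^sub>\<ge>\<^sub>0" if p: "p \<in> quad_module_inf m" for p
    proof -
      let ?h = "\<lambda>F. indicator ?B F *\<^sub>R eval_cpoly (\<lambda>a. of_real t * fourier_coeff F a) p"
      have h: "?h F \<in> \<real>\<^sub>\<ge>\<^sub>0" for F
      proof (cases "F \<in> ?B")
        case True
        have "(\<Sum>a\<in>freqs \<rho>. weight m a * (cmod (of_real t * fourier_coeff F a))\<^sup>2) \<le> 1" for \<rho>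
        proof -
          have "(\<Sum>a\<in>freqs \<rho>. weight m a * (cmod (of_real t * fourier_coeff F a))\<^sup>2)
             = t\<^sup>2 * (\<Sum>a\<in>freqs \<rho>. weight m a * (cmod (fourier_coeff F a))\<^sup>2)"
            by (simp add: sum_distrib_left norm_mult power_mult_distrib mult_ac)
          also have "\<dots> \<le> 1"
            using True t by (intro mult_le_one sum_nonneg) (auto simp: sobolev_ball_iff weight_nonneg power_le_one)
          finally show ?thesis .
        qed
        moreover have "hermitian_point (\<lambda>a. of_real t * fourier_coeff F a)"
          using True by (simp add: hermitian_point_def sobolev_ball_iff hermitian_coeffs_def)
        ultimately show ?thesis using True eval_cpoly_quad_module_inf[OF p] by simp
      qed simp
      then have "0 \<le> Re (?h F)" "Im (?h F) = 0" for F
        using h[of F] unfolding complex_nonneg_Reals_iff by blast+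
      then have "0 \<le> (LINT F|\<mu>. Re (?h F))" "(LINT F|\<mu>. Im (?h F)) = 0"
        by (simp_all only: integral_nonneg_AE AE_I2 integral_zero)
      then show ?thesis
        using riesz[of p] unfolding complex_nonneg_Reals_iff by (simp only: integral_Re integral_Im)
    qed
    moreover have "(\<lambda>\<alpha>. (cmod (y t \<alpha>))\<^sup>2) summable_on UNIV"
    proof (rule nonneg_bdd_above_summable_on)
      show "bdd_above (sum (\<lambda>\<alpha>. (cmod (y t \<alpha>))\<^sup>2) ` {S. S \<subseteq> UNIV \<and> finite S})"
      proof (rule bdd_aboveI, clarify)
        fix S :: "(int ^ 'n) multiset set" assume S: "finite S"
        let ?q = "\<lambda>\<alpha> F. indicator ?B F * (t ^ (2 * size \<alpha>) * (cmod (monomial_at \<alpha> F))\<^sup>2)"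
        have iq: "integrable \<mu> (?q \<alpha>)" for \<alpha>
        proof (rule integrable_const_bound[of _ 1])
          have "t ^ (2 * size \<alpha>) * (cmod (monomial_at \<alpha> F))\<^sup>2 \<le> 1" if "F \<in> ?B" for F
            using t monomial_at_le_1[OF that] by (intro mult_le_one power_le_one) auto
          then show "AE F in \<mu>. norm (?q \<alpha> F) \<le> 1"
            using t by (intro AE_I2) (auto simp: indicator_def)
        qed measurable
        \<comment> \<open>Cauchy-Schwarz moves the square under the integral, where the sum over
          collections is bounded pointwise.\<close>
        have y2: "(cmod (y t \<alpha>))\<^sup>2 \<le> M * (LINT F|\<mu>. ?q \<alpha> F)" for \<alpha>
        proof -
          have "cmod (y t \<alpha>) = t ^ size \<alpha> * cmod (LINT F|\<mu>. ?g \<alpha> F)"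
            using t by (simp add: y_def norm_mult norm_power)
          also have "\<dots> \<le> t ^ size \<alpha> * (LINT F|\<mu>. cmod (?g \<alpha> F))"
            using t by (intro mult_left_mono integral_norm_bound) auto
          also have "\<dots> = (LINT F|\<mu>. t ^ size \<alpha> * cmod (?g \<alpha> F))" by simp
          finally have "(cmod (y t \<alpha>))\<^sup>2 \<le> (LINT F|\<mu>. t ^ size \<alpha> * cmod (?g \<alpha> F))\<^sup>2"
            by (intro power_mono) auto
          also have "\<dots> \<le> M * (LINT F|\<mu>. (t ^ size \<alpha> * cmod (?g \<alpha> F))\<^sup>2)"
          proof -
            have eq: "(t ^ size \<alpha> * cmod (?g \<alpha> F))\<^sup>2 = ?q \<alpha> F" for F
              by (auto simp: indicator_def power_mult_distrib power_mult[symmetric] mult.commute)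
            show ?thesis
              unfolding M_def
            proof (rule integral_square_le)
              show "integrable \<mu> (\<lambda>F. (t ^ size \<alpha> * cmod (?g \<alpha> F))\<^sup>2)" unfolding eq by (rule iq)
            qed measurable
          qed
          also have "(\<lambda>F. (t ^ size \<alpha> * cmod (?g \<alpha> F))\<^sup>2) = ?q \<alpha>"
            by (auto simp: indicator_def power_mult_distrib power_mult[symmetric] mult.commute)
          finally show ?thesis .
        qed
        obtain \<rho> where \<rho>: "(\<Union>\<alpha>\<in>S. set_mset \<alpha>) \<subseteq> freqs \<rho>"
          using finite_subset_freqs[of "\<Union>\<alpha>\<in>S. set_mset \<alpha>"] S by auto
        have bound: "(\<Sum>\<alpha>\<in>S. ?q \<alpha> F) \<le> 1 / (1 - t\<^sup>2)" for F
        proof (cases "F \<in> ?B")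
          case True
          have eq: "?q \<alpha> F = (\<Prod>a\<in>#\<alpha>. t\<^sup>2 * (cmod (fourier_coeff F a))\<^sup>2)" for \<alpha>
            using True unfolding monomial_at_def
            by (induction \<alpha>) (simp_all add: norm_mult power_mult_distrib power2_eq_square mult_ac)
          have "(\<Sum>a\<in>freqs \<rho>. t\<^sup>2 * (cmod (fourier_coeff F a))\<^sup>2) \<le> t\<^sup>2 * (\<Sum>a\<in>freqs \<rho>. weight m a * (cmod (fourier_coeff F a))\<^sup>2)"
            unfolding sum_distrib_left
            by (intro sum_mono mult_left_mono) (simp_all add: mult_le_cancel_right1 weight_ge_1)
          also have "\<dots> \<le> t\<^sup>2 * 1"
            using True by (intro mult_left_mono) (auto simp: sobolev_ball_iff)
          finally have le: "(\<Sum>a\<in>freqs \<rho>. t\<^sup>2 * (cmod (fourier_coeff F a))\<^sup>2) \<le> t\<^sup>2" by simp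
          show ?thesis
            unfolding eq using t \<rho> S by (intro sum_prod_mset_le[OF _ _ le]) (auto simp: power_less_one_iff)
        next
          case False
          then show ?thesis using t by (simp add: power_le_one)
        qed
        have "(\<Sum>\<alpha>\<in>S. (cmod (y t \<alpha>))\<^sup>2) \<le> (\<Sum>\<alpha>\<in>S. M * (LINT F|\<mu>. ?q \<alpha> F))"
          by (intro sum_mono y2)
        also have "\<dots> = M * (LINT F|\<mu>. (\<Sum>\<alpha>\<in>S. ?q \<alpha> F))"
          by (subst Bochner_Integration.integral_sum) (simp_all only: iq sum_distrib_left)
        also have "\<dots> \<le> M * (LINT F|\<mu>. 1 / (1 - t\<^sup>2))"
          by (intro mult_left_mono integral_mono bound Bochner_Integration.integrable_sum iq) (simp_all add: M_def)
        finally show "(\<Sum>\<alpha>\<in>S. (cmod (y t \<alpha>))\<^sup>2) \<le> M * (LINT F|\<mu>. 1 / (1 - t\<^sup>2))" .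
      qed
    qed simp
    ultimately show ?thesis unfolding outer_cone_def by blast
  qed
  \<comment> \<open>The shift by 2 keeps every factor strictly between 0 and 1.\<close>
  define t where "t k = 1 - 1 / real (k + 2)" for k
  have t: "0 < t k" "t k < 1" for k by (auto simp: t_def field_simps)
  have "t \<longlonglongrightarrow> 1 - 0"
    unfolding t_def by (intro tendsto_diff tendsto_const LIMSEQ_ignore_initial_segment lim_const_over_n[of 1])
  then have "(\<lambda>k. y (t k) \<alpha>) \<longlonglongrightarrow> of_real (1 ^ size \<alpha>) * (LINT F|\<mu>. ?g \<alpha> F)" for \<alpha>
    unfolding y_def by (intro tendsto_intros) simp
  then have "(\<lambda>k. \<chi> j. y (t k) (A $ j)) \<longlonglongrightarrow> z"
    by (intro vec_tendstoI) (simp add: z set_lebesgue_integral_def)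
  then show "z \<in> closure (outer_cone m A)"
    unfolding closure_sequential using outer[OF t] by (intro exI[of _ "\<lambda>k. \<chi> j. y (t k) (A $ j)"]) simp
qed

text \<open>Outer, atomic and moment cone form a cycle, each contained in the closure of the next,
  so their closures agree. With an empty entry the atomic cone is closed and coincides with the
  moment cone.\<close>

theorem proposition6:
  fixes m :: nat and A :: "((int ^ 'n) multiset) ^ 'N"
  assumes "m > 0"
  shows "((\<exists>j. A $ j = {#}) \<longrightarrow> closure (outer_cone m A) = moment_cone m A) \<and>
         closure (outer_cone m A) = closure (moment_cone m A)"
proof -
  note 1 = moment_cone_subset[OF assms, of A] and 2 = outer_cone_subset[of m A]
    and 3 = atomic_cone_subset_moment_cone[of m A]
    and 4 = moment_cone_subset_closure_outer_cone[OF assms, of A]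
  have "closure (outer_cone m A) \<subseteq> closure (atomic_cone m A)"
    using closure_minimal[OF 2] by simp
  moreover have "closure (atomic_cone m A) \<subseteq> closure (moment_cone m A)"
    using 3 by (rule closure_mono)
  moreover have "closure (moment_cone m A) \<subseteq> closure (outer_cone m A)"
    using closure_minimal[OF 4] by simp
  ultimately have eq: "closure (outer_cone m A) = closure (moment_cone m A)"
    "closure (outer_cone m A) = closure (atomic_cone m A)" by auto
  have "closure (outer_cone m A) = moment_cone m A" if "A $ j = {#}" for j
    using eq 1 3 closure_closed[OF closed_atomic_cone[OF assms that]] by simp
  with eq(1) show ?thesis by blast
qed

end
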